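(* Let $n\ge 6$. Each $(2,n)$-BCFW cell $S$ of $\mathrm{Gr}_{2,n}^{\ge 0}$ is $S_D$ for a $\oplus$-diagram $D$ belonging to one of the following nine classes, and every $V\in S$ is the row span of a $2\times n$ matrix with rows $d$ (first row) and $e$ (second row) with the sign pattern listed for that class. Notation for diagrams (columns from left to right): $[x/y]$ is a column of height $2$ with $x$ above $y$; $[x]$ is a column of height $1$ (first row only); $Z_2$, $Z_1$ denote a possibly empty block of columns of height $2$, respectively $1$, filled with $0$'s. Notation for sign patterns: $\mid$ denotes a possibly empty block of columns that are zero in both rows, and $+,-,0$ denote a positive, negative, zero entry. Class 1: $[+/+]\,Z_2\,[0/+][0/+]\,Z_2\,[0/+]\,Z_1\,[+][+]\,Z_1\,[+]$; $d:\ \mid ++\mid ++\mid 00\mid 00\mid -$, $e:\ \mid 00\mid 00\mid ++\mid ++\mid +$. Class 2: $[+/+]\,Z_2\,[0/+][0/+]\,Z_2\,[+/+][+]\,Z_1\,[+]$; $d:\ \mid ++\mid ++0\mid 00\mid -$, $e:\ \mid 00\mid 0++\mid ++\mid +$. Class 3: $[+/+]\,Z_2\,[0/+][+/+]\,Z_2\,[+/+]\,Z_1\,[+]$; $d:\ \mid ++\mid ++\mid 00\mid -$, $e:\ \mid 00\mid ++\mid ++\mid +$. Class 4: $[+/+]\,Z_2\,[+/+][+/+]\,Z_2\,[0/+]\,Z_1\,[+]$; $d:\ \mid ++\mid 00\mid --\mid -$, $e:\ \mid ++\mid ++\mid ++\mid 0$. Class 5: $[+/+]\,Z_2\,[+/0][+/+][0/+]\,Z_2\,[0/+]\,Z_1\,[+]$;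 $d:\ \mid ++\mid 00\mid 0--\mid -$, $e:\ \mid ++\mid ++\mid ++0\mid 0$. Class 6: $[+/+]\,Z_2\,[+/0][+/0]\,Z_2\,[0/+][0/+]\,Z_2\,[0/+]\,Z_1\,[+]$; $d:\ \mid ++\mid 00\mid 00\mid --\mid -$, $e:\ \mid ++\mid ++\mid ++\mid 00\mid 0$. Class 7: $[+/+]\,Z_2\,[+/0][+/0]\,Z_2\,[0/+][0/+]\,Z_2\,[+/+]$; $d:\ \mid ++0\mid 00\mid --\mid -$, $e:\ \mid +++\mid ++\mid 00\mid 0$. Class 8: $[+/+]\,Z_2\,[+/0][+/+][0/+]\,Z_2\,[+/+]$; $d:\ \mid ++0\mid 0--\mid -$, $e:\ \mid +++\mid ++0\mid 0$. Class 9: $[+/+]\,Z_2\,[+/+][+/+]\,Z_2\,[+/+]$; $d:\ \mid ++0\mid --\mid -$, $e:\ \mid +++\mid ++\mid 0$. In particular $d$ is orthodox in Classes 1–3 and deviant in Classes 4–9; call $V$ orthodox or deviant accordingly. Moreover, there are linearly independent positive dominoes $d^{(1)},d^{(2)},d^{(3)},d^{(4)}\in\mathbb R^n$, with indices $i_1,i_2,i_3,i_4$ respectively, such that: * if $V$ is orthodox, then $i_1+1<i_2\le i_3<i_4-1$, $\overline d=d^{(1)}+d^{(2)}$ with $d_n<0$, and $\overline e=d^{(3)}+d^{(4)}$ with $e_n>0$; * if $V$ is deviant, then $i_1+1<i_2+1<i_3\le i_4$, $\overline d=d^{(1)}-d^{(4)}$ with $d_n<0$, and $e=d^{(1)}+d^{(2)}+d^{(3)}$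 (with $e_n=0$).
   Context: $\mathrm{Gr}_{k,n}$ is the real Grassmannian of $k$-dimensional subspaces of $\mathbb R^n$ (row spans of $k\times n$ matrices); $\mathrm{Gr}_{k,n}^{\ge 0}$ is the set of $V$ representable by a matrix all of whose $k\times k$ minors are nonnegative. $[n]=\{1,\dots,n\}$. **Dominoes.** For $1\le i\le n-1$, an $i$-domino is $d\in\mathbb R^n$ with $d_j=0$ for $j\ne i,i+1$ and $d_i,d_{i+1}$ nonzero of the same sign; an $n$-domino is a vector whose only nonzero coordinate is the $n$th. $i$ is its index, and the common sign of its nonzero entries is its sign. For $v\in\mathbb R^n$, $\overline v$ is $v$ with the $n$th coordinate set to $0$. $v$ is orthodox if $\overline v$ is a sum of two nonzero dominoes of the same sign with disjoint supports, and deviant if $\overline v$ is a difference of two such dominoes. **Decorated permutations and positroid cells.** A decorated permutation of $[n]$ is a permutation of $[n]$ with each fixed point colored black or white. For $V\in\mathrm{Gr}_{k,n}^{\ge 0}$ represented by a matrix with columns $v_1,\dots,v_n$, put $v_{j+n}=v_j$; the decorated permutation $\pi_V$ sends $i$ to the residue in $[n]$ mod $n$ of the smallest $j\ge i$ with $v_i\in\mathrm{span}(v_{i+1},\dots,v_j)$ (so $j=i$ iff $v_i=0$); a fixed point $i$ is black if $j=i$ and white if $j=i+n$. The positroid cell of $\pi$ is $S_\pi=\{V:\pi_V=\pi\}$. **$\oplus$-diagrams.** A $\oplus$-diagram $D$ of type $(k,n)$ is a filling with symbols $0,+$ of a Young diagram (English notation) inside a $k\times(n-k)$ rectangle. Its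 decorated permutation $\pi_D$: label the $n$ unit steps of the southeast border of the Young diagram (a lattice path from the northeast to the southwest corner of the rectangle) by $1,\dots,n$, and label each edge of the northwest border by the label of the opposite edge (same row or column) of the southeast border. A pipe starts at each southeast border edge and travels northwest: in a box with $0$ it goes straight; in a box with $+$, a pipe entering through the right edge leaves through the top edge and a pipe entering through the bottom edge leaves through the left edge. If the pipe starting at $i$ ends at $j$, then $\pi_D(i)=j$; a fixed point is black if $i$ labels horizontal edges, white if $i$ labels vertical edges. Put $S_D=S_{\pi_D}$. **Plabic graphs.** A plabic graph is a planar graph in a disk with boundary vertices $1,\dots,n$ in clockwise order, each incident to a single edge, and internal vertices colored black or white. Its permutation $\pi_G$: from boundary vertex $i$ follow edges, turning maximally right at black and maximally left at white internal vertices, ending at boundary vertex $\pi_G(i)$. *Blowing up at $i$*: let boundary vertex $i$ be adjacent to an internal vertex $v$ of degree $3$, whose edges in clockwise order are (the edge to $i$), $e$, $f$. Replace $v$ by a 4-cycle $a,b,c,d$ (clockwise) with $a,c$ black and $b,d$ white; attach $e$ to $a$ and $f$ to $b$; join $c$ to boundary vertex $i$ and $d$ to a new boundary vertex $i+1$ placed next clockwise after $i$; the old labels $i+1,\dots,n$ increase by $1$. **BCFW cells.** For $2\le k\le n-2$ define sets $\tilde{\mathcal G}_{n,k,4}$ of plabic graphs: $\tilde{\mathcal G}_{4,2,4}$ consists of the single graph formed by a 4-cycle whose vertices in clockwise order are white, black, white, black and are joined respectively to boundary vertices $1,2,3,4$. For $n\ge 5$, $\tilde{\mathcal G}_{n,k,4}$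 is the set of all graphs obtained by blowing up a graph in $\tilde{\mathcal G}_{n-1,k,4}$ at some $i\ne 1,n-1$ adjacent to a black vertex, or a graph in $\tilde{\mathcal G}_{n-1,k-1,4}$ at some $i\neq 1,n-1$ adjacent to a white vertex. Let $c_n$ be the $n$-cycle $n\mapsto n-1\mapsto\cdots\mapsto 1\mapsto n$ (products composed right to left). For $0\le k\le n-4$, $\Pi_{n,k,4}=\{c_n^2\pi_G: G\in\tilde{\mathcal G}_{n,k+2,4}\}$, with all fixed points colored black, and the $(k,n)$-BCFW cells are the cells $S_\pi\subseteq\mathrm{Gr}_{k,n}^{\ge0}$ with $\pi\in\Pi_{n,k,4}$. *)

theory Defs
  imports Jordan_Normal_Form.DL_Rank Jordan_Normal_Form.DL_Submatrix
begin

section \<open>Vectors and dominoes\<close>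

text \<open>Vectors of \<open>\<real>\<^sup>n\<close> are the library's \<open>real vec\<close> of dimension \<open>n\<close>, whose entries are
  numbered from 0. Coordinates in the text are numbered from 1.\<close>

definition coord :: "real vec \<Rightarrow> nat \<Rightarrow> real" where
  "coord v j = v $ (j - 1)"

text \<open>\<open>domino n i s v\<close>: \<open>v\<close> is an \<open>i\<close>-domino in \<open>\<real>\<^sup>n\<close> of sign \<open>s\<close>. For \<open>i = n\<close> the
  coordinate \<open>i + 1\<close> does not exist, so that only the \<open>n\<close>-th entry is nonzero.\<close>

definition domino :: "nat \<Rightarrow> nat \<Rightarrow> real \<Rightarrow> real vec \<Rightarrow> bool" where
  "domino n i s v \<longleftrightarrow> v \<in> carrier_vec n \<and> i \<in> {1..n} \<and> s \<in> {1, -1} \<and>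
     (\<forall>j\<in>{1..n}. if j = i \<or> j = i + 1 then sgn (coord v j) = s else coord v j = 0)"

definition supp :: "nat \<Rightarrow> real vec \<Rightarrow> nat set" where
  "supp n v = {j \<in> {1..n}. coord v j \<noteq> 0}"

definition bar :: "nat \<Rightarrow> real vec \<Rightarrow> real vec" where
  "bar n v = vec n (\<lambda>j. if j = n - 1 then 0 else v $ j)"

definition orthodox :: "nat \<Rightarrow> real vec \<Rightarrow> bool" where
  "orthodox n v \<longleftrightarrow> (\<exists>x y i j s. domino n i s x \<and> domino n j s y \<and>
     supp n x \<inter> supp n y = {} \<and> bar n v = x + y)"

definition deviant :: "nat \<Rightarrow> real vec \<Rightarrow> bool" where
  "deviant n v \<longleftrightarrow> (\<exists>x y i j s. domino n i s x \<and> domino n j s y \<and>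
     supp n x \<inter> supp n y = {} \<and> bar n v = x - y)"

abbreviation lin_indpt_vecs :: "nat \<Rightarrow> real vec list \<Rightarrow> bool" where
  "lin_indpt_vecs n vs \<equiv>
     distinct vs \<and> \<not> LinearCombinations.module.lin_dep class_ring (module_vec TYPE(real) n) (set vs)"


section \<open>The nonnegative Grassmannian and positroid cells\<close>

definition grassmannian :: "nat \<Rightarrow> nat \<Rightarrow> real vec set set" where
  "grassmannian k n = {V. VectorSpace.subspace class_ring V (module_vec TYPE(real) n) \<and>
     vectorspace.dim class_ring ((module_vec TYPE(real) n)\<lparr>carrier := V\<rparr>) = k}"

definition represents :: "nat \<Rightarrow> nat \<Rightarrow> real mat \<Rightarrow> real vec set \<Rightarrow> bool" where
  "represents k n A V \<longleftrightarrow> A \<in> carrier_mat k n \<and> V = vec_space.row_space n A"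

definition nonneg_grassmannian :: "nat \<Rightarrow> nat \<Rightarrow> real vec set set" where
  "nonneg_grassmannian k n = {V \<in> grassmannian k n. \<exists>A. represents k n A V \<and>
     (\<forall>J. J \<subseteq> {0..<n} \<and> card J = k \<longrightarrow> det (submatrix A UNIV J) \<ge> 0)}"

text \<open>A decorated permutation of \<open>{1..n}\<close> is a pair of a permutation, extended by the identity
  outside \<open>{1..n}\<close>, and the set of its black fixed points; the other fixed points in \<open>{1..n}\<close>
  are white.\<close>

type_synonym decorated_perm = "(nat \<Rightarrow> nat) \<times> nat set"

definition residue :: "nat \<Rightarrow> nat \<Rightarrow> nat" where
  "residue n j = (j - 1) mod n + 1"

definition cyc_col :: "nat \<Rightarrow> real mat \<Rightarrow> nat \<Rightarrow> real vec" where
  "cyc_col n A j = col A (residue n j - 1)"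

definition first_return :: "nat \<Rightarrow> nat \<Rightarrow> real mat \<Rightarrow> nat \<Rightarrow> nat" where
  "first_return k n A i = (LEAST j. i \<le> j \<and> cyc_col n A i \<in>
     LinearCombinations.module.span class_ring (module_vec TYPE(real) k) (cyc_col n A ` {i+1..j}))"

definition mat_perm :: "nat \<Rightarrow> nat \<Rightarrow> real mat \<Rightarrow> decorated_perm" where
  "mat_perm k n A =
     ((\<lambda>i. if i \<in> {1..n} then residue n (first_return k n A i) else i),
      {i \<in> {1..n}. first_return k n A i = i})"

text \<open>\<open>mat_perm\<close> is the same for all matrices representing \<open>V\<close>, as these differ by an
  invertible left factor.\<close>

definition positroid_cell :: "nat \<Rightarrow> nat \<Rightarrow> decorated_perm \<Rightarrow> real vec set set" where
  "positroid_cell k n \<pi> =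
     {V \<in> nonneg_grassmannian k n. \<exists>A. represents k n A V \<and> mat_perm k n A = \<pi>}"


section \<open>Oplus-diagrams\<close>

datatype symbol = Z | P  \<comment> \<open>\<open>0\<close> and \<open>+\<close>\<close>

text \<open>A filled Young diagram is the list of its nonempty columns from left to right, each column
  being read from top to bottom.\<close>

type_synonym diagram = "symbol list list"

definition oplus_diagram :: "nat \<Rightarrow> nat \<Rightarrow> diagram \<Rightarrow> bool" where
  "oplus_diagram k n D \<longleftrightarrow> k \<le> n \<and> length D \<le> n - k \<and>
     (\<forall>x\<in>set D. 1 \<le> length x \<and> length x \<le> k) \<and> sorted_wrt (\<ge>) (map length D)"

definition box :: "diagram \<Rightarrow> nat \<Rightarrow> nat \<Rightarrow> symbol" where
  "box D r c = D ! (c - 1) ! (r - 1)"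

definition col_height :: "diagram \<Rightarrow> nat \<Rightarrow> nat" where
  "col_height D c = (if c \<in> {1..length D} then length (D ! (c - 1)) else 0)"

definition row_length :: "diagram \<Rightarrow> nat \<Rightarrow> nat" where
  "row_length D r = length (filter (\<lambda>x. r \<le> length x) D)"

text \<open>\<open>RowEdge r\<close> stands for the vertical southeast border edge in row \<open>r\<close> and for the opposite
  northwest border edge, \<open>ColEdge c\<close> for the two horizontal border edges of column \<open>c\<close> of the
  \<open>k \<times> (n - k)\<close> rectangle. The label of a southeast edge is one more than the number of unit steps
  preceding it on the path from the northeast to the southwest corner: the edge in row \<open>r\<close> comes
  after \<open>r - 1\<close> steps south and \<open>n - k - row_length D r\<close> steps west, the one in column \<open>c\<close>
  after \<open>col_height D c\<close> steps south and \<open>n - k - c\<close> steps west.\<close>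

datatype border_edge = RowEdge nat | ColEdge nat

definition border_edges :: "nat \<Rightarrow> nat \<Rightarrow> border_edge set" where
  "border_edges k n = RowEdge ` {1..k} \<union> ColEdge ` {1..n-k}"

fun edge_label :: "nat \<Rightarrow> nat \<Rightarrow> diagram \<Rightarrow> border_edge \<Rightarrow> nat" where
  "edge_label k n D (RowEdge r) = (n - k - row_length D r) + r"
| "edge_label k n D (ColEdge c) = (n - k - c) + col_height D c + 1"

text \<open>\<open>pipe D s r c\<close> is the northwest border edge at which a pipe ends that enters box \<open>(r, c)\<close>
  through side \<open>s\<close>; row 0 and column 0 lie beyond the northwest border.\<close>

datatype side = RightSide | BottomSide

function pipe :: "diagram \<Rightarrow> side \<Rightarrow> nat \<Rightarrow> nat \<Rightarrow> border_edge" where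
  "pipe D s r c =
     (if r = 0 then ColEdge c
      else if c = 0 then RowEdge r
      else case (s, box D r c) of
        (RightSide, Z) \<Rightarrow> pipe D RightSide r (c - 1)
      | (RightSide, P) \<Rightarrow> pipe D BottomSide (r - 1) c
      | (BottomSide, Z) \<Rightarrow> pipe D BottomSide (r - 1) c
      | (BottomSide, P) \<Rightarrow> pipe D RightSide r (c - 1))"
  by pat_completeness auto
termination by (relation "measure (\<lambda>(D, s, r, c). r + c)") auto

declare pipe.simps [simp del]

fun pipe_end :: "diagram \<Rightarrow> border_edge \<Rightarrow> border_edge" where
  "pipe_end D (RowEdge r) = pipe D RightSide r (row_length D r)"
| "pipe_end D (ColEdge c) = pipe D BottomSide (col_height D c) c"

definition diagram_perm :: "nat \<Rightarrow> nat \<Rightarrow> diagram \<Rightarrow> decorated_perm" where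
  "diagram_perm k n D =
     (let edge = inv_into (border_edges k n) (edge_label k n D);
          p = (\<lambda>i. if i \<in> {1..n} then edge_label k n D (pipe_end D (edge i)) else i)
      in (p, {i \<in> {1..n}. p i = i \<and> (\<exists>c. edge i = ColEdge c)}))"

definition diagram_cell :: "nat \<Rightarrow> nat \<Rightarrow> diagram \<Rightarrow> real vec set set" where
  "diagram_cell k n D = positroid_cell k n (diagram_perm k n D)"


section \<open>Plabic graphs\<close>

datatype colour = Black | White

datatype vertex = Bdry nat | Intl nat

text \<open>A graph drawn in a disk is given by its rotation system: \<open>nbrs G u\<close> lists the neighbours of
  \<open>u\<close> in clockwise order (up to rotation of the list). The boundary vertices are \<open>Bdry 1\<close>, ...,
  \<open>Bdry (bdry_num G)\<close> in clockwise order. All graphs considered below arise from a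
  4-cycle by blowing up; hence they are planar and simple, and an edge is given by its two ends.\<close>

record plabic =
  bdry_num :: nat
  internal :: "nat set"
  colour :: "nat \<Rightarrow> colour"
  nbrs :: "vertex \<Rightarrow> vertex list"

definition next_cw :: "'a list \<Rightarrow> 'a \<Rightarrow> 'a \<Rightarrow> bool" where
  "next_cw xs x y \<longleftrightarrow> (\<exists>i<length xs. xs ! i = x \<and> xs ! (Suc i mod length xs) = y)"

text \<open>\<open>trip G u w j\<close>: the path that has just traversed the edge from \<open>u\<close> to \<open>w\<close> ends at boundary
  vertex \<open>j\<close>. Seen from the edge along which a vertex was reached, the rightmost edge is the next
  one counterclockwise, and the leftmost edge is the next one clockwise.\<close>

inductive trip :: "plabic \<Rightarrow> vertex \<Rightarrow> vertex \<Rightarrow> nat \<Rightarrow> bool" for G where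
  arrive: "trip G u (Bdry j) j"
| black: "\<lbrakk>colour G w = Black; next_cw (nbrs G (Intl w)) x u; trip G (Intl w) x j\<rbrakk>
            \<Longrightarrow> trip G u (Intl w) j"
| white: "\<lbrakk>colour G w = White; next_cw (nbrs G (Intl w)) u x; trip G (Intl w) x j\<rbrakk>
            \<Longrightarrow> trip G u (Intl w) j"

definition trip_perm :: "plabic \<Rightarrow> nat \<Rightarrow> nat" where
  "trip_perm G i = (if i \<in> {1..bdry_num G}
     then THE j. trip G (Bdry i) (hd (nbrs G (Bdry i))) j else i)"

text \<open>\<open>blow_up_graph\<close> replaces the internal vertex \<open>v\<close>, with clockwise neighbours \<open>Bdry i\<close>, \<open>e\<close>,
  \<open>f\<close>, by the clockwise 4-cycle \<open>a\<close>, \<open>b\<close>, \<open>c\<close>, \<open>d\<close>. Placing \<open>Bdry i\<close> above \<open>v\<close>, the edge to \<open>e\<close>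
  leaves \<open>v\<close> to the lower right and the one to \<open>f\<close> to the lower left; \<open>a\<close>, \<open>b\<close>, \<open>c\<close>, \<open>d\<close> are the
  lower right, lower left, upper left and upper right corners of a square. The old boundary
  vertices beyond \<open>i\<close> are renamed by \<open>shift\<close>; in \<open>old u x\<close>, \<open>u\<close> and \<open>x\<close> are adjacent vertices of
  the old graph, and the result is the new name of that neighbour of \<open>u\<close>.\<close>

definition blow_up_graph ::
  "nat \<Rightarrow> nat \<Rightarrow> vertex \<Rightarrow> vertex \<Rightarrow> nat \<Rightarrow> nat \<Rightarrow> nat \<Rightarrow> nat \<Rightarrow> plabic \<Rightarrow> plabic" where
  "blow_up_graph i v e f a b c d G =
     (let shift = (\<lambda>x. case x of Bdry j \<Rightarrow> Bdry (if j > i then j + 1 else j) | Intl w \<Rightarrow> Intl w);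
          old = (\<lambda>u x. if x = Intl v then (if u = e then Intl a else Intl b) else shift x)
      in \<lparr> bdry_num = bdry_num G + 1,
           internal = internal G - {v} \<union> {a, b, c, d},
           colour = (colour G)(a := Black, b := White, c := Black, d := White),
           nbrs = (\<lambda>u. case u of
             Bdry j \<Rightarrow>
               if j = i then [Intl c]
               else if j = i + 1 then [Intl d]
               else let u' = Bdry (if j > i + 1 then j - 1 else j) in map (old u') (nbrs G u')
           | Intl w \<Rightarrow>
               if w = a then [Intl d, shift e, Intl b]
               else if w = b then [Intl c, Intl a, shift f]
               else if w = c then [Bdry i, Intl d, Intl b]
               else if w = d then [Bdry (i + 1), Intl a, Intl c]
               else map (old (Intl w)) (nbrs G (Intl w))) \<rparr>)"

definition blow_up :: "nat \<Rightarrow> plabic \<Rightarrow> plabic \<Rightarrow> bool" where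
  "blow_up i G H \<longleftrightarrow> (\<exists>v e f a b c d m. v \<in> internal G \<and>
     rotate m (nbrs G (Intl v)) = [Bdry i, e, f] \<and>
     distinct [a, b, c, d] \<and> {a, b, c, d} \<inter> internal G = {} \<and>
     H = blow_up_graph i v e f a b c d G)"

definition square_graph :: plabic where
  "square_graph =
     \<lparr> bdry_num = 4,
       internal = {1, 2, 3, 4},
       colour = (\<lambda>w. if w = 1 \<or> w = 3 then White else Black),
       nbrs = (\<lambda>u. case u of
         Bdry j \<Rightarrow> [Intl j]
       | Intl w \<Rightarrow> [Bdry w, Intl (if w = 4 then 1 else w + 1), Intl (if w = 1 then 4 else w - 1)]) \<rparr>"


section \<open>BCFW cells\<close>

definition bdry_colour :: "plabic \<Rightarrow> nat \<Rightarrow> colour \<Rightarrow> bool" where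
  "bdry_colour G i x \<longleftrightarrow> (\<exists>v\<in>internal G. nbrs G (Bdry i) = [Intl v] \<and> colour G v = x)"

inductive bcfw_graph :: "nat \<Rightarrow> nat \<Rightarrow> plabic \<Rightarrow> bool" where
  square: "bcfw_graph 4 2 square_graph"
| black: "\<lbrakk>bcfw_graph n k G; i \<in> {1..n}; i \<noteq> 1; i \<noteq> n; bdry_colour G i Black; blow_up i G H\<rbrakk>
            \<Longrightarrow> bcfw_graph (n + 1) k H"
| white: "\<lbrakk>bcfw_graph n k G; i \<in> {1..n}; i \<noteq> 1; i \<noteq> n; bdry_colour G i White; blow_up i G H\<rbrakk>
            \<Longrightarrow> bcfw_graph (n + 1) (k + 1) H"

definition cyc :: "nat \<Rightarrow> nat \<Rightarrow> nat" where
  "cyc n i = (if i \<in> {1..n} then (if i = 1 then n else i - 1) else i)"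

definition bcfw_perms :: "nat \<Rightarrow> nat \<Rightarrow> decorated_perm set" where
  "bcfw_perms k n =
     {(p, {i \<in> {1..n}. p i = i}) | p G. bcfw_graph n (k + 2) G \<and> p = cyc n \<circ> cyc n \<circ> trip_perm G}"

definition bcfw_cells :: "nat \<Rightarrow> nat \<Rightarrow> real vec set set set" where
  "bcfw_cells k n = positroid_cell k n ` bcfw_perms k n"


section \<open>The nine classes\<close>

text \<open>Patterns are words in which \<open>Many x\<close> stands for a possibly empty block of \<open>x\<close>'s.\<close>

datatype 'a item = One 'a | Many 'a

fun instances :: "'a item list \<Rightarrow> 'a list set" where
  "instances [] = {[]}"
| "instances (One x # ts) = {x # xs | xs. xs \<in> instances ts}"
| "instances (Many x # ts) = {replicate m x @ xs | m xs. xs \<in> instances ts}"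

datatype bcfw_class =
  Class1 | Class2 | Class3 | Class4 | Class5 | Class6 | Class7 | Class8 | Class9

text \<open>Columns of height 0, on the right of the rectangle, are not part of these words.\<close>

fun diagram_pattern :: "bcfw_class \<Rightarrow> symbol list item list" where
  "diagram_pattern Class1 =
     [One [P,P], Many [Z,Z], One [Z,P], One [Z,P], Many [Z,Z], One [Z,P], Many [Z],
      One [P], One [P], Many [Z], One [P]]"
| "diagram_pattern Class2 =
     [One [P,P], Many [Z,Z], One [Z,P], One [Z,P], Many [Z,Z], One [P,P], One [P], Many [Z],
      One [P]]"
| "diagram_pattern Class3 =
     [One [P,P], Many [Z,Z], One [Z,P], One [P,P], Many [Z,Z], One [P,P], Many [Z], One [P]]"
| "diagram_pattern Class4 =
     [One [P,P], Many [Z,Z], One [P,P], One [P,P], Many [Z,Z], One [Z,P], Many [Z], One [P]]"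
| "diagram_pattern Class5 =
     [One [P,P], Many [Z,Z], One [P,Z], One [P,P], One [Z,P], Many [Z,Z], One [Z,P], Many [Z],
      One [P]]"
| "diagram_pattern Class6 =
     [One [P,P], Many [Z,Z], One [P,Z], One [P,Z], Many [Z,Z], One [Z,P], One [Z,P], Many [Z,Z],
      One [Z,P], Many [Z], One [P]]"
| "diagram_pattern Class7 =
     [One [P,P], Many [Z,Z], One [P,Z], One [P,Z], Many [Z,Z], One [Z,P], One [Z,P], Many [Z,Z],
      One [P,P]]"
| "diagram_pattern Class8 =
     [One [P,P], Many [Z,Z], One [P,Z], One [P,P], One [Z,P], Many [Z,Z], One [P,P]]"
| "diagram_pattern Class9 =
     [One [P,P], Many [Z,Z], One [P,P], One [P,P], Many [Z,Z], One [P,P]]"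

text \<open>In both rows of a sign pattern the character \<open>|\<close> marks the same blocks of zero columns.\<close>

fun sign_rows :: "bcfw_class \<Rightarrow> string \<times> string" where
  "sign_rows Class1 = (''|++|++|00|00|-'',
                       ''|00|00|++|++|+'')"
| "sign_rows Class2 = (''|++|++0|00|-'',
                       ''|00|0++|++|+'')"
| "sign_rows Class3 = (''|++|++|00|-'',
                       ''|00|++|++|+'')"
| "sign_rows Class4 = (''|++|00|--|-'',
                       ''|++|++|++|0'')"
| "sign_rows Class5 = (''|++|00|0--|-'',
                       ''|++|++|++0|0'')"
| "sign_rows Class6 = (''|++|00|00|--|-'',
                       ''|++|++|++|00|0'')"
| "sign_rows Class7 = (''|++0|00|--|-'',
                       ''|+++|++|00|0'')"
| "sign_rows Class8 = (''|++0|0--|-'',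
                       ''|+++|++0|0'')"
| "sign_rows Class9 = (''|++0|--|-'',
                       ''|+++|++|0'')"

definition char_sign :: "char \<Rightarrow> real" where
  "char_sign x = (if x = CHR ''+'' then 1 else if x = CHR ''-'' then -1 else 0)"

definition sign_pattern :: "bcfw_class \<Rightarrow> (real \<times> real) item list" where
  "sign_pattern c =
     map (\<lambda>(x, y). if x = CHR ''|'' then Many (0, 0) else One (char_sign x, char_sign y))
       (zip (fst (sign_rows c)) (snd (sign_rows c)))"

definition has_sign_pattern :: "nat \<Rightarrow> bcfw_class \<Rightarrow> real vec \<Rightarrow> real vec \<Rightarrow> bool" where
  "has_sign_pattern n c d e \<longleftrightarrow>
     map (\<lambda>j. (sgn (coord d j), sgn (coord e j))) [1..<n+1] \<in> instances (sign_pattern c)"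

end

(* Blowing up at a vertex cuts the trip that crosses there. The end of that trip is known: along the
   boundary, trips run clockwise through consecutive black and counterclockwise through consecutive
   white vertices. Hence the permutations of the BCFW graphs are generated by a recursion that only
   knows the set of boundary labels next to black vertices. For two white blow-ups, all permutations
   obtained in this way are described by the indices i1, ..., i4 of four dominoes: the columns
   outside of {i1, i1+1, ..., i4, i4+1, n} are zero, and the permutation encodes which of the others
   are parallel. Pipes in diagrams with two rows give the same permutations.

   Write D(a, b) for the minor of the columns a, b of a totally nonnegative representative. By the
   Pluecker relation D(a, b) > 0 for a < b whenever the columns are nonzero and not parallel. Suitable
   rows are then d_j = D(j, i4+1), e_j = D(i1, j) in the orthodox case and, up to a positive factor of
   e, d_j = D(j, i2+1), e_j = D(j, n) in the deviant case. *)

theory Submission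
  imports Defs
begin

section \<open>Trips through a blown-up graph\<close>

text \<open>The permutation alone does not show which trip crosses at \<open>i\<close>, so it cannot
  be updated under a blow-up by itself. The order in which the trips pass the vertices next to the
  boundary is therefore carried along. In \<open>bcfw_graph n 4\<close> exactly two blow-ups are
  white. The first one, at \<open>q + 2\<close>, turns the identity into a cycle through
  \<open>q\<close>, \<open>q + 1\<close>, \<open>q + 2\<close>, \<open>q + 3\<close> and the last
  label, that is, through two dominoes and the last column. The second one adds two more dominoes,
  either beside these (orthodox) or between them (deviant). A black blow-up inserts a zero column,
  except that a column shared by the first two dominoes of a deviant cell is doubled by blowing up
  at \<open>i1 + 2\<close>. A row of minors \<open>D(j, m)\<close> vanishes exactly on the zero
  columns and on the parallel class of \<open>m\<close>. So \<open>m\<close> is taken from the class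
  on which the row has to vanish, and as a member that stays in it however the dominoes overlap:
  \<open>i4 + 1\<close> and \<open>i1\<close> in the orthodox case, \<open>i2 + 1\<close> and
  \<open>n\<close> in the deviant one.\<close>

definition turn :: "plabic \<Rightarrow> nat \<Rightarrow> vertex \<Rightarrow> vertex \<Rightarrow> bool" where
  "turn G w u x \<longleftrightarrow> (if colour G w = Black then next_cw (nbrs G (Intl w)) x u
                     else next_cw (nbrs G (Intl w)) u x)"

section \<open>Turns in a rotation system\<close>

lemma next_cw_triple:
  "next_cw [x, y, z] u w \<longleftrightarrow> u = x \<and> w = y \<or> u = y \<and> w = z \<or> u = z \<and> w = x"
proof -
  have ex: "(\<exists>i<3. Q i) \<longleftrightarrow> Q 0 \<or> Q 1 \<or> Q (2::nat)" for Q
    by (auto simp: numeral_3_eq_3 less_Suc_eq numeral_2_eq_2)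
  have "length [x, y, z] = 3" by simp
  then show ?thesis unfolding next_cw_def by (simp only: ex) auto
qed

lemma next_cw_rotate1: "next_cw xs x y \<Longrightarrow> next_cw (rotate1 xs) x y"
proof -
  assume "next_cw xs x y"
  then obtain i where i: "i < length xs" "xs ! i = x" "xs ! (Suc i mod length xs) = y"
    unfolding next_cw_def by blast
  define l where "l = length xs"
  define m where "m = (if i = 0 then l - 1 else i - 1)"
  have l: "0 < l" using i l_def by auto
  have m: "m < l" "Suc m mod l = i" unfolding m_def using i l l_def by auto
  have "Suc (Suc m mod l) mod l = Suc i mod l" using m by simp
  then have "rotate1 xs ! m = x" "rotate1 xs ! (Suc m mod l) = y"
    using m i l by (auto simp: nth_rotate1 l_def[symmetric] simp del: mod_Suc_eq)
  then show ?thesis unfolding next_cw_def using m l_def by auto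
qed

text \<open>One direction suffices, since rotating further by \<open>length xs * m - m\<close> gives
  back the list. Neighbours are listed only up to rotation, so turns must not depend on where the
  list begins.\<close>

lemma next_cw_rotate: "next_cw (rotate m xs) x y \<longleftrightarrow> next_cw xs x y"
proof -
  have fw: "next_cw xs x y \<Longrightarrow> next_cw (rotate k xs) x y" for k and xs :: "'a list"
    by (induction k) (auto intro: next_cw_rotate1)
  have "rotate (length xs * m - m) (rotate m xs) = xs" if "xs \<noteq> []"
  proof -
    have "m \<le> length xs * m" using that by (cases xs) auto
    then show ?thesis by (simp add: rotate_rotate rotate_id)
  qed
  then show ?thesis using fw by (metis rotate_is_Nil_conv)
qed

lemma next_cw_map: "next_cw xs x y \<Longrightarrow> next_cw (map f xs) (f x) (f y)"
  proof -
  assume "next_cw xs x y"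
  then obtain i where i: "i < length xs" "xs ! i = x" "xs ! (Suc i mod length xs) = y"
    unfolding next_cw_def by blast
  then have "Suc i mod length xs < length xs" by (intro mod_less_divisor) auto
  then have "map f xs ! i = f x \<and> map f xs ! (Suc i mod length (map f xs)) = f y" using i by simp
  then show ?thesis unfolding next_cw_def using i by (metis length_map)
qed

lemma next_cw_unique:
  assumes "distinct xs"
  shows "next_cw xs x y \<Longrightarrow> next_cw xs x y' \<Longrightarrow> y = y'"
    and "next_cw xs x y \<Longrightarrow> next_cw xs x' y \<Longrightarrow> x = x'"
proof -
  show "next_cw xs x y \<Longrightarrow> next_cw xs x y' \<Longrightarrow> y = y'"
    using assms unfolding next_cw_def by (metis nth_eq_iff_index_eq)
  assume "next_cw xs x y" "next_cw xs x' y"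
  then obtain i i' where i: "i < length xs" "i' < length xs" "xs ! i = x" "xs ! i' = x'"
     "xs ! (Suc i mod length xs) = xs ! (Suc i' mod length xs)" unfolding next_cw_def by metis
  then have "Suc i mod length xs = Suc i' mod length xs"
    using assms by (metis nth_eq_iff_index_eq mod_less_divisor length_pos_if_in_set nth_mem)
  then have "i = i'" using i(1,2)
    by (auto simp: mod_Suc split: if_splits)
  then show "x = x'" using i by simp
qed

lemma next_cw_set: "next_cw xs x y \<Longrightarrow> x \<in> set xs \<and> y \<in> set xs"
proof -
  assume "next_cw xs x y"
  then obtain i where i: "i < length xs" "xs ! i = x" "xs ! (Suc i mod length xs) = y"
    unfolding next_cw_def by blast
  then have "Suc i mod length xs < length xs" by (intro mod_less_divisor) auto
  then show ?thesis using i nth_mem by blast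
qed

lemma turn_unique: "distinct (nbrs G (Intl w)) \<Longrightarrow> turn G w u x \<Longrightarrow> turn G w u x' \<Longrightarrow> x = x'"
  unfolding turn_def using next_cw_unique[of "nbrs G (Intl w)"] by (simp split: if_splits)

lemma turn_set: "turn G w u x \<Longrightarrow> x \<in> set (nbrs G (Intl w))"
  unfolding turn_def using next_cw_set by (metis (full_types))

lemma turn_triple:
  assumes "rotate m (nbrs G (Intl w)) = [x, y, z]"
  shows "turn G w p q \<longleftrightarrow>
    (if colour G w = Black then p = x \<and> q = z \<or> p = z \<and> q = y \<or> p = y \<and> q = x
     else p = x \<and> q = y \<or> p = y \<and> q = z \<or> p = z \<and> q = x)"
  unfolding turn_def next_cw_rotate[of m "nbrs G (Intl w)", symmetric] assms next_cw_triple by auto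

lemma trip_turn: "turn G w u x \<Longrightarrow> trip G (Intl w) x j \<Longrightarrow> trip G u (Intl w) j"
  unfolding turn_def by (cases "colour G w") (simp_all add: trip.black trip.white)

lemma trip_turnE:
  assumes "trip G u (Intl w) j"
  obtains x where "turn G w u x" "trip G (Intl w) x j"
  using assms unfolding turn_def by (cases rule: trip.cases) auto

section \<open>Uniqueness of trips and their routing along the boundary\<close>

definition well_formed :: "plabic \<Rightarrow> nat \<Rightarrow> (nat \<Rightarrow> nat) \<Rightarrow> bool" where
  "well_formed G n V \<longleftrightarrow> bdry_num G = n \<and> inj_on V {1..n} \<and>
     (\<forall>j\<in>{1..n}. V j \<in> internal G \<and> nbrs G (Bdry j) = [Intl (V j)]) \<and>
     (\<forall>w\<in>internal G. distinct (nbrs G (Intl w)) \<and> length (nbrs G (Intl w)) = 3 \<and>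
        Intl w \<notin> set (nbrs G (Intl w)) \<and>
        (\<forall>j. Bdry j \<in> set (nbrs G (Intl w)) \<longrightarrow> j \<in> {1..n} \<and> V j = w) \<and>
        (\<forall>x. Intl x \<in> set (nbrs G (Intl w)) \<longrightarrow> x \<in> internal G))"

text \<open>Distinct neighbours make every turn unique, so a trip has no choice. This allows the
  definite description in \<open>trip_perm\<close> to be evaluated by exhibiting one trip.\<close>

lemma trip_unique:
  assumes wf: "well_formed G n V" and w: "\<And>w'. w = Intl w' \<Longrightarrow> w' \<in> internal G"
    and t: "trip G u w j" "trip G u w j'"
  shows "j = j'"
proof -
  have nb: "distinct (nbrs G (Intl y))" "Intl z \<in> set (nbrs G (Intl y)) \<Longrightarrow> z \<in> internal G"
    if "y \<in> internal G" for y z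
    using that wf by (auto simp: well_formed_def)
  show ?thesis using t w
  proof (induction rule: trip.induct)
    case (arrive u j)
    then show ?case by (cases rule: trip.cases) auto
  next
    case (black y x u j)
    then have y: "y \<in> internal G" and t: "turn G y u x" by (auto simp: turn_def)
    obtain x' where x': "turn G y u x'" "trip G (Intl y) x' j'" using black.prems trip_turnE by metis
    have "x' = x" using turn_unique[OF nb(1)[OF y] x'(1) t] .
    then show ?case using black.IH x' turn_set[OF t] nb(2)[OF y] by auto
  next
    case (white y u x j)
    then have y: "y \<in> internal G" and t: "turn G y u x" by (auto simp: turn_def)
    obtain x' where x': "turn G y u x'" "trip G (Intl y) x' j'" using white.prems trip_turnE by metis
    have "x' = x" using turn_unique[OF nb(1)[OF y] x'(1) t] .
    then show ?case using white.IH x' turn_set[OF t] nb(2)[OF y] by auto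
  qed
qed

text \<open>The trips turn at the internal vertex \<open>V j\<close> next to boundary vertex \<open>j\<close> as
  \<open>Bdry j \<rightarrow> s j \<rightarrow> t j \<rightarrow> Bdry j\<close>. A mark is a passage through such a vertex: a trip arrives at it
  by ending at \<open>j\<close> (\<open>Bd j\<close>, coming from \<open>t j\<close>) or by crossing from \<open>s j\<close> to \<open>t j\<close> (\<open>Xg j\<close>), and it
  departs by starting at \<open>j\<close> (\<open>Bd j\<close>, going to \<open>s j\<close>) or after crossing (\<open>Xg j\<close>).
  \<open>nx\<close> sends a departure to the next arrival.\<close>

datatype mark = Bd nat | Xg nat

fun idx :: "mark \<Rightarrow> nat" where
  "idx (Bd j) = j" | "idx (Xg j) = j"

fun departure :: "(nat \<Rightarrow> nat) \<Rightarrow> (nat \<Rightarrow> nat) \<Rightarrow> mark \<Rightarrow> nat" where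
  "departure s t (Bd j) = s j" | "departure s t (Xg j) = t j"

fun arrival :: "(nat \<Rightarrow> nat) \<Rightarrow> (nat \<Rightarrow> nat) \<Rightarrow> mark \<Rightarrow> nat" where
  "arrival s t (Bd j) = t j" | "arrival s t (Xg j) = s j"

text \<open>A stretch of a trip from one directed edge to another that makes no turn at the vertices
  of \<open>B\<close>. With \<open>B\<close> the vertices next to the boundary it has no mark in its
  interior, and a blow-up at one of them can only affect its two ends.\<close>

inductive seg :: "plabic \<Rightarrow> nat set \<Rightarrow> nat \<Rightarrow> nat \<Rightarrow> nat \<Rightarrow> nat \<Rightarrow> bool" for G B where
  arrived: "seg G B u w u w"
| step: "\<lbrakk>w \<notin> B; turn G w (Intl u) (Intl x); seg G B w x u' w'\<rbrakk> \<Longrightarrow> seg G B u w u' w'"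

definition routed ::
  "plabic \<Rightarrow> nat \<Rightarrow> (nat \<Rightarrow> nat) \<Rightarrow> (nat \<Rightarrow> nat) \<Rightarrow> (nat \<Rightarrow> nat) \<Rightarrow> (mark \<Rightarrow> mark) \<Rightarrow> bool" where
  "routed G n V s t nx \<longleftrightarrow>
     (\<forall>j\<in>{1..n}. turn G (V j) (Bdry j) (Intl (s j)) \<and> turn G (V j) (Intl (s j)) (Intl (t j)) \<and>
        turn G (V j) (Intl (t j)) (Bdry j)) \<and>
     (\<forall>z. idx z \<in> {1..n} \<longrightarrow> idx (nx z) \<in> {1..n} \<and>
        seg G (V ` {1..n}) (V (idx z)) (departure s t z) (arrival s t (nx z)) (V (idx (nx z))))"

inductive chain :: "(mark \<Rightarrow> mark) \<Rightarrow> mark \<Rightarrow> nat \<Rightarrow> bool" for nx where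
  stop: "nx z = Bd j \<Longrightarrow> chain nx z j"
| cross: "nx z = Xg k \<Longrightarrow> chain nx (Xg k) j \<Longrightarrow> chain nx z j"

lemma seg_trans: "seg G B u w u' w' \<Longrightarrow> seg G B u' w' u'' w'' \<Longrightarrow> seg G B u w u'' w''"
  by (induction rule: seg.induct) (blast intro: seg.intros)+

lemma seg_trip:
  "seg G B u w u' w' \<Longrightarrow> trip G (Intl u') (Intl w') j \<Longrightarrow> trip G (Intl u) (Intl w) j"
  by (induction rule: seg.induct) (blast intro: trip_turn)+

lemma chain_trip:
  assumes "routed G n V s t nx"
  shows "chain nx z j \<Longrightarrow> idx z \<in> {1..n} \<Longrightarrow> trip G (Intl (V (idx z))) (Intl (departure s t z)) j"
proof (induction rule: chain.induct)
  case (stop z j)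
  then have "idx (nx z) \<in> {1..n}"
    "seg G (V ` {1..n}) (V (idx z)) (departure s t z) (arrival s t (nx z)) (V (idx (nx z)))"
    using assms unfolding routed_def by blast+
  moreover from this stop have "turn G (V j) (Intl (t j)) (Bdry j)"
    using assms unfolding routed_def by simp
  moreover from this have "trip G (Intl (t j)) (Intl (V j)) j" by (metis trip_turn trip.arrive)
  ultimately show ?case using stop by (auto intro: seg_trip)
next
  case (cross z k j)
  then have "idx (nx z) \<in> {1..n}"
    "seg G (V ` {1..n}) (V (idx z)) (departure s t z) (arrival s t (nx z)) (V (idx (nx z)))"
    using assms unfolding routed_def by blast+
  moreover from this cross have "turn G (V k) (Intl (s k)) (Intl (t k))"
    using assms unfolding routed_def by simp
  moreover have "idx (Xg k) \<in> {1..n}" using calculation(1) cross by simp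
  moreover from this have "trip G (Intl (V k)) (Intl (t k)) j" using cross by fastforce
  ultimately show ?case using cross by (auto intro: seg_trip trip_turn)
qed

text \<open>The segments between marks concatenate to a trip, whose end is unique. The permutation
  is thereby read off from \<open>nx\<close> without further reference to the graph.\<close>

lemma trip_perm_chain:
  assumes wf: "well_formed G n V" and r: "routed G n V s t nx"
    and i: "i \<in> {1..n}" and c: "chain nx (Bd i) j"
  shows "trip_perm G i = j"
proof -
  have n: "bdry_num G = n" and V: "V i \<in> internal G" "nbrs G (Bdry i) = [Intl (V i)]"
    using wf i by (auto simp: well_formed_def)
  have "trip G (Intl (V i)) (Intl (s i)) j" using chain_trip[OF r c] i by simp
  moreover have "turn G (V i) (Bdry i) (Intl (s i))" using r i unfolding routed_def by blast
  ultimately have t: "trip G (Bdry i) (Intl (V i)) j" by (metis trip_turn)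
  then have "(THE j. trip G (Bdry i) (Intl (V i)) j) = j"
    using trip_unique[OF wf _ _ t] V(1) by (intro the_equality t) (metis vertex.inject(2))
  then show ?thesis using i n V by (simp add: trip_perm_def)
qed

section \<open>Blowing up a vertex next to the boundary\<close>

definition unsh :: "nat \<Rightarrow> nat \<Rightarrow> nat" where
  "unsh i j = (if j \<le> i then j else j - 1)"

text \<open>The old boundary vertex \<open>i\<close> has two successors. As the end of a trip it
  becomes \<open>u\<close>, which is recorded here; as the start of a trip it becomes the other one,
  see \<open>depart_ren\<close>.\<close>

definition grow :: "nat \<Rightarrow> nat \<Rightarrow> nat \<Rightarrow> nat" where
  "grow i u j = (if j = i then u else if i < j then j + 1 else j)"

text \<open>A trip crossing the blown up vertex is cut into two trips. Of the two vertices \<open>i\<close> and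
  \<open>i + 1\<close> of the blown up graph, \<open>u\<close> is the one where the second part starts and \<open>u'\<close> the one
  where the first part ends; \<open>(u, u')\<close> is \<open>(i, i + 1)\<close> at a black and \<open>(i + 1, i)\<close> at a white
  vertex.\<close>

fun arrive_ren :: "nat \<Rightarrow> nat \<Rightarrow> nat \<Rightarrow> mark \<Rightarrow> mark" where
  "arrive_ren i u u' (Bd j) = (if j = i then Xg u' else Bd (grow i u j))"
| "arrive_ren i u u' (Xg j) = Xg (grow i u j)"

text \<open>A trip starting at \<open>u\<close> continues as the old one did after crossing at
  \<open>i\<close>. A crossing at one of the two new corners leads along the edge between
  \<open>c\<close> and \<open>d\<close> straight to the other boundary vertex, whence the two values
  that do not come from \<open>nx\<close>.\<close>

fun grow_nx :: "nat \<Rightarrow> nat \<Rightarrow> nat \<Rightarrow> (mark \<Rightarrow> mark) \<Rightarrow> mark \<Rightarrow> mark" where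
  "grow_nx i u u' nx (Bd j) =
     arrive_ren i u u' (nx (if j = u then Xg i else Bd (unsh i j)))"
| "grow_nx i u u' nx (Xg j) =
     (if j = u then Bd u' else if j = u' then Bd u else arrive_ren i u u' (nx (Xg (unsh i j))))"

locale blow_up_graph_context =
  fixes G :: plabic and n V s t nx i v e f a b c d m
  assumes wf: "well_formed G n V" and rt: "routed G n V s t nx"
    and i: "i \<in> {1..n}" and v: "v \<in> internal G"
    and rot: "rotate m (nbrs G (Intl v)) = [Bdry i, Intl e, Intl f]"
    and dist: "distinct [a, b, c, d]" and fresh: "{a, b, c, d} \<inter> internal G = {}"
begin

definition "H = blow_up_graph i v (Intl e) (Intl f) a b c d G"
definition "u = (if colour G v = Black then i else i + 1)"
definition "u' = (if colour G v = Black then i + 1 else i)"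
definition "rn w x = (if x = v then (if w = e then a else b) else x)"
definition "V' j = (if j = i then c else if j = i + 1 then d else V (unsh i j))"
definition "s' j = (if j = i then b else if j = i + 1 then a else rn (V (unsh i j)) (s (unsh i j)))"
definition "t' j = (if j = i then d else if j = i + 1 then c else rn (V (unsh i j)) (t (unsh i j)))"
definition "old w x = (case x of Bdry j \<Rightarrow> Bdry (if j > i then j + 1 else j) | Intl y \<Rightarrow> Intl (rn w y))"
text \<open>The old edges at \<open>v\<close> are attached to \<open>a\<close> or \<open>b\<close>,
  according to whether their other end is \<open>e\<close> or \<open>f\<close>. \<open>src\<close>
  and \<open>dst\<close> rename the two ends of an edge that is directed along a trip.\<close>

definition "src w' x = (if w' = v then (if x = e then a else b) else w')"
definition "dst w' x = (if w' = v then x else rn w' x)"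

lemma nbrs_v: "set (nbrs G (Intl v)) = {Bdry i, Intl e, Intl f}" "distinct [Bdry i, Intl e, Intl f]"
proof -
  have "set (rotate m (nbrs G (Intl v))) = set (nbrs G (Intl v))" by simp
  then show "set (nbrs G (Intl v)) = {Bdry i, Intl e, Intl f}" using rot by simp
  have "distinct (rotate m (nbrs G (Intl v)))" using wf v by (simp add: well_formed_def)
  then show "distinct [Bdry i, Intl e, Intl f]" using rot by simp
qed

lemma internal_nbrs:
  assumes "w \<in> internal G"
  shows "distinct (nbrs G (Intl w))" "length (nbrs G (Intl w)) = 3" "Intl w \<notin> set (nbrs G (Intl w))"
    "Bdry j \<in> set (nbrs G (Intl w)) \<Longrightarrow> j \<in> {1..n} \<and> V j = w"
    "Intl x \<in> set (nbrs G (Intl w)) \<Longrightarrow> x \<in> internal G"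
  using wf assms unfolding well_formed_def by blast+

lemma Vi: "V i = v"
  using internal_nbrs(4)[OF v, of i] nbrs_v(1) by simp

lemma ef: "e \<in> internal G" "f \<in> internal G" "e \<noteq> v" "f \<noteq> v" "e \<noteq> f"
  using internal_nbrs(5)[OF v, of e] internal_nbrs(5)[OF v, of f] internal_nbrs(3)[OF v] nbrs_v
  by simp_all

lemma V: "j \<in> {1..n} \<Longrightarrow> V j \<in> internal G" "j \<in> {1..n} \<Longrightarrow> nbrs G (Bdry j) = [Intl (V j)]"
  "j \<in> {1..n} \<Longrightarrow> j' \<in> {1..n} \<Longrightarrow> V j = V j' \<longleftrightarrow> j = j'"
  using wf unfolding well_formed_def by (blast, blast, meson inj_on_eq_iff)

lemma V_neq: "j \<in> {1..n} \<Longrightarrow> j \<noteq> i \<Longrightarrow> V j \<noteq> v"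
  using V(3)[OF _ i] Vi by simp

lemma fresh': "w \<in> internal G \<Longrightarrow> w \<noteq> a \<and> w \<noteq> b \<and> w \<noteq> c \<and> w \<noteq> d"
  "a \<notin> internal G" "b \<notin> internal G" "c \<notin> internal G" "d \<notin> internal G"
  using fresh by auto

lemma nbrs_H:
  "nbrs H (Bdry i) = [Intl c]" "nbrs H (Bdry (i + 1)) = [Intl d]"
  "nbrs H (Intl a) = [Intl d, Intl e, Intl b]" "nbrs H (Intl b) = [Intl c, Intl a, Intl f]"
  "nbrs H (Intl c) = [Bdry i, Intl d, Intl b]" "nbrs H (Intl d) = [Bdry (i + 1), Intl a, Intl c]"
  using dist by (auto simp: H_def blow_up_graph_def Let_def)

lemma colour_H:
  "colour H a = Black" "colour H b = White" "colour H c = Black" "colour H d = White"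
  "w \<in> internal G \<Longrightarrow> colour H w = colour G w"
  using dist fresh' by (auto simp: H_def blow_up_graph_def Let_def)

lemma internal_H: "internal H = internal G - {v} \<union> {a, b, c, d}"
  by (auto simp: H_def blow_up_graph_def Let_def)

lemma nbrs_H_old:
  assumes "w \<in> internal G"
  shows "nbrs H (Intl w) = map (old w) (nbrs G (Intl w))"
  using fresh'(1)[OF assms]
  by (auto simp: H_def blow_up_graph_def Let_def old_def rn_def split: vertex.splits)

lemma nbrs_H_bdry:
  assumes "j \<in> {1..n + 1}"
  shows "nbrs H (Bdry j) = [Intl (V' j)]"
proof -
  consider "j = i" | "j = i + 1" | "j \<noteq> i" "j \<noteq> i + 1" by blast
  then show ?thesis
  proof cases
    case 3
    then have j: "unsh i j \<in> {1..n}" "unsh i j \<noteq> i" using assms i by (auto simp: unsh_def)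
    have u: "(if i + 1 < j then j - 1 else j) = unsh i j" using 3 by (auto simp: unsh_def)
    have "nbrs H (Bdry j) = map (\<lambda>x. if x = Intl v then (if Bdry (unsh i j) = Intl e then Intl a else Intl b)
       else case x of Bdry j \<Rightarrow> Bdry (if j > i then j + 1 else j) | Intl w \<Rightarrow> Intl w) (nbrs G (Bdry (unsh i j)))"
      using 3 u by (simp add: H_def blow_up_graph_def Let_def)
    then show ?thesis using V(2)[OF j(1)] V_neq[OF j] 3 by (simp add: V'_def)
  next
    case 2
    then show ?thesis unfolding 2 nbrs_H(2) by (simp add: V'_def)
  qed (simp add: nbrs_H V'_def)
qed

lemma old_inj:
  assumes "w \<in> internal G"
  shows "inj_on (old w) (set (nbrs G (Intl w)))"
proof (rule inj_onI)
  fix x y assume x: "x \<in> set (nbrs G (Intl w))" and y: "y \<in> set (nbrs G (Intl w))"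
    and eq: "old w x = old w y"
  show "x = y"
  proof (cases x)
    case (Bdry j)
    then show ?thesis using eq by (cases y) (auto simp: old_def split: if_splits)
  next
    case (Intl p)
    then obtain q where q: "y = Intl q" using eq by (cases y) (auto simp: old_def)
    have "p \<in> internal G" "q \<in> internal G"
      using x y Intl q internal_nbrs(5)[OF assms] by auto
    then show ?thesis using Intl q eq fresh' by (auto simp: old_def rn_def split: if_splits)
  qed
qed

lemma V'_notin:
  assumes "j \<in> {1..n + 1}" "j \<noteq> i" "j \<noteq> i + 1"
  shows "unsh i j \<in> {1..n} \<and> unsh i j \<noteq> i
    \<and> V' j = V (unsh i j) \<and> V' j \<in> internal G \<and> V' j \<noteq> v"
proof -
  have k: "unsh i j \<in> {1..n}" "unsh i j \<noteq> i" using assms i by (auto simp: unsh_def)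
  then show ?thesis using V(1)[OF k(1)] V_neq[OF k] assms by (simp add: V'_def)
qed

lemma well_formed_H: "well_formed H (n + 1) V'"
proof -
  have bn: "bdry_num H = n + 1"
    using wf by (simp add: H_def blow_up_graph_def Let_def well_formed_def)
  have inj: "inj_on V' {1..n + 1}"
  proof (rule inj_onI)
    fix x y assume x: "x \<in> {1..n + 1}" and y: "y \<in> {1..n + 1}" and eq: "V' x = V' y"
    consider "x \<in> {i, i + 1}" "y \<in> {i, i + 1}" | "x \<in> {i, i + 1}" "y \<notin> {i, i + 1}"
      | "x \<notin> {i, i + 1}" "y \<in> {i, i + 1}" | "x \<notin> {i, i + 1}" "y \<notin> {i, i + 1}" by blast
    then show "x = y"
    proof cases
      case 1
      then show ?thesis using eq dist by (auto simp: V'_def)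
    next
      case 2
      then show ?thesis using eq V'_notin[OF y] fresh' by (auto simp: V'_def)
    next
      case 3
      then show ?thesis using eq V'_notin[OF x] fresh' by (auto simp: V'_def)
    next
      case 4
      then have "unsh i x = unsh i y" using eq V'_notin[OF x] V'_notin[OF y] V(3) by auto
      then show ?thesis using 4 by (auto simp: unsh_def split: if_splits)
    qed
  qed
  have bd: "V' j \<in> internal H \<and> nbrs H (Bdry j) = [Intl (V' j)]" if "j \<in> {1..n + 1}" for j
  proof (cases "j = i \<or> j = i + 1")
    case True
    then show ?thesis using nbrs_H_bdry[OF that] by (auto simp: internal_H V'_def)
  next
    case False
    then show ?thesis using nbrs_H_bdry[OF that] V'_notin[OF that] by (auto simp: internal_H)
  qed
  have loc: "distinct (nbrs H (Intl w)) \<and> length (nbrs H (Intl w)) = 3 \<and>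
        Intl w \<notin> set (nbrs H (Intl w)) \<and>
        (\<forall>j. Bdry j \<in> set (nbrs H (Intl w)) \<longrightarrow> j \<in> {1..n + 1} \<and> V' j = w) \<and>
        (\<forall>x. Intl x \<in> set (nbrs H (Intl w)) \<longrightarrow> x \<in> internal H)" if wH: "w \<in> internal H" for w
  proof -
    consider "w = a" | "w = b" | "w = c" | "w = d" | "w \<in> internal G" "w \<noteq> v"
      using wH unfolding internal_H by blast
    then show ?thesis
    proof cases
      case 5
      note L = internal_nbrs[OF 5(1)] and N = nbrs_H_old[OF 5(1)]
      have "distinct (nbrs H (Intl w))" using L(1) old_inj[OF 5(1)] by (simp add: N distinct_map)
      moreover have "length (nbrs H (Intl w)) = 3" using L(2) by (simp add: N)
      moreover have "Intl w \<notin> set (nbrs H (Intl w))"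
        using L(3) 5 fresh' by (auto simp: N old_def rn_def split: vertex.splits if_splits)
      moreover have "j \<in> {1..n + 1} \<and> V' j = w" if bj: "Bdry j \<in> set (nbrs H (Intl w))" for j
      proof -
        obtain j' where j': "Bdry j' \<in> set (nbrs G (Intl w))" "j = (if j' > i then j' + 1 else j')"
          using bj by (auto simp: N old_def split: vertex.splits)
        then have "j' \<in> {1..n}" "V j' = w" using L(4) by auto
        moreover then have "j' \<noteq> i" using Vi 5 by auto
        ultimately show ?thesis using j' by (auto simp: V'_def unsh_def)
      qed
      moreover have "x \<in> internal H" if "Intl x \<in> set (nbrs H (Intl w))" for x
        using that L(5) by (auto simp: N old_def rn_def internal_H split: vertex.splits if_splits)
      ultimately show ?thesis by blast
    qed (use dist ef fresh' i in \<open>auto simp: nbrs_H internal_H V'_def\<close>)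
  qed
  show ?thesis unfolding well_formed_def using bn inj bd loc by blast
qed

lemma turn_H_old:
  assumes "w \<in> internal G" "turn G w p q"
  shows "turn H w (old w p) (old w q)"
  using assms(2) unfolding turn_def colour_H(5)[OF assms(1)] nbrs_H_old[OF assms(1)]
  by (simp add: next_cw_map split: if_splits)

lemma turn_H_new:
  "turn H a (Intl e) (Intl d)" "turn H a (Intl d) (Intl b)" "turn H a (Intl b) (Intl e)"
  "turn H b (Intl c) (Intl a)" "turn H b (Intl a) (Intl f)" "turn H b (Intl f) (Intl c)"
  "turn H c (Bdry i) (Intl b)" "turn H c (Intl b) (Intl d)" "turn H c (Intl d) (Bdry i)"
  "turn H d (Bdry (i + 1)) (Intl a)" "turn H d (Intl a) (Intl c)" "turn H d (Intl c) (Bdry (i + 1))"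
  by (simp_all add: turn_def nbrs_H colour_H next_cw_triple)

lemma turn_s_t:
  assumes "j \<in> {1..n}"
  shows "turn G (V j) (Bdry j) (Intl (s j))" "turn G (V j) (Intl (s j)) (Intl (t j))"
    "turn G (V j) (Intl (t j)) (Bdry j)"
  using rt assms unfolding routed_def by blast+

lemma s_t_i:
  "colour G v = Black \<Longrightarrow> s i = f \<and> t i = e" "colour G v = White \<Longrightarrow> s i = e \<and> t i = f"
proof -
  note T = turn_s_t[OF i, unfolded Vi turn_triple[OF rot]]
  show "colour G v = Black \<Longrightarrow> s i = f \<and> t i = e" using T nbrs_v(2) by simp
  show "colour G v = White \<Longrightarrow> s i = e \<and> t i = f" using T nbrs_v(2) by simp
qed

lemma new_notin: "a \<notin> V' ` {1..n + 1}" "b \<notin> V' ` {1..n + 1}"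
proof -
  have "V' j \<noteq> a \<and> V' j \<noteq> b" if "j \<in> {1..n + 1}" for j
  proof (cases "j = i \<or> j = i + 1")
    case True
    then show ?thesis using dist by (auto simp: V'_def)
  next
    case False
    then show ?thesis using V'_notin[OF that] fresh'(1) by blast
  qed
  then show "a \<notin> V' ` {1..n + 1}" "b \<notin> V' ` {1..n + 1}" by (metis imageE)+
qed

text \<open>A segment never turns at \<open>v\<close>, because \<open>v = V i\<close> belongs to the
  avoided set. Hence it meets \<open>v\<close> at most at its two ends, and all its turns take place
  at vertices that survive.\<close>

lemma seg_H:
  "seg G (V ` {1..n}) w x w' x' \<Longrightarrow> x \<in> internal G \<Longrightarrow>
     seg H (V' ` {1..n + 1}) (src w x) (dst w x) (src w' x') (dst w' x')"
proof (induction rule: seg.induct)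
  case (arrived w x)
  show ?case by (rule seg.arrived)
next
  case (step x w y w' x')
  have xv: "x \<noteq> v" using step.hyps(1) Vi i by auto
  have d: "dst w x = x" using xv by (simp add: dst_def rn_def)
  have "x \<notin> V' ` {1..n + 1}"
  proof
    assume "x \<in> V' ` {1..n + 1}"
    then obtain j where j: "j \<in> {1..n + 1}" "x = V' j" by auto
    then show False using V'_notin[OF j(1)] step.hyps(1) step.prems fresh'
      by (cases "j = i \<or> j = i + 1") (auto simp: V'_def)
  qed
  moreover have "turn H x (Intl (src w x)) (Intl (dst x y))"
  proof -
    have "old x (Intl w) = Intl (src w x)" "old x (Intl y) = Intl (dst x y)"
      using xv by (auto simp: old_def src_def dst_def rn_def)
    then show ?thesis using turn_H_old[OF step.prems step.hyps(2)] by simp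
  qed
  moreover have "y \<in> internal G"
    using turn_set[OF step.hyps(2)] internal_nbrs(5)[OF step.prems] by simp
  moreover have "src x y = x" using xv by (simp add: src_def)
  ultimately show ?case using step.IH d seg.step by metis
qed

text \<open>A trip arriving at the blown up vertex from \<open>e\<close> turns at \<open>a\<close>
  towards \<open>d\<close>, one from \<open>f\<close> turns at \<open>b\<close> towards
  \<open>c\<close>. Either way it crosses there next, so an old end at \<open>i\<close> becomes the
  crossing \<open>Xg u'\<close>.\<close>

lemma seg_arrival:
  assumes y: "idx y \<in> {1..n}"
  defines "z \<equiv> arrive_ren i u u' y"
  shows "idx z \<in> {1..n + 1} \<and> seg H (V' ` {1..n + 1}) (src (arrival s t y) (V (idx y)))
    (dst (arrival s t y) (V (idx y))) (arrival s' t' z) (V' (idx z))"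
proof (cases "idx y = i")
  case True
  have e: "seg H (V' ` {1..n + 1}) (src e v) (dst e v) (s' (i + 1)) (V' (i + 1))"
    using seg.step[OF new_notin(1) turn_H_new(1) seg.arrived] ef dist
    by (simp add: src_def dst_def rn_def s'_def V'_def)
  have f: "seg H (V' ` {1..n + 1}) (src f v) (dst f v) (s' i) (V' i)"
    using seg.step[OF new_notin(2) turn_H_new(6) seg.arrived] ef dist
    by (simp add: src_def dst_def rn_def s'_def V'_def)
  show ?thesis using True e f s_t_i i Vi
    by (cases y; cases "colour G v") (auto simp: z_def u_def u'_def grow_def)
next
  case False
  let ?j = "idx y"
  define j' where "j' = grow i u ?j"
  have j': "j' \<noteq> i" "j' \<noteq> i + 1" "unsh i j' = ?j" "j' \<in> {1..n + 1}"
    using False y by (auto simp: j'_def grow_def unsh_def)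
  have 1: "idx z = j'" "arrival s' t' z = rn (V ?j) (arrival s t y)"
    using False j' by (cases y; simp add: z_def j'_def s'_def t'_def)+
  have "src (arrival s t y) (V ?j) = rn (V ?j) (arrival s t y)" "dst (arrival s t y) (V ?j) = V' j'"
    using V_neq[OF y False] j' by (auto simp: src_def dst_def rn_def V'_def)
  then show ?thesis using 1 j' by (simp add: seg.arrived)
qed

lemma routed_H: "routed H (n + 1) V' s' t' (grow_nx i u u' nx)"
proof -
  let ?B = "V' ` {1..n + 1}"
  have turns: "turn H (V' j) (Bdry j) (Intl (s' j)) \<and> turn H (V' j) (Intl (s' j)) (Intl (t' j)) \<and>
        turn H (V' j) (Intl (t' j)) (Bdry j)" if j: "j \<in> {1..n + 1}" for j
  proof (cases "j = i \<or> j = i + 1")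
    case True
    then show ?thesis using turn_H_new by (auto simp: V'_def s'_def t'_def)
  next
    case False
    define k where "k = unsh i j"
    have k: "k \<in> {1..n}" "k \<noteq> i" "V' j = V k" "V k \<in> internal G"
      using V'_notin[OF j] False by (auto simp: k_def)
    have "old (V k) (Bdry k) = Bdry j" using False by (auto simp: old_def k_def unsh_def)
    moreover have "old (V k) (Intl (s k)) = Intl (s' j)" "old (V k) (Intl (t k)) = Intl (t' j)"
      using False by (auto simp: old_def s'_def t'_def k_def)
    ultimately show ?thesis using turn_s_t[OF k(1)] turn_H_old[OF k(4)] k(3) by metis
  qed
  have nxG: "idx (grow_nx i u u' nx z) \<in> {1..n + 1} \<and>
      seg H ?B p q (arrival s' t' (grow_nx i u u' nx z)) (V' (idx (grow_nx i u u' nx z)))"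
    if y: "idx y \<in> {1..n}" "grow_nx i u u' nx z = arrive_ren i u u' (nx y)"
      and sg: "seg H ?B p q (src (V (idx y)) (departure s t y)) (dst (V (idx y)) (departure s t y))"
    for z y p q
  proof -
    have 1: "idx (nx y) \<in> {1..n}"
      "seg G (V ` {1..n}) (V (idx y)) (departure s t y) (arrival s t (nx y)) (V (idx (nx y)))"
      using rt y(1) unfolding routed_def by blast+
    have "departure s t y \<in> internal G"
      using turn_set[OF turn_s_t(1)[OF y(1)]] turn_set[OF turn_s_t(2)[OF y(1)]]
        internal_nbrs(5)[OF V(1)[OF y(1)]] by (cases y) auto
    from seg_trans[OF sg seg_H[OF 1(2) this]] show ?thesis
      using seg_arrival[OF 1(1)] y(2) by (simp add: seg_trans)
  qed
  have nxt: "idx (grow_nx i u u' nx z) \<in> {1..n + 1} \<and>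
      seg H ?B (V' (idx z)) (departure s' t' z) (arrival s' t' (grow_nx i u u' nx z))
        (V' (idx (grow_nx i u u' nx z)))" if z: "idx z \<in> {1..n + 1}" for z
  proof -
    have uu: "u \<noteq> u'" "{u, u'} = {i, i + 1}" by (auto simp: u_def u'_def)
    consider "z = Bd i" | "z = Bd (i + 1)" | "z = Xg i" | "z = Xg (i + 1)"
      | "idx z \<noteq> i" "idx z \<noteq> i + 1" by (cases z) auto
    then show ?thesis
    proof cases
      case 1
      \<comment> \<open>The trip from \<open>Bdry i\<close> runs through \<open>c\<close>,
        \<open>b\<close> and \<open>a\<close> to \<open>e\<close>. The old trip that left
        \<open>v\<close> towards \<open>e\<close> was the one crossing at \<open>i\<close> if
        \<open>v\<close> is black, and the one starting at \<open>i\<close> if \<open>v\<close> is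
        white.\<close>
      define y where "y = (if colour G v = Black then Xg i else Bd i)"
      have y: "idx y = i" "departure s t y = e" using s_t_i by (cases "colour G v"; auto simp: y_def)+
      have "seg H ?B c b a e"
        using seg.step[OF new_notin(2) turn_H_new(4) seg.step[OF new_notin(1) turn_H_new(3) seg.arrived]] .
      then have "seg H ?B (V' i) (s' i) (src (V (idx y)) (departure s t y)) (dst (V (idx y)) (departure s t y))"
        using y Vi by (simp add: V'_def s'_def src_def dst_def)
      moreover have "grow_nx i u u' nx z = arrive_ren i u u' (nx y)"
        using 1 by (cases "colour G v") (auto simp: y_def u_def unsh_def)
      ultimately show ?thesis using nxG[of y z] y 1 i by simp
    next
      case 2
      define y where "y = (if colour G v = Black then Bd i else Xg i)"
      have y: "idx y = i" "departure s t y = f" using s_t_i by (cases "colour G v"; auto simp: y_def)+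
      have "seg H ?B d a b f"
        using seg.step[OF new_notin(1) turn_H_new(2) seg.step[OF new_notin(2) turn_H_new(5) seg.arrived]] .
      then have "seg H ?B (V' (i + 1)) (s' (i + 1)) (src (V (idx y)) (departure s t y)) (dst (V (idx y)) (departure s t y))"
        using y Vi ef by (simp add: V'_def s'_def src_def dst_def)
      moreover have "grow_nx i u u' nx z = arrive_ren i u u' (nx y)"
        using 2 by (cases "colour G v") (auto simp: y_def u_def unsh_def)
      ultimately show ?thesis using nxG[of y z] y 2 i by simp
    next
      case 3
      then have "grow_nx i u u' nx z = Bd (i + 1)" by (cases "colour G v") (auto simp: u_def u'_def)
      then show ?thesis using 3 i by (auto simp: V'_def t'_def seg.arrived)
    next
      case 4
      then have "grow_nx i u u' nx z = Bd i" by (cases "colour G v") (auto simp: u_def u'_def)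
      then show ?thesis using 4 i by (auto simp: V'_def t'_def seg.arrived)
    next
      case 5
      define y where "y = (case z of Bd j \<Rightarrow> Bd (unsh i j) | Xg j \<Rightarrow> Xg (unsh i j))"
      have V'z: "unsh i (idx z) \<in> {1..n}" "unsh i (idx z) \<noteq> i" "V' (idx z) = V (unsh i (idx z))" "V' (idx z) \<noteq> v"
        using V'_notin[OF z 5] by auto
      have y: "idx y = unsh i (idx z)" by (cases z) (auto simp: y_def)
      have g: "grow_nx i u u' nx z = arrive_ren i u u' (nx y)"
        using 5 uu by (cases z) (auto simp: y_def)
      have "departure s' t' z = dst (V (idx y)) (departure s t y)"
        using 5 y V'z by (cases z) (auto simp: y_def s'_def t'_def dst_def)
      moreover have "V' (idx z) = src (V (idx y)) (departure s t y)"
        using V'z y by (auto simp: src_def)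
      ultimately have "seg H ?B (V' (idx z)) (departure s' t' z)
          (src (V (idx y)) (departure s t y)) (dst (V (idx y)) (departure s t y))"
        by (metis seg.arrived)
      from nxG[OF _ g this] show ?thesis using V'z(1) y by metis
    qed
  qed
  show ?thesis unfolding routed_def using turns nxt by blast
qed

end

section \<open>Cutting the crossing trip\<close>

fun depart_ren :: "nat \<Rightarrow> nat \<Rightarrow> nat \<Rightarrow> mark \<Rightarrow> mark" where
  "depart_ren i u u' (Bd j) = Bd (if j = i then u' else grow i u j)"
| "depart_ren i u u' (Xg j) = Xg (grow i u j)"

lemma chain_unique: "chain nx z j \<Longrightarrow> chain nx z j' \<Longrightarrow> j = j'"
proof (induction arbitrary: j' rule: chain.induct)
  case (stop z j)
  then show ?case by (auto elim: chain.cases)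
next
  case (cross z k j)
  from cross.prems cross.hyps(1) have "chain nx (Xg k) j'" by (auto elim: chain.cases)
  then show ?case by (rule cross.IH)
qed

text \<open>\<open>Q\<close> collects the marks which a trip meets between its crossing at \<open>i\<close> and its end \<open>r\<close>.\<close>

locale cut =
  fixes n i u u' :: nat and nx r Q
  assumes i: "i \<in> {1..n}" and u: "u = i \<and> u' = i + 1 \<or> u = i + 1 \<and> u' = i"
    and range: "\<And>z. idx z \<in> {1..n} \<Longrightarrow> idx (nx z) \<in> {1..n}"
    and Q: "i \<notin> Q" "Q \<subseteq> {1..n}"
    and bwd: "\<And>x. idx x \<in> {1..n} \<Longrightarrow> nx x \<in> insert (Bd r) (Xg ` Q) \<Longrightarrow> x \<in> Xg ` insert i Q"
    and fwd: "\<And>q. q \<in> insert i Q \<Longrightarrow> nx (Xg q) \<in> insert (Bd r) (Xg ` Q)"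
    and end_chain: "\<And>q. q \<in> insert i Q \<Longrightarrow> chain nx (Xg q) r"
    and r: "r \<noteq> i"
begin

abbreviation "nx' \<equiv> grow_nx i u u' nx"

text \<open>The new routing is the old one up to renaming departures and arrivals. The only
  exception is the departure after the crossing at \<open>i\<close>, where the cut is made.\<close>

lemma nx'_ren:
  assumes "x \<noteq> Xg i"
  shows "nx' (depart_ren i u u' x) = arrive_ren i u u' (nx x)"
proof (cases x)
  case (Bd j)
  then show ?thesis using u by (auto simp: grow_def unsh_def)
next
  case (Xg j)
  then have "j \<noteq> i" using assms by simp
  then show ?thesis using Xg u by (auto simp: grow_def unsh_def)
qed

lemma nx'_new: "nx' (Xg u) = Bd u'" "nx' (Xg u') = Bd u"
  using u by auto

lemma chain_new: "chain nx' (Xg u) u'" "chain nx' (Xg u') u"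
  by (rule chain.stop, rule nx'_new)+

text \<open>A trip that does not end at \<open>r\<close> cannot cross at \<open>i\<close>, since
  chains are deterministic; hence only names change. The trip that ended at \<open>i\<close> now
  crosses at \<open>u'\<close> and ends at \<open>u\<close>, which is the value of
  \<open>grow\<close> there.\<close>

lemma chain_other:
  "chain nx x j \<Longrightarrow> idx x \<in> {1..n} \<Longrightarrow> j \<noteq> r \<Longrightarrow> chain nx' (depart_ren i u u' x) (grow i u j)"
proof (induction rule: chain.induct)
  case (stop x j)
  have "x \<noteq> Xg i" using stop fwd[of i] by auto
  then have e: "nx' (depart_ren i u u' x) = arrive_ren i u u' (Bd j)" using nx'_ren stop by simp
  show ?case
  proof (cases "j = i")
    case True
    then have "nx' (depart_ren i u u' x) = Xg u'" using e by simp
    then show ?thesis using chain.cross[OF _ chain_new(2)] True by (simp add: grow_def)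
  next
    case False
    then show ?thesis using e by (auto intro: chain.stop)
  qed
next
  case (cross x k j)
  have k: "k \<in> {1..n}" using range[OF cross.prems(1)] cross.hyps(1) by simp
  have "x \<noteq> Xg i"
  proof
    assume "x = Xg i"
    then have "chain nx x r" using end_chain by simp
    then show False using chain_unique[OF chain.cross[OF cross.hyps]] cross.prems by simp
  qed
  then have "nx' (depart_ren i u u' x) = Xg (grow i u k)" using nx'_ren cross.hyps by simp
  then show ?case using cross.IH k cross.prems by (auto intro: chain.cross)
qed

text \<open>By \<open>bwd\<close> the marks after the cut can be entered only through the crossing
  at \<open>i\<close>. So every trip ending at \<open>r\<close> crosses at \<open>i\<close>, and it
  is now diverted: the crossing at \<open>u\<close> leads to the end \<open>u'\<close>.\<close>

lemma chain_before:
  "chain nx x j \<Longrightarrow> idx x \<in> {1..n} \<Longrightarrow> j = r \<Longrightarrow> x \<notin> Xg ` insert i Q \<Longrightarrow>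
     chain nx' (depart_ren i u u' x) u'"
proof (induction rule: chain.induct)
  case (stop x j)
  then show ?case using bwd[of x] by auto
next
  case (cross x k j)
  have k: "k \<in> {1..n}" using range[OF cross.prems(1)] cross.hyps(1) by simp
  have kQ: "k \<notin> Q" using bwd[OF cross.prems(1)] cross.hyps(1) cross.prems(3) by auto
  have "nx' (depart_ren i u u' x) = Xg (grow i u k)" using nx'_ren cross by auto
  moreover have "chain nx' (Xg (grow i u k)) u'"
  proof (cases "k = i")
    case True
    then show ?thesis using chain_new(1) by (simp add: grow_def)
  next
    case False
    then show ?thesis using cross.IH k kQ cross.prems by (auto simp: image_iff)
  qed
  ultimately show ?case by (rule chain.cross)
qed

lemma chain_after:
  "chain nx x j \<Longrightarrow> x \<in> Xg ` Q \<Longrightarrow> chain nx' (depart_ren i u u' x) (grow i u r)"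
proof (induction rule: chain.induct)
  case (stop x j)
  from stop(2) obtain q where q: "q \<in> Q" "x = Xg q" by auto
  have "x \<noteq> Xg i" "nx x = Bd r" using q stop(1) Q(1) fwd[of q] by auto
  then have "nx' (depart_ren i u u' x) = Bd (grow i u r)" using nx'_ren r by simp
  then show ?case by (rule chain.stop)
next
  case (cross x k j)
  from cross.prems obtain q where q: "q \<in> Q" "x = Xg q" by auto
  have x: "x \<noteq> Xg i" "k \<in> Q" using q cross.hyps(1) Q(1) fwd[of q] by auto
  then have "nx' (depart_ren i u u' x) = Xg (grow i u k)" using nx'_ren cross by simp
  then show ?case using cross.IH x(2) by (auto intro: chain.cross)
qed

lemma chain_first_part:
  assumes "chain nx (Bd j) y" "j \<in> {1..n}"
  shows "chain nx' (Bd (if j = i then u' else grow i u j)) (if y = r then u' else grow i u y)"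
proof -
  have "Bd j \<notin> Xg ` insert i Q" by auto
  then show ?thesis
    using chain_other[OF assms(1)] chain_before[OF assms(1)] assms(2) by (cases "y = r") simp_all
qed

lemma chain_second_part: "chain nx' (Bd u) (grow i u r)"
proof -
  have e: "nx' (Bd u) = arrive_ren i u u' (nx (Xg i))" by simp
  from fwd[of i] consider "nx (Xg i) = Bd r" | q where "q \<in> Q" "nx (Xg i) = Xg q" by auto
  then show ?thesis
  proof cases
    case 1
    then show ?thesis using e r by (auto intro: chain.stop)
  next
    case 2
    then have "chain nx' (Xg (grow i u q)) (grow i u r)"
      using chain_after[OF end_chain[of q]] by auto
    then show ?thesis using e 2 by (auto intro: chain.cross)
  qed
qed

lemma inj_nx':
  assumes inj: "inj_on nx {z. idx z \<in> {1..n}}"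
  shows "inj_on nx' {z. idx z \<in> {1..n + 1}}"
proof (rule inj_onI)
  fix x y assume x: "x \<in> {z. idx z \<in> {1..n + 1}}" and y: "y \<in> {z. idx z \<in> {1..n + 1}}"
    and eq: "nx' x = nx' y"
  \<comment> \<open>Inverse renaming: apart from the crossings at the two new corners, every new
    departure comes from exactly one old one.\<close>
  define pull where "pull z = (case z of Bd j \<Rightarrow> if j = u then Xg i else Bd (unsh i j)
    | Xg j \<Rightarrow> Xg (unsh i j))" for z
  have new: "nx' z = arrive_ren i u u' (nx (pull z))" if "z \<noteq> Xg u" "z \<noteq> Xg u'" for z
    using that by (cases z) (auto simp: pull_def)
  have pull_range: "idx (pull z) \<in> {1..n}" if "idx z \<in> {1..n + 1}" for z
    using that i u by (cases z) (auto simp: pull_def unsh_def)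
  have pull_inj: "p = q" if "p \<noteq> Xg u" "p \<noteq> Xg u'" "q \<noteq> Xg u" "q \<noteq> Xg u'" "pull p = pull q" for p q
    using that u by (cases p; cases q) (auto simp: pull_def unsh_def split: if_splits)
  have not_new: "arrive_ren i u u' z \<noteq> Bd u \<and> arrive_ren i u u' z \<noteq> Bd u'" for z
    using u by (cases z) (auto simp: grow_def)
  have ren_inj: "arrive_ren i u u' p = arrive_ren i u u' q \<Longrightarrow> p = q" for p q
    using u by (cases p; cases q) (auto simp: grow_def split: if_splits)
  have uu: "u \<noteq> u'" using u by auto
  show "x = y"
  proof (cases "x \<in> {Xg u, Xg u'} \<or> y \<in> {Xg u, Xg u'}")
    case True
    then show ?thesis using eq new[of x] new[of y] not_new nx'_new uu
      by (metis empty_iff insert_iff mark.inject(1))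
  next
    case False
    then have "nx (pull x) = nx (pull y)" using new eq ren_inj by simp
    then have "pull x = pull y" using inj_onD[OF inj] pull_range x y by simp
    then show ?thesis using pull_inj False by simp
  qed
qed

end

section \<open>Runs of trips along the boundary\<close>

definition sh :: "nat \<Rightarrow> nat \<Rightarrow> nat" where
  "sh a y = (if y < a then y else y + 1)"

text \<open>The corner \<open>c\<close> next to \<open>i\<close> is black and the corner
  \<open>d\<close> next to \<open>i + 1\<close> is white, whatever the colour of the old vertex. The
  colours beyond move up by one.\<close>

definition insert_black :: "nat \<Rightarrow> nat set \<Rightarrow> nat set" where
  "insert_black i B = insert i (sh i ` (B - {i}))"

lemma mem_insert_black:
  "j \<in> insert_black i B \<longleftrightarrow> j = i \<or> j < i \<and> j \<in> B \<or> j > i + 1 \<and> j - 1 \<in> B"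
proof
  assume "j \<in> insert_black i B"
  then show "j = i \<or> j < i \<and> j \<in> B \<or> j > i + 1 \<and> j - 1 \<in> B"
    by (auto simp: insert_black_def sh_def)
next
  assume "j = i \<or> j < i \<and> j \<in> B \<or> j > i + 1 \<and> j - 1 \<in> B"
  then consider "j = i" | "j < i" "j \<in> B" | "j > i + 1" "j - 1 \<in> B" by blast
  then show "j \<in> insert_black i B"
  proof cases
    case 3
    then have "j = sh i (j - 1)" "j - 1 \<in> B - {i}" by (auto simp: sh_def)
    then show ?thesis unfolding insert_black_def by blast
  qed (auto simp: insert_black_def sh_def image_iff)
qed

text \<open>\<open>B\<close> is the set of the \<open>i \<in> {2..n-1}\<close> adjacent to a black vertex. A trip that crosses at one
  of these \<open>i\<close> runs clockwise through the following black ones up to the next white one, and it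
  runs counterclockwise in the same way if \<open>i\<close> is adjacent to a white vertex.\<close>

definition staircase :: "nat \<Rightarrow> nat set \<Rightarrow> (mark \<Rightarrow> mark) \<Rightarrow> bool" where
  "staircase n B nx \<longleftrightarrow> n \<ge> 4 \<and> B \<subseteq> {2..n - 2} \<and> 2 \<in> B \<and>
     (\<forall>z. idx z \<in> {1..n} \<longrightarrow> idx (nx z) \<in> {1..n}) \<and> inj_on nx {z. idx z \<in> {1..n}} \<and>
     nx (Bd 1) = Xg 2 \<and>
     (\<forall>i\<in>{2..n - 1}. nx (Xg i) =
        (if i \<in> B then if i + 1 \<in> B then Xg (i + 1) else Bd (i + 1)
         else if i - 1 \<in> B then Bd (i - 1) else Xg (i - 1)))"

lemma staircaseD:
  assumes "staircase n B nx"
  shows "n \<ge> 4" "B \<subseteq> {2..n - 2}" "2 \<in> B"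
    "\<And>z. idx z \<in> {1..n} \<Longrightarrow> idx (nx z) \<in> {1..n}" "inj_on nx {z. idx z \<in> {1..n}}"
    "nx (Bd 1) = Xg 2"
    "\<And>i. i \<in> {2..n - 1} \<Longrightarrow> i \<in> B \<Longrightarrow> nx (Xg i) = (if i + 1 \<in> B then Xg (i + 1) else Bd (i + 1))"
    "\<And>i. i \<in> {2..n - 1} \<Longrightarrow> i \<notin> B \<Longrightarrow> nx (Xg i) = (if i - 1 \<in> B then Bd (i - 1) else Xg (i - 1))"
  using assms unfolding staircase_def by auto

text \<open>From \<open>i\<close> on the trip passes the crossings up to the first white vertex
  \<open>r\<close> in order, so the marks after the cut are those of \<open>{i<..<r}\<close>.
  Condition \<open>bwd\<close> is injectivity of \<open>nx\<close>: each of these marks already has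
  a predecessor in the run.\<close>

lemma cut_black:
  assumes st: "staircase n B nx" and i: "i \<in> B" and r: "i < r" "{i..<r} \<subseteq> B" "r \<notin> B"
  shows "cut n i i (i + 1) nx r {i<..<r}"
proof
  note D = staircaseD[OF st]
  have B: "q \<in> B \<and> q \<in> {2..n - 1}" if "q \<in> {i..<r}" for q
  proof -
    have "q \<in> B" using that r(2) by blast
    moreover then have "q \<in> {2..n - 2}" using D(2) by blast
    ultimately show ?thesis by auto
  qed
  have nx: "nx (Xg q) = (if q + 1 = r then Bd r else Xg (q + 1))" if "q \<in> {i..<r}" for q
  proof (cases "q + 1 = r")
    case True
    then show ?thesis using D(7)[of q] B[OF that] r by auto
  next
    case False
    then have "q + 1 \<in> {i..<r}" using that by auto
    then show ?thesis using D(7)[of q] B[OF that] B False by auto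
  qed
  have n1: "r - 1 \<le> n - 1" using B[of "r - 1"] r(1) by auto
  show "i \<in> {1..n}" using B[of i] r(1) by auto
  show "i = i \<and> i + 1 = i + 1 \<or> i = i + 1 \<and> i + 1 = i" by simp
  show "\<And>z. idx z \<in> {1..n} \<Longrightarrow> idx (nx z) \<in> {1..n}" using D(4) .
  show "i \<notin> {i<..<r}" "{i<..<r} \<subseteq> {1..n}" "r \<noteq> i" using n1 D(1) r by auto
  show fwd: "nx (Xg q) \<in> insert (Bd r) (Xg ` {i<..<r})" if "q \<in> insert i {i<..<r}" for q
  proof (cases "q + 1 = r")
    case True
    then show ?thesis using nx[of q] that r(1) by auto
  next
    case False
    then have "nx (Xg q) = Xg (q + 1)" "q + 1 \<in> {i<..<r}" using nx[of q] that r(1) by auto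
    then show ?thesis by blast
  qed
  show "x \<in> Xg ` insert i {i<..<r}"
    if x: "idx x \<in> {1..n}" and nxx: "nx x \<in> insert (Bd r) (Xg ` {i<..<r})" for x
  proof -
    obtain q where q: "q \<in> {i..<r}" "nx (Xg q) = nx x"
    proof (cases "nx x = Bd r")
      case True
      then show ?thesis using that[of "r - 1"] nx[of "r - 1"] r(1) by auto
    next
      case False
      then obtain k where k: "k \<in> {i<..<r}" "nx x = Xg k" using nxx by auto
      then have "k - 1 \<in> {i..<r}" by auto
      then show ?thesis using that[of "k - 1"] nx[of "k - 1"] k by auto
    qed
    then have "x = Xg q" using inj_onD[OF D(5) q(2)] x B[OF q(1)] by auto
    then show ?thesis using q(1) by auto
  qed
  show "chain nx (Xg q) r" if "q \<in> insert i {i<..<r}" for q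
  proof -
    have "q < r \<Longrightarrow> i \<le> q \<Longrightarrow> chain nx (Xg q) r" for q
    proof (induction "r - q" arbitrary: q rule: less_induct)
      case less
      show ?case
      proof (cases "q + 1 = r")
        case True
        then show ?thesis using nx[of q] less.prems by (auto intro: chain.stop)
      next
        case False
        then have "chain nx (Xg (q + 1)) r" using less by auto
        then show ?thesis using nx[of q] less.prems False by (auto intro: chain.cross)
      qed
    qed
    then show ?thesis using that r(1) by auto
  qed
qed

lemma cut_white:
  assumes st: "staircase n B nx" and i: "i \<in> {3..n - 1}"
    and r: "r \<in> B" "r < i" "{r<..i} \<inter> B = {}"
  shows "cut n i (i + 1) i nx r {r<..<i}"
proof
  note D = staircaseD[OF st]
  have B: "q \<notin> B \<and> q \<in> {2..n - 1}" if "q \<in> {r<..i}" for q using that r i D(2) by auto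
  have nx: "nx (Xg q) = (if q - 1 = r then Bd r else Xg (q - 1))" if "q \<in> {r<..i}" for q
  proof (cases "q - 1 = r")
    case True
    then show ?thesis using D(8)[of q] B[OF that] r by auto
  next
    case False
    then have "q - 1 \<in> {r<..i}" using that by auto
    then show ?thesis using D(8)[of q] B[OF that] B False by auto
  qed
  have r1: "2 \<le> r" using r D(2) by auto
  show "i \<in> {1..n}" using i by auto
  show "i + 1 = i \<and> i = i + 1 \<or> i + 1 = i + 1 \<and> i = i" by simp
  show "\<And>z. idx z \<in> {1..n} \<Longrightarrow> idx (nx z) \<in> {1..n}" using D(4) .
  show "i \<notin> {r<..<i}" "{r<..<i} \<subseteq> {1..n}" "r \<noteq> i" using i r by auto
  show fwd: "nx (Xg q) \<in> insert (Bd r) (Xg ` {r<..<i})" if "q \<in> insert i {r<..<i}" for q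
  proof (cases "q - 1 = r")
    case True
    then show ?thesis using nx[of q] that r(2) by auto
  next
    case False
    then have "nx (Xg q) = Xg (q - 1)" "q - 1 \<in> {r<..<i}" using nx[of q] that r(2) by auto
    then show ?thesis by blast
  qed
  show "x \<in> Xg ` insert i {r<..<i}"
    if x: "idx x \<in> {1..n}" and nxx: "nx x \<in> insert (Bd r) (Xg ` {r<..<i})" for x
  proof -
    obtain q where q: "q \<in> {r<..i}" "nx (Xg q) = nx x"
    proof (cases "nx x = Bd r")
      case True
      then show ?thesis using that[of "r + 1"] nx[of "r + 1"] r(2) by auto
    next
      case False
      then obtain k where k: "k \<in> {r<..<i}" "nx x = Xg k" using nxx by auto
      then have "k + 1 \<in> {r<..i}" by auto
      then show ?thesis using that[of "k + 1"] nx[of "k + 1"] k by auto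
    qed
    then have "x = Xg q" using inj_onD[OF D(5) q(2)] x B[OF q(1)] by auto
    then show ?thesis using q(1) by auto
  qed
  show "chain nx (Xg q) r" if "q \<in> insert i {r<..<i}" for q
  proof -
    have "r < q \<Longrightarrow> q \<le> i \<Longrightarrow> chain nx (Xg q) r" for q
    proof (induction q)
      case (Suc q)
      show ?case
      proof (cases "q = r")
        case True
        then show ?thesis using nx[of "Suc q"] Suc.prems by (auto intro: chain.stop)
      next
        case False
        then have "chain nx (Xg q) r" using Suc by auto
        then show ?thesis using nx[of "Suc q"] Suc.prems False by (auto intro: chain.cross)
      qed
    qed simp
    then show ?thesis using that r(2) by auto
  qed
qed

text \<open>The two new crossings obey the rule for a black \<open>i\<close> and a white
  \<open>i + 1\<close>: \<open>Xg i\<close> leads to \<open>Bd (i + 1)\<close> and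
  \<open>Xg (i + 1)\<close> to \<open>Bd i\<close>. A run that used to cross or to end at
  \<open>i\<close> now crosses at the nearer one of \<open>i\<close> and \<open>i + 1\<close>,
  whatever the old colour.\<close>

lemma staircase_grow:
  assumes st: "staircase n B nx" and c: "cut n i u u' nx r Q"
    and i: "i \<in> {2..n - 1}" and u: "u = (if i \<in> B then i else i + 1)"
    and rng: "\<And>z. idx z \<in> {1..n + 1} \<Longrightarrow> idx (grow_nx i u u' nx z) \<in> {1..n + 1}"
  shows "staircase (n + 1) (insert_black i B) (grow_nx i u u' nx)"
proof -
  note D = staircaseD[OF st]
  have uu: "u = i \<and> u' = i + 1 \<or> u = i + 1 \<and> u' = i" using c by (simp add: cut_def)
  have u1: "u \<noteq> 1" "2 \<le> u'" using i uu by auto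
  have "insert_black i B \<subseteq> {2..n + 1 - 2}"
  proof
    fix x assume "x \<in> insert_black i B"
    then consider "x = i" | "x < i" "x \<in> {2..n - 2}" | "x > i + 1" "x - 1 \<in> {2..n - 2}"
      using D(2) unfolding mem_insert_black by blast
    then show "x \<in> {2..n + 1 - 2}" using i D(1) by cases auto
  qed
  moreover have "2 \<in> insert_black i B" using D(3) i by (cases "i = 2") (auto simp: mem_insert_black)
  moreover have "grow_nx i u u' nx (Bd 1) = Xg 2"
  proof -
    have "grow_nx i u u' nx (Bd 1) = arrive_ren i u u' (Xg 2)"
      using u1 i D(6) by (auto simp: unsh_def)
    then show ?thesis using i u D(3) by (auto simp: grow_def)
  qed
  moreover have "grow_nx i u u' nx (Xg k) =
      (if k \<in> insert_black i B then if k + 1 \<in> insert_black i B then Xg (k + 1) else Bd (k + 1)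
         else if k - 1 \<in> insert_black i B then Bd (k - 1) else Xg (k - 1))"
    if k: "k \<in> {2..n + 1 - 1}" for k
  proof -
    consider "k = i" | "k = i + 1" | "k < i" | "k > i + 1" by linarith
    then show ?thesis
    proof cases
      case 1
      then show ?thesis using uu by (auto simp: mem_insert_black)
    next
      case 2
      then show ?thesis using uu by (auto simp: mem_insert_black)
    next
      case 3
      have e: "grow_nx i u u' nx (Xg k) = arrive_ren i u u' (nx (Xg k))"
        using 3 uu by (auto simp: unsh_def)
      have k': "k \<in> {2..n - 1}" using 3 i k by auto
      have m: "k \<in> insert_black i B \<longleftrightarrow> k \<in> B" "k - 1 \<in> insert_black i B \<longleftrightarrow> k - 1 \<in> B"
        "k + 1 \<in> insert_black i B \<longleftrightarrow> k + 1 = i \<or> k + 1 \<in> B"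
        using 3 by (auto simp: mem_insert_black)
      show ?thesis
      proof (cases "k \<in> B")
        case True
        then show ?thesis using D(7)[OF k' True] 3 uu u
          unfolding e m by (cases "k + 1 = i") (auto simp: grow_def)
      next
        case False
        then show ?thesis using D(8)[OF k' False] 3
          unfolding e m by (auto simp: grow_def)
      qed
    next
      case 4
      define l where "l = k - 1"
      have l: "k = l + 1" "i < l" using 4 by (auto simp: l_def)
      have e: "grow_nx i u u' nx (Xg k) = arrive_ren i u u' (nx (Xg l))"
        using l uu by (auto simp: unsh_def)
      have l': "l \<in> {2..n - 1}" using l i k by auto
      have m: "k \<in> insert_black i B \<longleftrightarrow> l \<in> B" "k + 1 \<in> insert_black i B \<longleftrightarrow> l + 1 \<in> B"
        "k - 1 \<in> insert_black i B \<longleftrightarrow> l - 1 \<in> B \<and> l - 1 \<noteq> i"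
        using l by (auto simp: mem_insert_black)
      show ?thesis
      proof (cases "l \<in> B")
        case True
        then show ?thesis using D(7)[OF l' True] l
          unfolding e m by (auto simp: grow_def)
      next
        case False
        then show ?thesis using D(8)[OF l' False] l uu u
          unfolding e m by (cases "l - 1 = i") (auto simp: grow_def)
      qed
    qed
  qed
  ultimately show ?thesis
    unfolding staircase_def using D(1) cut.inj_nx'[OF c D(5)] rng by auto
qed

section \<open>The recursion for the permutations\<close>

definition black_perm :: "nat \<Rightarrow> nat \<Rightarrow> (nat \<Rightarrow> nat) \<Rightarrow> nat \<Rightarrow> nat" where
  "black_perm i r \<rho> z = (if z = i then r - 1
     else if \<rho> (unsh i z) = r - 2 then i - 1 else sh (i - 1) (\<rho> (unsh i z)))"

text \<open>Values are ends of trips after the double rotation, so an end \<open>y\<close> appears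
  as \<open>y - 2\<close>. The second part of the cut trip starts at \<open>i + 1\<close> and keeps
  its end, the first part ends at \<open>i\<close>, and ends are shifted past \<open>i\<close>,
  whence \<open>sh (i - 2)\<close>. In \<open>black_perm\<close> the two new vertices exchange
  roles: the start is \<open>i\<close>, the new end is \<open>i + 1\<close>, and ends are shifted
  past \<open>i + 1\<close>.\<close>

definition white_perm :: "nat \<Rightarrow> nat \<Rightarrow> (nat \<Rightarrow> nat) \<Rightarrow> nat \<Rightarrow> nat" where
  "white_perm i p \<rho> z = (if z = i + 1 then sh (i - 2) p
     else if \<rho> (unsh i z) = p then i - 2 else sh (i - 2) (\<rho> (unsh i z)))"

text \<open>\<open>B\<close> is as above and \<open>\<rho>\<close> is the permutation \<open>c\<^sub>n\<^sup>2 \<pi>\<close>. The trip that is cut ends at \<open>r\<close>, which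
  for \<open>\<rho>\<close> becomes \<open>r - 2\<close> modulo \<open>n\<close>. A trip starting at 1 always crosses at 2 first, whence the last
  premise at a black vertex.\<close>

inductive reachable :: "nat \<Rightarrow> nat \<Rightarrow> nat set \<Rightarrow> (nat \<Rightarrow> nat) \<Rightarrow> bool" where
  start: "reachable 4 2 {2} (\<lambda>j. j)"
| at_black: "\<lbrakk>reachable n k B \<rho>; i \<in> B; i < r; r < n; {i..<r} \<subseteq> B; r \<notin> B; i = 2 \<longrightarrow> \<rho> 1 = r - 2\<rbrakk>
     \<Longrightarrow> reachable (n + 1) k (insert_black i B) (black_perm i r \<rho>)"
| at_white: "\<lbrakk>reachable n k B \<rho>; i \<in> {3..n - 1}; r \<in> B; r < i; {r<..i} \<inter> B = {}\<rbrakk>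
     \<Longrightarrow> reachable (n + 1) (k + 1) (insert_black i B) (white_perm i (if r = 2 then n else r - 2) \<rho>)"

definition models :: "plabic \<Rightarrow> nat \<Rightarrow> nat set \<Rightarrow> (nat \<Rightarrow> nat) \<Rightarrow> bool" where
  "models G n B \<rho> \<longleftrightarrow> (\<exists>V s t nx. well_formed G n V \<and> routed G n V s t nx \<and> staircase n B nx \<and>
     (\<forall>j\<in>{2..n - 1}. colour G (V j) = Black \<longleftrightarrow> j \<in> B) \<and>
     (\<forall>j\<in>{1..n}. \<exists>y\<in>{1..n}. chain nx (Bd j) y \<and> \<rho> j = cyc n (cyc n y)) \<and>
     (\<forall>j. j \<notin> {1..n} \<longrightarrow> \<rho> j = j))"

lemma cyc2: "n \<ge> 3 \<Longrightarrow> y \<in> {1..n} \<Longrightarrow> cyc n (cyc n y) = (if y \<le> 2 then y + n - 2 else y - 2)"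
  by (auto simp: cyc_def)

lemma models_trip_perm:
  assumes "models G n B \<rho>"
  shows "cyc n (cyc n (trip_perm G j)) = \<rho> j"
proof -
  from assms obtain V s t nx where w: "well_formed G n V" "routed G n V s t nx"
    and p: "\<forall>j\<in>{1..n}. \<exists>y\<in>{1..n}. chain nx (Bd j) y \<and> \<rho> j = cyc n (cyc n y)"
     "\<forall>j. j \<notin> {1..n} \<longrightarrow> \<rho> j = j" unfolding models_def by blast
  show ?thesis
  proof (cases "j \<in> {1..n}")
    case True
    then obtain y where "chain nx (Bd j) y" "\<rho> j = cyc n (cyc n y)" using p by blast
    then show ?thesis using trip_perm_chain[OF w True] by simp
  next
    case False
    moreover have "bdry_num G = n" using w by (simp add: well_formed_def)
    ultimately show ?thesis using p(2) False by (auto simp: trip_perm_def cyc_def)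
  qed
qed

text \<open>In the 4-cycle every internal vertex is next to the boundary, so each departure is
  already an arrival and all segments are trivial.\<close>

lemma models_square: "models square_graph 4 {2} (\<lambda>j. j)"
proof -
  define V :: "nat \<Rightarrow> nat" where "V = (\<lambda>j. j)"
  define s :: "nat \<Rightarrow> nat" where "s = (\<lambda>j. if j = 1 then 2 else if j = 2 then 1 else if j = 3 then 4 else 3)"
  define t :: "nat \<Rightarrow> nat" where "t = (\<lambda>j. if j = 1 then 4 else if j = 2 then 3 else if j = 3 then 2 else 1)"
  define nx where "nx = (\<lambda>z. case z of
      Bd j \<Rightarrow> if j = 1 then Xg 2 else if j = 2 then Xg 1 else if j = 3 then Xg 4 else Xg 3
    | Xg j \<Rightarrow> if j = 1 then Bd 4 else if j = 2 then Bd 3 else if j = 3 then Bd 2 else Bd 1)"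
  have I: "{1..4} = {1, 2, 3, 4 :: nat}" by auto
  have wf: "well_formed square_graph 4 V"
    unfolding well_formed_def I by (auto simp: V_def square_graph_def)
  have rt: "routed square_graph 4 V s t nx"
  proof -
    have "turn square_graph (V j) (Bdry j) (Intl (s j)) \<and> turn square_graph (V j) (Intl (s j)) (Intl (t j)) \<and>
        turn square_graph (V j) (Intl (t j)) (Bdry j)" if "j \<in> {1, 2, 3, 4}" for j
      using that by (auto simp: V_def s_def t_def turn_def square_graph_def next_cw_triple)
    moreover have "idx (nx z) \<in> {1, 2, 3, 4} \<and>
        seg square_graph (V ` {1, 2, 3, 4}) (V (idx z)) (departure s t z) (arrival s t (nx z)) (V (idx (nx z)))"
      if "idx z \<in> {1, 2, 3, 4}" for z
      using that by (cases z) (auto simp: V_def s_def t_def nx_def seg.arrived)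
    ultimately show ?thesis unfolding routed_def I by blast
  qed
  have st: "staircase 4 {2} nx"
  proof -
    have "inj_on nx {z. idx z \<in> {1..4}}"
    proof (rule inj_onI)
      fix x y assume "x \<in> {z. idx z \<in> {1..4}}" "y \<in> {z. idx z \<in> {1..4}}" "nx x = nx y"
      then show "x = y" unfolding I by (cases x; cases y) (auto simp: nx_def split: if_splits)
    qed
    moreover have "idx (nx z) \<in> {1..4}" for z by (cases z) (auto simp: nx_def)
    moreover have "nx (Xg i) = (if i \<in> {2} then if i + 1 \<in> {2} then Xg (i + 1) else Bd (i + 1)
         else if i - 1 \<in> {2} then Bd (i - 1) else Xg (i - 1))" if "i \<in> {2..4 - 1}" for i
    proof -
      have "i = 2 \<or> i = 3" using that by auto
      then show ?thesis by (auto simp: nx_def)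
    qed
    ultimately show ?thesis unfolding staircase_def by (simp add: nx_def)
  qed
  have col: "colour square_graph (V j) = Black \<longleftrightarrow> j \<in> {2}" if "j \<in> {2..4 - 1}" for j
  proof -
    have "j = 2 \<or> j = 3" using that by auto
    then show ?thesis by (auto simp: V_def square_graph_def)
  qed
  have ch: "\<exists>y\<in>{1..4}. chain nx (Bd j) y \<and> j = cyc 4 (cyc 4 y)" if "j \<in> {1..4}" for j
  proof -
    define y where "y = (if j \<le> 2 then j + 2 else j - 2)"
    have j: "j \<in> {1, 2, 3, 4}" using that unfolding I .
    then have "nx (Bd j) = Xg (if j = 1 then 2 else if j = 2 then 1 else if j = 3 then 4 else 3)"
      "nx (Xg (if j = 1 then 2 else if j = 2 then 1 else if j = 3 then 4 else 3)) = Bd y"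
      by (auto simp: nx_def y_def)
    then have "chain nx (Bd j) y" by (metis chain.stop chain.cross)
    moreover have "y \<in> {1..4}" "j = cyc 4 (cyc 4 y)" using j by (auto simp: y_def cyc_def)
    ultimately show ?thesis by blast
  qed
  show ?thesis unfolding models_def using wf rt st col ch by blast
qed

lemma models_blow_up:
  assumes mG: "models G n B \<rho>" and bu: "blow_up i G H" and i: "i \<in> {2..n - 1}"
  shows "i \<in> B \<Longrightarrow> i < r \<Longrightarrow> {i..<r} \<subseteq> B \<Longrightarrow> r \<notin> B \<Longrightarrow>
      models H (n + 1) (insert_black i B) (black_perm i r \<rho>)"
    and "i \<notin> B \<Longrightarrow> r \<in> B \<Longrightarrow> r < i \<Longrightarrow> {r<..i} \<inter> B = {} \<Longrightarrow>
      models H (n + 1) (insert_black i B) (white_perm i (if r = 2 then n else r - 2) \<rho>)"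
proof -
  from mG obtain V s t nx where wf: "well_formed G n V" and rt: "routed G n V s t nx"
    and st: "staircase n B nx" and col: "\<forall>j\<in>{2..n - 1}. colour G (V j) = Black \<longleftrightarrow> j \<in> B"
    and ch: "\<forall>j\<in>{1..n}. \<exists>y\<in>{1..n}. chain nx (Bd j) y \<and> \<rho> j = cyc n (cyc n y)"
    and out: "\<forall>j. j \<notin> {1..n} \<longrightarrow> \<rho> j = j" unfolding models_def by blast
  from bu obtain v e f a b c d m where v: "v \<in> internal G"
    and rot: "rotate m (nbrs G (Intl v)) = [Bdry i, e, f]" and dist: "distinct [a, b, c, d]"
    and fresh: "{a, b, c, d} \<inter> internal G = {}" and H: "H = blow_up_graph i v e f a b c d G"
    unfolding blow_up_def by blast
  note D = staircaseD[OF st]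
  have i1: "i \<in> {1..n}" using i by auto
  have "set (rotate m (nbrs G (Intl v))) = set (nbrs G (Intl v))" by simp
  then have sv: "set (nbrs G (Intl v)) = {Bdry i, e, f}" using rot by simp
  have "distinct (rotate m (nbrs G (Intl v)))" using wf v by (simp add: well_formed_def)
  then have dv: "distinct [Bdry i, e, f]" using rot by simp
  have bv: "V j = v" if "Bdry j \<in> {Bdry i, e, f}" for j
    using that wf v sv unfolding well_formed_def by blast
  have bj: "j \<in> {1..n}" if "Bdry j \<in> {Bdry i, e, f}" for j
    using that wf v sv unfolding well_formed_def by blast
  \<comment> \<open>\<open>V\<close> is injective, so \<open>v\<close> has no second neighbour on
    the boundary. Thus \<open>e\<close> and \<open>f\<close> are internal.\<close>
  have "j = i" if "Bdry j \<in> {Bdry i, e, f}" for j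
    using that bv[of j] bv[of i] bj[of j] i1 wf unfolding well_formed_def
    by (metis inj_onD insertI1)
  then have "\<exists>e'. e = Intl e'" "\<exists>f'. f = Intl f'"
    using dv by (cases e; auto; fail) (cases f; use dv \<open>\<And>j. Bdry j \<in> {Bdry i, e, f} \<Longrightarrow> j = i\<close> in auto)
  then obtain e' f' where ef: "e = Intl e'" "f = Intl f'" by blast
  interpret X: blow_up_graph_context G n V s t nx i v e' f' a b c d m
    using wf rt i1 v rot dist fresh by unfold_locales (simp_all add: ef)
  have H: "X.H = H" using H by (simp add: X.H_def ef)
  have cv: "colour G v = Black \<longleftrightarrow> i \<in> B" using col i X.Vi by auto
  have u: "X.u = (if i \<in> B then i else i + 1)" "X.u' = (if i \<in> B then i + 1 else i)"
    by (simp_all add: X.u_def X.u'_def cv)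
  have col': "colour H (X.V' j) = Black \<longleftrightarrow> j \<in> insert_black i B" if j: "j \<in> {2..n + 1 - 1}" for j
  proof -
    consider "j = i" | "j = i + 1" | "j \<noteq> i" "j \<noteq> i + 1" by blast
    then show ?thesis
    proof cases
      case 3
      then have j': "j \<in> {1..n + 1}" "unsh i j \<in> {2..n - 1}" using j i by (auto simp: unsh_def)
      then have "colour H (X.V' j) = colour G (V (unsh i j))"
        using X.V'_notin[OF j'(1) 3] X.colour_H(5) H by auto
      then show ?thesis using col j'(2) 3 by (auto simp: mem_insert_black unsh_def)
    qed (use X.colour_H H in \<open>auto simp: X.V'_def mem_insert_black\<close>)
  qed
  \<comment> \<open>The two colours differ only in the cut and in the arithmetic of the new
    permutation: \<open>p1\<close> concerns the trips starting at old vertices, \<open>p2\<close>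
    the second part of the cut trip.\<close>
  have main: "models H (n + 1) (insert_black i B) \<rho>'"
    if c: "cut n i X.u X.u' nx r Q"
      and p1: "\<And>j y. j \<in> {1..n} \<Longrightarrow> y \<in> {1..n} \<Longrightarrow> \<rho> j = cyc n (cyc n y) \<Longrightarrow>
        \<rho>' (if j = i then X.u' else grow i X.u j) =
          cyc (n + 1) (cyc (n + 1) (if y = r then X.u' else grow i X.u y))"
      and p2: "\<rho>' X.u = cyc (n + 1) (cyc (n + 1) (grow i X.u r))" and r: "r \<in> {1..n}"
      and out': "\<And>j. j \<notin> {1..n + 1} \<Longrightarrow> \<rho>' j = j" for r Q \<rho>'
  proof -
    have rt': "routed H (n + 1) X.V' X.s' X.t' (grow_nx i X.u X.u' nx)" using X.routed_H H by simp
    have "staircase (n + 1) (insert_black i B) (grow_nx i X.u X.u' nx)"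
      using staircase_grow[OF st c i u(1)] rt' unfolding routed_def by blast
    moreover have "\<exists>y\<in>{1..n + 1}. chain (grow_nx i X.u X.u' nx) (Bd j) y \<and>
        \<rho>' j = cyc (n + 1) (cyc (n + 1) y)" if j: "j \<in> {1..n + 1}" for j
    proof (cases "j = X.u")
      case True
      have "grow i X.u r \<in> {1..n + 1}" using r i u by (auto simp: grow_def)
      then show ?thesis using cut.chain_second_part[OF c] p2 True by blast
    next
      case False
      define j' where "j' = unsh i j"
      have j': "j' \<in> {1..n}" "j = (if j' = i then X.u' else grow i X.u j')"
        using j i False u by (auto simp: j'_def unsh_def grow_def split: if_splits)
      then obtain y where y: "y \<in> {1..n}" "chain nx (Bd j') y" "\<rho> j' = cyc n (cyc n y)" using ch by blast
      have "(if y = r then X.u' else grow i X.u y) \<in> {1..n + 1}"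
        using y i u by (auto simp: grow_def)
      moreover note cut.chain_first_part[OF c y(2) j'(1), folded j'(2)]
      moreover note p1[OF j'(1) y(1,3), folded j'(2)]
      ultimately show ?thesis by blast
    qed
    ultimately show ?thesis
      unfolding models_def using X.well_formed_H rt' col' out' H by blast
  qed
  have n: "n \<ge> 4" using D(1) .
  have cy: "cyc n (cyc n y) = (if y \<le> 2 then y + n - 2 else y - 2)" if "y \<in> {1..n}" for y
    using cyc2[of n y] n that by simp
  have cy': "cyc (n + 1) (cyc (n + 1) y) = (if y \<le> 2 then y + n - 1 else y - 2)" if "y \<in> {1..n + 1}" for y
    using cyc2[of "n + 1" y] n that by simp
  show "models H (n + 1) (insert_black i B) (black_perm i r \<rho>)"
    if a: "i \<in> B" "i < r" "{i..<r} \<subseteq> B" "r \<notin> B"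
  proof (rule main)
    show "cut n i X.u X.u' nx r {i<..<r}" using cut_black[OF st a] u a(1) by simp
    have "r - 1 \<in> B" using a by auto
    then have "r - 1 \<in> {2..n - 2}" using D(2) by blast
    then have rn: "r \<le> n - 1" "3 \<le> r" using a(2) i by auto
    then show "r \<in> {1..n}" by auto
    have "grow i X.u r = r + 1" using a by (simp add: grow_def)
    moreover have "cyc (n + 1) (cyc (n + 1) (r + 1)) = r - 1" using cy'[of "r + 1"] rn by simp
    ultimately show "black_perm i r \<rho> X.u = cyc (n + 1) (cyc (n + 1) (grow i X.u r))"
      using a u by (simp add: black_perm_def)
    show "black_perm i r \<rho> j = j" if "j \<notin> {1..n + 1}" for j
    proof -
      have "unsh i j \<notin> {1..n}" "j \<noteq> i" using that i by (auto simp: unsh_def)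
      then have "\<rho> (unsh i j) = unsh i j" "j \<noteq> i" using out by blast+
      then show ?thesis using that i rn by (auto simp: black_perm_def unsh_def sh_def)
    qed
    fix j y assume j: "j \<in> {1..n}" and y: "y \<in> {1..n}" and e: "\<rho> j = cyc n (cyc n y)"
    define z where "z = (if j = i then X.u' else grow i X.u j)"
    have z: "z \<noteq> i" "unsh i z = j" using u a(1) by (auto simp: z_def grow_def unsh_def)
    have \<rho>: "\<rho> (unsh i z) = (if y \<le> 2 then y + n - 2 else y - 2)" using z e cy[OF y] by simp
    show "black_perm i r \<rho> (if j = i then X.u' else grow i X.u j) =
          cyc (n + 1) (cyc (n + 1) (if y = r then X.u' else grow i X.u y))"
    proof (cases "y = r")
      case True
      moreover have "cyc (n + 1) (cyc (n + 1) (i + 1)) = i - 1" using cy'[of "i + 1"] i n by auto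
      ultimately show ?thesis using z \<rho> u a(1) rn
        unfolding z_def[symmetric] by (simp add: black_perm_def)
    next
      case False
      have g: "grow i X.u y = (if y \<le> i then y else y + 1)" using u a(1) by (simp add: grow_def)
      have "\<rho> (unsh i z) \<noteq> r - 2" using \<rho> False rn y by (auto split: if_splits)
      then have "black_perm i r \<rho> z = sh (i - 1) (if y \<le> 2 then y + n - 2 else y - 2)"
        using z \<rho> by (simp add: black_perm_def)
      also have "\<dots> = cyc (n + 1) (cyc (n + 1) (if y \<le> i then y else y + 1))"
        using cy'[of "if y \<le> i then y else y + 1"] y i n by (auto simp: sh_def)
      finally show ?thesis unfolding z_def[symmetric] using False g by simp
    qed
  qed
  show "models H (n + 1) (insert_black i B) (white_perm i (if r = 2 then n else r - 2) \<rho>)"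
    if a: "i \<notin> B" "r \<in> B" "r < i" "{r<..i} \<inter> B = {}"
  proof (rule main)
    have i3: "i \<in> {3..n - 1}" using i a(1) D(3) by (cases "i = 2") auto
    show "cut n i X.u X.u' nx r {r<..<i}" using cut_white[OF st i3 a(2-4)] u a(1) by simp
    have rn: "2 \<le> r" "r \<le> n - 2" using D(2) a(2) by auto
    then show "r \<in> {1..n}" by auto
    define p where "p = (if r = 2 then n else r - 2)"
    have "grow i X.u r = r" using a by (simp add: grow_def)
    moreover have "cyc (n + 1) (cyc (n + 1) r) = sh (i - 2) p"
      using cy'[of r] rn i3 a(3) by (auto simp: p_def sh_def)
    ultimately show "white_perm i p \<rho> X.u = cyc (n + 1) (cyc (n + 1) (grow i X.u r))"
      using a u by (simp add: white_perm_def)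
    show "white_perm i p \<rho> j = j" if "j \<notin> {1..n + 1}" for j
    proof -
      have "unsh i j \<notin> {1..n}" "j \<noteq> i + 1" using that i by (auto simp: unsh_def)
      then have "\<rho> (unsh i j) = unsh i j" "j \<noteq> i + 1" using out by blast+
      then show ?thesis using that i3 rn by (auto simp: white_perm_def unsh_def sh_def p_def)
    qed
    fix j y assume j: "j \<in> {1..n}" and y: "y \<in> {1..n}" and e: "\<rho> j = cyc n (cyc n y)"
    define z where "z = (if j = i then X.u' else grow i X.u j)"
    have z: "z \<noteq> i + 1" "unsh i z = j" using u a(1) by (auto simp: z_def grow_def unsh_def)
    have \<rho>: "\<rho> (unsh i z) = (if y \<le> 2 then y + n - 2 else y - 2)" using z e cy[OF y] by simp
    show "white_perm i p \<rho> (if j = i then X.u' else grow i X.u j) =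
          cyc (n + 1) (cyc (n + 1) (if y = r then X.u' else grow i X.u y))"
    proof (cases "y = r")
      case True
      then have "\<rho> (unsh i z) = p" using \<rho> rn by (auto simp: p_def)
      moreover have "cyc (n + 1) (cyc (n + 1) i) = i - 2" using cy'[of i] i3 by auto
      ultimately show ?thesis using True z u a(1)
        unfolding z_def[symmetric] by (simp add: white_perm_def)
    next
      case False
      have g: "grow i X.u y = (if y < i then y else y + 1)" using u a(1) by (simp add: grow_def)
      have "\<rho> (unsh i z) \<noteq> p" using \<rho> False rn y by (auto simp: p_def split: if_splits)
      then have "white_perm i p \<rho> z = sh (i - 2) (if y \<le> 2 then y + n - 2 else y - 2)"
        using z \<rho> by (simp add: white_perm_def)
      also have "\<dots> = cyc (n + 1) (cyc (n + 1) (if y < i then y else y + 1))"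
        using cy'[of "if y < i then y else y + 1"] y i3 n by (auto simp: sh_def)
      finally show ?thesis unfolding z_def[symmetric] using False g by simp
    qed
  qed
qed

lemma bdry_colour_models:
  assumes "models G n B \<rho>" "bdry_colour G i x" "i \<in> {2..n - 1}"
  shows "x = Black \<longleftrightarrow> i \<in> B"
proof -
  obtain V where "well_formed G n V" "\<forall>j\<in>{2..n - 1}. colour G (V j) = Black \<longleftrightarrow> j \<in> B"
    using assms(1) unfolding models_def by blast
  moreover then have "nbrs G (Bdry i) = [Intl (V i)]" using assms(3) by (auto simp: well_formed_def)
  ultimately show ?thesis using assms(2,3) unfolding bdry_colour_def by auto
qed

lemma bcfw_graph_reachable:
  "bcfw_graph n k G \<Longrightarrow> \<exists>B \<rho>. reachable n k B \<rho> \<and> models G n B \<rho>"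
proof (induction rule: bcfw_graph.induct)
  case square
  then show ?case using reachable.start models_square by blast
next
  case (black n k G i H)
  then obtain B \<rho> where r: "reachable n k B \<rho>" and mG: "models G n B \<rho>" by blast
  have i: "i \<in> {2..n - 1}" using black by auto
  have iB: "i \<in> B" using bdry_colour_models[OF mG black.hyps(5) i] by simp
  from mG obtain nx where st: "staircase n B nx"
    and ch: "\<forall>j\<in>{1..n}. \<exists>y\<in>{1..n}. chain nx (Bd j) y \<and> \<rho> j = cyc n (cyc n y)"
    unfolding models_def by blast
  note D = staircaseD[OF st]
  \<comment> \<open>The cut trip ends at the first white vertex after \<open>i\<close>, which exists
    because \<open>n - 1\<close> is white.\<close>
  define q where "q = (LEAST q. i < q \<and> q \<notin> B)"
  have "i \<in> {2..n - 2}" "n - 1 \<notin> {2..n - 2}" using D(2) iB D(1) by auto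
  then have nB: "i < n - 1 \<and> n - 1 \<notin> B" using D(2) D(1) by auto
  have q: "i < q \<and> q \<notin> B" unfolding q_def using nB by (rule LeastI[of "\<lambda>q. i < q \<and> q \<notin> B"])
  have qn: "q \<le> n - 1" unfolding q_def using nB by (rule Least_le)
  have run: "{i..<q} \<subseteq> B"
  proof
    fix x assume x: "x \<in> {i..<q}"
    then have "\<not> (i < x \<and> x \<notin> B)" unfolding q_def using not_less_Least by auto
    then show "x \<in> B" using x iB by (cases "x = i") auto
  qed
  have "i = 2 \<longrightarrow> \<rho> 1 = q - 2"
  proof
    assume i2: "i = 2"
    have c: "cut n i i (i + 1) nx q {i<..<q}" using cut_black[OF st iB _ run] q by simp
    have "chain nx (Xg 2) q" using cut.end_chain[OF c, of i] i2 by simp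
    then have "chain nx (Bd 1) q" using D(6) by (rule chain.cross[rotated])
    moreover obtain y where "chain nx (Bd 1) y" "\<rho> 1 = cyc n (cyc n y)" using ch D(1) by force
    ultimately have "\<rho> 1 = cyc n (cyc n q)" using chain_unique by blast
    then show "\<rho> 1 = q - 2" using cyc2[of n q] q qn i2 D(1) by auto
  qed
  then have "reachable (n + 1) k (insert_black i B) (black_perm i q \<rho>)"
    using reachable.at_black[OF r iB _ _ run] q qn D(1) by auto
  then show ?case using models_blow_up(1)[OF mG black.hyps(6) i iB _ run] q by blast
next
  case (white n k G i H)
  then obtain B \<rho> where r: "reachable n k B \<rho>" and mG: "models G n B \<rho>" by blast
  have i: "i \<in> {2..n - 1}" using white by auto
  have iB: "i \<notin> B" using bdry_colour_models[OF mG white.hyps(5) i] by simp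
  from mG obtain nx where st: "staircase n B nx" unfolding models_def by blast
  note D = staircaseD[OF st]
  have i3: "i \<in> {3..n - 1}" using i iB D(3) by (cases "i = 2") auto
  \<comment> \<open>The cut trip ends at the last black vertex before \<open>i\<close>, which exists
    because 2 is black.\<close>
  define q where "q = Max {q \<in> B. q < i}"
  have fin: "finite {q \<in> B. q < i}" by auto
  have "2 \<in> {q \<in> B. q < i}" using D(3) i3 by auto
  then have q: "q \<in> B" "q < i" using Max_in[OF fin] unfolding q_def by blast+
  have run: "{q<..i} \<inter> B = {}"
  proof (rule ccontr)
    assume "{q<..i} \<inter> B \<noteq> {}"
    then obtain x where "q < x" "x \<le> i" "x \<in> B" by auto
    moreover then have "x \<noteq> i" using iB by auto
    ultimately have "x \<in> {q \<in> B. q < i}" "q < x" by auto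
    then show False using Max_ge[OF fin, of x] unfolding q_def by linarith
  qed
  show ?case using reachable.at_white[OF r i3 q run] models_blow_up(2)[OF mG white.hyps(6) i iB q run]
    by blast
qed

section \<open>Permutations given by parallel classes of columns\<close>

text \<open>The identity is the default. All permutations below move only a few explicit labels, so
  that their equality is a finite check on the keys.\<close>

fun subst :: "(nat \<times> nat) list \<Rightarrow> nat \<Rightarrow> nat" where
  "subst [] x = x"
| "subst ((a, b) # ps) x = (if x = a then b else subst ps x)"

fun path_to :: "nat list \<Rightarrow> nat \<Rightarrow> (nat \<times> nat) list" where
  "path_to [] y = []"
| "path_to [a] y = [(a, y)]"
| "path_to (a # b # as) y = (a, b) # path_to (b # as) y"

text \<open>In a totally nonnegative \<open>2 \<times> n\<close> matrix, parallel nonzero columns are cyclically consecutive.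
  If \<open>gs\<close> lists the parallel classes, the decorated permutation sends each nonzero column to the
  next one of its class, and the last one of a class to the first one of the class after the next.\<close>

definition class_pairs :: "nat list list \<Rightarrow> (nat \<times> nat) list" where
  "class_pairs gs = concat (map2 (\<lambda>g h. path_to g (hd h)) gs (drop 2 gs @ take 2 gs))"

text \<open>The second and third domino may share both columns, one column or none. A shared column
  is a class of its own.\<close>

definition orthodox_classes :: "nat \<Rightarrow> nat \<Rightarrow> nat \<Rightarrow> nat \<Rightarrow> nat \<Rightarrow> nat list list" where
  "orthodox_classes i1 i2 i3 i4 n =
     (if i2 = i3 then [[i1, i1 + 1], [i2], [i2 + 1], [i4, i4 + 1], [n]]
      else if i2 + 1 = i3 then [[i1, i1 + 1, i2], [i3], [i3 + 1, i4, i4 + 1], [n]]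
      else [[i1, i1 + 1, i2, i2 + 1], [i3, i3 + 1, i4, i4 + 1], [n]])"

text \<open>Two independent overlaps give six cases: the first two dominoes share a column if
  \<open>i2 = i1 + 1\<close>, and the last two share two, one or no columns if \<open>i4\<close> is
  \<open>i3\<close>, \<open>i3 + 1\<close> or larger. Label \<open>n\<close> joins the columns in
  which only the first row is nonzero.\<close>

definition deviant_classes :: "nat \<Rightarrow> nat \<Rightarrow> nat \<Rightarrow> nat \<Rightarrow> nat \<Rightarrow> nat list list" where
  "deviant_classes i1 i2 i3 i4 n =
     (if i2 = i1 + 1
      then if i4 = i3 then [[i1], [i1 + 1], [i2 + 1], [i3], [i3 + 1], [n]]
        else if i4 = i3 + 1 then [[i1], [i1 + 1], [i2 + 1, i3], [i3 + 1], [i4 + 1, n]]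
        else [[i1], [i1 + 1], [i2 + 1, i3, i3 + 1], [i4, i4 + 1, n]]
      else if i4 = i3 then [[i1, i1 + 1], [i2, i2 + 1], [i3], [i3 + 1], [n]]
        else if i4 = i3 + 1 then [[i1, i1 + 1], [i2, i2 + 1, i3], [i3 + 1], [i4 + 1, n]]
        else [[i1, i1 + 1], [i2, i2 + 1, i3, i3 + 1], [i4, i4 + 1, n]])"

text \<open>The effect on the permutation of inserting a zero column at position
  \<open>z\<close>.\<close>

definition insert_fixpoint :: "nat \<Rightarrow> (nat \<Rightarrow> nat) \<Rightarrow> nat \<Rightarrow> nat" where
  "insert_fixpoint z \<rho> x = (if x = z then z else sh z (\<rho> (unsh z x)))"

lemma sh_eq_iff [simp]: "sh z x = sh z y \<longleftrightarrow> x = y"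
  by (auto simp: sh_def)

lemma sh_unsh: "x \<noteq> z \<Longrightarrow> sh z (unsh z x) = x"
  by (auto simp: sh_def unsh_def)

lemma sh_neq: "sh z x \<noteq> z"
  by (auto simp: sh_def)

lemma insert_fixpoint_subst:
  "insert_fixpoint z (subst ps) = subst (map (map_prod (sh z) (sh z)) ps)"
proof (rule ext)
  have a: "subst (map (map_prod (sh z) (sh z)) ps) (sh z x) = sh z (subst ps x)" for x
    by (induction ps) auto
  have b: "subst (map (map_prod (sh z) (sh z)) ps) z = z"
    using sh_neq[of z, symmetric] by (induction ps) auto
  show "insert_fixpoint z (subst ps) x = subst (map (map_prod (sh z) (sh z)) ps) x" for x
    using a[of "unsh z x"] b by (auto simp: insert_fixpoint_def sh_unsh)
qed

text \<open>If \<open>i + 1\<close> is white, the new label \<open>i\<close> is fixed. Shifting past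
  \<open>i - 1\<close> and past \<open>i\<close> differ only at the value \<open>i - 1\<close>, and
  this is the value \<open>r - 2\<close> that \<open>black_perm\<close> treats separately.\<close>

lemma black_perm_insert_fixpoint:
  assumes "2 \<le> i"
  shows "black_perm i (i + 1) \<rho> = insert_fixpoint i \<rho>"
proof (rule ext)
  fix z
  show "black_perm i (i + 1) \<rho> z = insert_fixpoint i \<rho> z"
    using assms by (cases "\<rho> (unsh i z) = i - 1") (auto simp: black_perm_def insert_fixpoint_def sh_def)
qed

text \<open>Since the trip cut at 2 is the one starting at 1, the new zero column is the first one.\<close>

lemma black_perm_2:
  assumes inj: "inj \<rho>" and 1: "\<rho> 1 = r - 2" and 0: "\<rho> 0 = 0" and r: "2 < r"
  shows "black_perm 2 r \<rho> = insert_fixpoint 1 \<rho>"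
proof (rule ext)
  fix z :: nat
  have r1: "\<rho> x = r - 2 \<longleftrightarrow> x = 1" for x using injD[OF inj, of x 1] 1 by auto
  consider "z = 0" | "z = 1" | "z = 2" | "z > 2" by linarith
  then show "black_perm 2 r \<rho> z = insert_fixpoint 1 \<rho> z"
    using 0 1 r r1[of "z - 1"] r1[of 0]
    by cases (auto simp: black_perm_def insert_fixpoint_def unsh_def sh_def)
qed

lemma reachable_inj: "reachable n k B \<rho> \<Longrightarrow> n \<ge> 4 \<and> inj \<rho> \<and> \<rho> 0 = 0 \<and> B \<subseteq> {2..n - 2}"
proof (induction rule: reachable.induct)
  case start
  then show ?case by (auto simp: inj_def)
next
  case (at_black n k B \<rho> i r)
  then have i: "2 \<le> i" "i \<le> n - 2" "r > i" by auto
  have "inj (black_perm i r \<rho>)"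
  proof (rule injI)
    fix x y assume e: "black_perm i r \<rho> x = black_perm i r \<rho> y"
    have s: "sh (i - 1) a = r - 1 \<longleftrightarrow> a = r - 2" "sh (i - 1) a \<noteq> i - 1" for a
      using i by (auto simp: sh_def)
    have r: "r - 1 \<noteq> i - 1" using i by auto
    have u: "unsh i x = unsh i y" if "x \<noteq> i" "y \<noteq> i"
      using e that s(2) s(2)[symmetric] injD[of \<rho> "unsh i x" "unsh i y"] at_black.IH
      by (auto simp: black_perm_def split: if_splits)
    show "x = y"
    proof (cases "x = i \<or> y = i")
      case True
      then show ?thesis using e s s(2)[symmetric] r r[symmetric]
        by (auto simp: black_perm_def eq_commute[of "r - 1"] split: if_splits)
    next
      case False
      then show ?thesis using u sh_unsh[of x i] sh_unsh[of y i] by metis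
    qed
  qed
  moreover have "insert_black i B \<subseteq> {2..n + 1 - 2}"
  proof
    fix x assume "x \<in> insert_black i B"
    then consider "x = i" | "x < i" "x \<in> {2..n - 2}" | "x > i + 1" "x - 1 \<in> {2..n - 2}"
      using at_black.IH unfolding mem_insert_black by blast
    then show "x \<in> {2..n + 1 - 2}" using i at_black.IH by cases auto
  qed
  moreover have "black_perm i r \<rho> 0 = 0"
    using i at_black.IH at_black.hyps by (auto simp: black_perm_def unsh_def sh_def)
  ultimately show ?case using at_black.IH by auto
next
  case (at_white n k B \<rho> i r)
  then have i: "3 \<le> i" "i \<le> n - 1" "2 \<le> r" by auto
  define p where "p = (if r = 2 then n else r - 2)"
  have p: "p \<ge> 1" using i by (auto simp: p_def)
  have "inj (white_perm i p \<rho>)"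
  proof (rule injI)
    fix x y assume e: "white_perm i p \<rho> x = white_perm i p \<rho> y"
    have s: "sh (i - 2) a \<noteq> i - 2" for a by (rule sh_neq)
    have u: "unsh i x = unsh i y" if "x \<noteq> i + 1" "y \<noteq> i + 1"
      using e that s s[symmetric] injD[of \<rho> "unsh i x" "unsh i y"] at_white.IH
      by (auto simp: white_perm_def split: if_splits)
    show "x = y"
    proof (cases "x = i + 1 \<or> y = i + 1")
      case True
      then show ?thesis using e s s[symmetric]
        by (auto simp: white_perm_def split: if_splits)
    next
      case False
      then show ?thesis using u by (auto simp: unsh_def split: if_splits)
    qed
  qed
  moreover have "insert_black i B \<subseteq> {2..n + 1 - 2}"
  proof
    fix x assume "x \<in> insert_black i B"
    then consider "x = i" | "x < i" "x \<in> {2..n - 2}" | "x > i + 1" "x - 1 \<in> {2..n - 2}"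
      using at_white.IH unfolding mem_insert_black by blast
    then show "x \<in> {2..n + 1 - 2}" using i at_white.IH by cases auto
  qed
  moreover have "white_perm i p \<rho> 0 = 0"
    using i p at_white.IH by (auto simp: white_perm_def unsh_def sh_def)
  ultimately show ?case using at_white.IH unfolding p_def by auto
qed

section \<open>Blow-ups of permutations given by association lists\<close>

lemma eq_by_keys:
  assumes "\<forall>x\<in>set K. f x = g x" "\<And>x. x \<notin> set K \<Longrightarrow> f x = g x"
  shows "f = (g :: nat \<Rightarrow> nat)"
  using assms by (auto simp: fun_eq_iff)

lemma subst_other: "x \<notin> fst ` set ps \<Longrightarrow> subst ps x = x"
  by (induction ps) auto

text \<open>Outside of \<open>q\<close>, ..., \<open>q + 3\<close> and of the old keys, renamed by
  \<open>sh (q + 3)\<close>, both sides are the identity, because the shifts by \<open>unsh\<close>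
  and \<open>sh\<close> cancel there. What remains is a finite list of values, to be computed in
  each case.\<close>

lemma white_perm_subst:
  assumes p: "p \<in> fst ` set ps"
    and K: "K = [q, q + 1, q + 2, q + 3] @ map (sh (q + 3) \<circ> fst) ps"
    and eq: "\<forall>x\<in>set K. white_perm (q + 2) p (subst ps) x = subst ps' x"
    and keys: "fst ` set ps' \<subseteq> set K"
  shows "white_perm (q + 2) p (subst ps) = subst ps'"
proof (rule eq_by_keys[OF eq])
  fix x assume x: "x \<notin> set K"
  have "unsh (q + 2) x \<notin> fst ` set ps"
  proof
    assume "unsh (q + 2) x \<in> fst ` set ps"
    then obtain b where b: "b \<in> set ps" "unsh (q + 2) x = fst b" by auto
    have "sh (q + 3) (unsh (q + 2) x) \<in> set K" unfolding b(2) K using b(1) by auto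
    moreover have "sh (q + 3) (unsh (q + 2) x) = x" using x K by (auto simp: sh_def unsh_def)
    ultimately show False using x by simp
  qed
  then have "subst ps (unsh (q + 2) x) = unsh (q + 2) x" "unsh (q + 2) x \<noteq> p"
    using subst_other p by auto
  moreover have "sh q (unsh (q + 2) x) = x" "x \<noteq> q + 3" using x K by (auto simp: sh_def unsh_def)
  moreover have "subst ps' x = x" using subst_other x keys by blast
  ultimately show "white_perm (q + 2) p (subst ps) x = subst ps' x"
    by (simp add: white_perm_def)
qed

lemma black_perm_subst:
  assumes r: "r \<in> fst ` set ps"
    and K: "K = [q + 1, q + 2] @ map (sh (q + 2) \<circ> fst) ps"
    and eq: "\<forall>x\<in>set K. black_perm (q + 2) (r + 2) (subst ps) x = subst ps' x"
    and keys: "fst ` set ps' \<subseteq> set K"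
  shows "black_perm (q + 2) (r + 2) (subst ps) = subst ps'"
proof (rule eq_by_keys[OF eq])
  fix x assume x: "x \<notin> set K"
  have "unsh (q + 2) x \<notin> fst ` set ps"
  proof
    assume "unsh (q + 2) x \<in> fst ` set ps"
    then obtain b where b: "b \<in> set ps" "unsh (q + 2) x = fst b" by auto
    have "sh (q + 2) (unsh (q + 2) x) \<in> set K" unfolding b(2) K using b(1) by auto
    moreover have "sh (q + 2) (unsh (q + 2) x) = x" using x K by (auto simp: sh_unsh)
    ultimately show False using x by simp
  qed
  then have "subst ps (unsh (q + 2) x) = unsh (q + 2) x" "unsh (q + 2) x \<noteq> r"
    using subst_other r by auto
  moreover have "sh (q + 1) (unsh (q + 2) x) = x" "x \<noteq> q + 2"
    using x K by (auto simp: sh_def unsh_def)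
  moreover have "subst ps' x = x" using subst_other x keys by blast
  ultimately show "black_perm (q + 2) (r + 2) (subst ps) x = subst ps' x"
    by (simp add: black_perm_def)
qed

text \<open>The first white blow-up. As 2 is the only black vertex, the cut trip ends there, and the
  double rotation takes 2 to \<open>n\<close>.\<close>

lemma white_perm_id:
  assumes "1 \<le> q" "q + 2 < n"
  shows "white_perm (q + 2) n (\<lambda>j. j) = subst (path_to [q, q + 1, q + 2, q + 2 + 1, n + 1] q)"
proof (rule eq_by_keys[where K = "[q, q + 1, q + 2, q + 3, n + 1]"])
  show "\<forall>x\<in>set [q, q + 1, q + 2, q + 3, n + 1].
    white_perm (q + 2) n (\<lambda>j. j) x = subst (path_to [q, q + 1, q + 2, q + 2 + 1, n + 1] q) x"
    using assms by (simp add: white_perm_def sh_def unsh_def)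
  show "white_perm (q + 2) n (\<lambda>j. j) x = subst (path_to [q, q + 1, q + 2, q + 2 + 1, n + 1] q) x"
    if "x \<notin> set [q, q + 1, q + 2, q + 3, n + 1]" for x
    using assms that by (auto simp: white_perm_def sh_def unsh_def)
qed

definition orthodox_indices :: "nat \<Rightarrow> nat \<Rightarrow> nat \<Rightarrow> nat \<Rightarrow> nat \<Rightarrow> bool" where
  "orthodox_indices i1 i2 i3 i4 n \<longleftrightarrow> 1 \<le> i1 \<and> i1 + 1 < i2 \<and> i2 \<le> i3 \<and> i3 + 1 < i4 \<and> i4 + 1 < n"

definition deviant_indices :: "nat \<Rightarrow> nat \<Rightarrow> nat \<Rightarrow> nat \<Rightarrow> nat \<Rightarrow> bool" where
  "deviant_indices i1 i2 i3 i4 n \<longleftrightarrow> 1 \<le> i1 \<and> i1 < i2 \<and> i2 + 1 < i3 \<and> i3 \<le> i4 \<and> i4 + 1 < n"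

lemma orthodox_cases:
  assumes "orthodox_indices i1 i2 i3 i4 n"
  obtains "i2 = i3" | "i3 = i2 + 1" | "i2 + 1 < i3"
  using assms unfolding orthodox_indices_def by linarith

lemma deviant_cases:
  assumes "deviant_indices i1 i2 i3 i4 n"
  obtains "i2 = i1 + 1" "i4 = i3" | "i2 = i1 + 1" "i4 = i3 + 1" | "i2 = i1 + 1" "i3 + 1 < i4"
    | "i1 + 1 < i2" "i4 = i3" | "i1 + 1 < i2" "i4 = i3 + 1" | "i1 + 1 < i2" "i3 + 1 < i4"
  using assms unfolding deviant_indices_def by linarith

lemma path_to_map: "path_to (map f g) (f y) = map (map_prod f f) (path_to g y)"
  by (induction g y rule: path_to.induct) auto

lemma class_pairs_map:
  assumes "[] \<notin> set gs"
  shows "class_pairs (map (map f) gs) = map (map_prod f f) (class_pairs gs)"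
proof -
  have "map2 (\<lambda>g h. path_to g (hd h)) (map (map f) xs) (map (map f) ys)
      = map (map (map_prod f f)) (map2 (\<lambda>g h. path_to g (hd h)) xs ys)" if "[] \<notin> set ys" for xs ys
    using that
  proof (induction xs arbitrary: ys)
    case (Cons x xs)
    then show ?case by (cases ys) (auto simp: path_to_map hd_map)
  qed simp
  moreover have "[] \<notin> set (drop 2 gs @ take 2 gs)"
    using assms by (auto dest: in_set_dropD in_set_takeD)
  ultimately have "map2 (\<lambda>g h. path_to g (hd h)) (map (map f) gs) (map (map f) (drop 2 gs @ take 2 gs))
      = map (map (map_prod f f)) (map2 (\<lambda>g h. path_to g (hd h)) gs (drop 2 gs @ take 2 gs))" .
  then show ?thesis
    unfolding class_pairs_def drop_map take_map map_append[symmetric] by (simp only: map_concat)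
qed

lemma insert_fixpoint_classes:
  "[] \<notin> set gs \<Longrightarrow> insert_fixpoint z (subst (class_pairs gs)) = subst (class_pairs (map (map (sh z)) gs))"
  by (simp add: insert_fixpoint_subst class_pairs_map)

section \<open>The second white blow-up and the exceptional black one\<close>

lemma white_orthodox_left:
  assumes "i1 + 1 < i2" "i2 + 1 < n" "1 \<le> q" "q + 1 \<le> i1"
  shows "white_perm (q + 2) n (subst (path_to [i1, i1 + 1, i2, i2 + 1, n] i1))
    = subst (class_pairs (orthodox_classes q (q + 2) (i1 + 1) (i2 + 1) (n + 1)))"
proof -
  consider "i1 = q + 1" | "i1 = q + 2" | "q + 2 < i1" using assms by linarith
  then show ?thesis
    by cases (rule white_perm_subst[OF _ refl]; use assms in \<open>simp add: orthodox_classes_def class_pairs_def white_perm_def sh_def unsh_def\<close>)+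
qed

lemma white_orthodox_right:
  assumes "i1 + 1 < i2" "i2 + 1 < n" "1 \<le> i1" "i2 \<le> q" "q + 2 < n"
  shows "white_perm (q + 2) i1 (subst (path_to [i1, i1 + 1, i2, i2 + 1, n] i1))
    = subst (class_pairs (orthodox_classes i1 i2 q (q + 2) (n + 1)))"
proof -
  consider "i2 = q" | "i2 + 1 = q" | "i2 + 1 < q" using assms by linarith
  then show ?thesis
    by cases (rule white_perm_subst[OF _ refl]; use assms in \<open>simp add: orthodox_classes_def class_pairs_def white_perm_def sh_def unsh_def\<close>)+
qed

text \<open>The new dominoes \<open>q\<close> and \<open>q + 2\<close> come between the old ones.
  The last black vertex before the blown up one is then \<open>i1 + 2\<close>, so the cut trip has
  the value \<open>i1\<close>. The cases are the possible overlaps on both sides.\<close>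

lemma white_deviant:
  assumes "1 \<le> i1" "i1 + 1 \<le> q" "q + 1 \<le> i2" "i2 + 1 < n"
  shows "white_perm (q + 2) i1 (subst (path_to [i1, i1 + 1, i2, i2 + 1, n] i1))
    = subst (class_pairs (deviant_classes i1 q (q + 2) (i2 + 1) (n + 1)))"
proof -
  consider "i2 = q + 1" | "i2 = q + 2" | "q + 2 < i2" using assms by linarith
  moreover consider "q = i1 + 1" | "i1 + 1 < q" using assms by linarith
  ultimately consider "i2 = q + 1" "q = i1 + 1" | "i2 = q + 1" "i1 + 1 < q"
    | "i2 = q + 2" "q = i1 + 1" | "i2 = q + 2" "i1 + 1 < q"
    | "i2 > q + 2" "q = i1 + 1" | "i2 > q + 2" "i1 + 1 < q" by blast
  then show ?thesis
    by cases (rule white_perm_subst[OF _ refl]; use assms in \<open>simp add: deviant_classes_def class_pairs_def white_perm_def sh_def unsh_def\<close>)+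
qed

text \<open>With \<open>i2 = i1 + 1\<close> the vertices \<open>i1 + 2\<close> and
  \<open>i1 + 3\<close> are both black, so the trip that is cut at \<open>i1 + 2\<close> runs on to
  \<open>i1 + 4\<close>. No zero column arises; the column shared by the first two dominoes is
  doubled instead, and these become disjoint.\<close>

lemma black_deviant:
  assumes "1 \<le> i1" "i1 + 2 < i3" "i3 \<le> i4" "i4 + 1 < n"
  shows "black_perm (i1 + 2) (i1 + 2 + 2) (subst (class_pairs (deviant_classes i1 (i1 + 1) i3 i4 n)))
    = subst (class_pairs (deviant_classes i1 (i1 + 2) (i3 + 1) (i4 + 1) (n + 1)))"
proof -
  consider "i4 = i3" | "i4 = i3 + 1" | "i4 > i3 + 1" using assms by linarith
  then show ?thesis
    by cases (rule black_perm_subst[OF _ refl]; use assms in \<open>simp add: deviant_classes_def class_pairs_def black_perm_def sh_def unsh_def\<close>)+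
qed

text \<open>The witnesses \<open>i1\<close>, \<open>i2\<close>, \<open>i3\<close>, \<open>i4\<close> are the indices of the dominoes of the cell.\<close>

definition cell_perm :: "nat \<Rightarrow> (nat \<Rightarrow> nat) \<Rightarrow> nat set \<Rightarrow> bool" where
  "cell_perm n \<rho> B \<longleftrightarrow> (\<exists>i1 i2 i3 i4.
     orthodox_indices i1 i2 i3 i4 n \<and> B = {2, i1 + 2, i3 + 2} \<and>
       \<rho> = subst (class_pairs (orthodox_classes i1 i2 i3 i4 n)) \<or>
     deviant_indices i1 i2 i3 i4 n \<and> B = {2, i1 + 2, i2 + 2} \<and>
       \<rho> = subst (class_pairs (deviant_classes i1 i2 i3 i4 n)))"

section \<open>The shape of the reachable permutations\<close>

lemma cell_permI:
  "orthodox_indices i1 i2 i3 i4 n \<Longrightarrow> B = {2, i1 + 2, i3 + 2} \<Longrightarrow>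
     \<rho> = subst (class_pairs (orthodox_classes i1 i2 i3 i4 n)) \<Longrightarrow> cell_perm n \<rho> B"
  "deviant_indices i1 i2 i3 i4 n \<Longrightarrow> B = {2, i1 + 2, i2 + 2} \<Longrightarrow>
     \<rho> = subst (class_pairs (deviant_classes i1 i2 i3 i4 n)) \<Longrightarrow> cell_perm n \<rho> B"
  unfolding cell_perm_def by blast+

lemma classes_nonempty:
  "[] \<notin> set (orthodox_classes i1 i2 i3 i4 n)" "[] \<notin> set (deviant_classes i1 i2 i3 i4 n)"
  by (simp_all add: orthodox_classes_def deviant_classes_def)

text \<open>Zero columns are inserted only before the first domino or directly behind the first or
  the third one. This never separates the two columns of a domino, so the overlaps, on which the
  classes depend, are kept.\<close>

lemma orthodox_classes_sh:
  assumes "orthodox_indices i1 i2 i3 i4 n" "z \<le> i1 \<or> z = i1 + 2 \<or> z = i3 + 2"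
  shows "map (map (sh z)) (orthodox_classes i1 i2 i3 i4 n) =
    orthodox_classes (sh z i1) (sh z i2) (sh z i3) (sh z i4) (n + 1)"
  using assms by (auto simp: orthodox_classes_def orthodox_indices_def sh_def)

lemma deviant_classes_sh:
  assumes "deviant_indices i1 i2 i3 i4 n" "z \<le> i1 \<or> z = i1 + 2 \<and> i1 + 1 < i2 \<or> z = i2 + 2"
  shows "map (map (sh z)) (deviant_classes i1 i2 i3 i4 n) =
    deviant_classes (sh z i1) (sh z i2) (sh z i3) (sh z i4) (n + 1)"
  using assms by (auto simp: deviant_classes_def deviant_indices_def sh_def)


text \<open>The invariant of the recursion. \<open>k - 2\<close> counts the white blow-ups, of which
  the cells at hand have two.\<close>

definition reachable_shape :: "nat \<Rightarrow> nat \<Rightarrow> nat set \<Rightarrow> (nat \<Rightarrow> nat) \<Rightarrow> bool" where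
  "reachable_shape n k B \<rho> \<longleftrightarrow> 2 \<le> k \<and>
     (k = 2 \<longrightarrow> B = {2} \<and> \<rho> = (\<lambda>j. j)) \<and>
     (k = 3 \<longrightarrow> (\<exists>i1 i2. 1 \<le> i1 \<and> i1 + 1 < i2 \<and> i2 + 1 < n \<and> B = {2, i1 + 2} \<and>
        \<rho> = subst (path_to [i1, i1 + 1, i2, i2 + 1, n] i1))) \<and>
     (k = 4 \<longrightarrow> cell_perm n \<rho> B)"

lemma black_run_1:
  assumes "{i..<r} \<subseteq> B" "r \<notin> B" "(i :: nat) \<in> B" "i + 1 \<notin> B" "i < r"
  shows "r = i + 1"
proof (rule ccontr)
  assume "r \<noteq> i + 1"
  then have "i + 1 \<in> {i..<r}" using assms(5) by auto
  then show False using assms by blast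
qed

lemma insert_fixpoint_id: "insert_fixpoint z (\<lambda>j. j) = (\<lambda>j. j)"
  by (auto simp: insert_fixpoint_def sh_unsh)

lemma insert_black_triple:
  assumes "2 < a" "a < b"
  shows "insert_black 2 {2, a, b} = {2, a + 1, b + 1}" "insert_black a {2, a, b} = {2, a, b + 1}"
    "insert_black b {2, a, b} = {2, a, b}"
  using assms by (simp_all add: insert_black_def sh_def insert_Diff_if insert_commute)

lemma shape_black:
  assumes re: "reachable n k B \<rho>" and sh: "reachable_shape n k B \<rho>"
    and i: "i \<in> B" "i < r" "r < n" "{i..<r} \<subseteq> B" "r \<notin> B" "i = 2 \<longrightarrow> \<rho> 1 = r - 2"
  shows "reachable_shape (n + 1) k (insert_black i B) (black_perm i r \<rho>)"
proof -
  note R = reachable_inj[OF re]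
  have two: "black_perm i r \<rho> = insert_fixpoint 1 \<rho>" if "i = 2"
    using black_perm_2[of \<rho> r] R i that by auto
  have one: "black_perm i r \<rho> = insert_fixpoint i \<rho>" if "i + 1 \<notin> B"
  proof -
    have "2 \<le> i" using R i(1) by auto
    then show ?thesis using black_perm_insert_fixpoint black_run_1[OF i(4,5,1) that i(2)] by simp
  qed
  consider "k = 2" | "k = 3" | "k = 4" | "k > 4" using sh unfolding reachable_shape_def by linarith
  then show ?thesis
  proof cases
    case 1
    then have e: "B = {2}" "\<rho> = (\<lambda>j. j)" using sh by (auto simp: reachable_shape_def)
    then have "i = 2" using i by simp
    then have "black_perm i r \<rho> = (\<lambda>j. j)" using two insert_fixpoint_id e by simp
    moreover have "insert_black i B = {2}" using e \<open>i = 2\<close> by (auto simp: insert_black_def)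
    ultimately show ?thesis using 1 by (simp add: reachable_shape_def)
  next
    case 2
    then obtain i1 i2 where a: "1 \<le> i1" "i1 + 1 < i2" "i2 + 1 < n" and B: "B = {2, i1 + 2}"
      and \<rho>: "\<rho> = subst (path_to [i1, i1 + 1, i2, i2 + 1, n] i1)"
      using sh unfolding reachable_shape_def by auto
    have "\<exists>i1 i2. 1 \<le> i1 \<and> i1 + 1 < i2 \<and> i2 + 1 < n + 1 \<and> insert_black i B = {2, i1 + 2} \<and>
        black_perm i r \<rho> = subst (path_to [i1, i1 + 1, i2, i2 + 1, n + 1] i1)"
    proof (cases "i = 2")
      case True
      have "black_perm i r \<rho> = subst (path_to [i1 + 1, i1 + 2, i2 + 1, i2 + 2, n + 1] (i1 + 1))"
        unfolding two[OF True] unfolding \<rho> insert_fixpoint_subst using a by (simp add: sh_def)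
      moreover have "insert_black i B = {2, i1 + 1 + 2}"
        using True a by (auto simp: B insert_black_def sh_def)
      ultimately show ?thesis using a by (intro exI[of _ "i1 + 1"] exI[of _ "i2 + 1"]) simp
    next
      case False
      then have i': "i = i1 + 2" using i B by simp
      then have "i + 1 \<notin> B" using a B by simp
      then have "black_perm i r \<rho> = subst (path_to [i1, i1 + 1, i2 + 1, i2 + 2, n + 1] i1)"
        unfolding one[OF \<open>i + 1 \<notin> B\<close>] unfolding \<rho> insert_fixpoint_subst i' using a by (simp add: sh_def)
      moreover have "insert_black i B = {2, i1 + 2}"
        using i' a by (auto simp: B insert_black_def sh_def)
      ultimately show ?thesis using a by (intro exI[of _ i1] exI[of _ "i2 + 1"]) simp
    qed
    then show ?thesis using 2 by (simp add: reachable_shape_def)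
  next
    case 3
    then have c: "cell_perm n \<rho> B" using sh by (simp add: reachable_shape_def)
    have "cell_perm (n + 1) (black_perm i r \<rho>) (insert_black i B)"
      using c unfolding cell_perm_def[of n]
    proof (elim exE disjE conjE)
      fix i1 i2 i3 i4
      assume x: "orthodox_indices i1 i2 i3 i4 n" and B: "B = {2, i1 + 2, i3 + 2}"
        and \<rho>: "\<rho> = subst (class_pairs (orthodox_classes i1 i2 i3 i4 n))"
      \<comment> \<open>The position of the new zero column: a blow-up at 2 creates it in front, any
        other one at \<open>i\<close> itself.\<close>
      define z where "z = (if i = 2 then 1 else i)"
      have iB: "i = 2 \<or> i \<noteq> 2 \<and> i = i1 + 2 \<or> i \<noteq> 2 \<and> i \<noteq> i1 + 2 \<and> i = i3 + 2" using i B by auto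
      have "i \<noteq> 2 \<Longrightarrow> i + 1 \<notin> B" using iB x by (auto simp: B orthodox_indices_def)
      then have "black_perm i r \<rho> = insert_fixpoint z \<rho>" using one two by (cases "i = 2") (auto simp: z_def)
      moreover have "z \<le> i1 \<or> z = i1 + 2 \<or> z = i3 + 2" using iB x by (auto simp: z_def orthodox_indices_def)
      ultimately have "black_perm i r \<rho> =
          subst (class_pairs (orthodox_classes (sh z i1) (sh z i2) (sh z i3) (sh z i4) (n + 1)))"
        using insert_fixpoint_classes[OF classes_nonempty(1)] orthodox_classes_sh[OF x] \<rho> by simp
      moreover have "orthodox_indices (sh z i1) (sh z i2) (sh z i3) (sh z i4) (n + 1)"
        using iB x by (auto simp: z_def orthodox_indices_def sh_def)
      moreover have "insert_black i B = {2, sh z i1 + 2, sh z i3 + 2}"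
        using iB x insert_black_triple[of "i1 + 2" "i3 + 2"]
        unfolding B orthodox_indices_def by (elim disjE conjE) (simp_all add: z_def sh_def)
      ultimately show ?thesis by (intro cell_permI(1))
    next
      fix i1 i2 i3 i4
      assume x: "deviant_indices i1 i2 i3 i4 n" and B: "B = {2, i1 + 2, i2 + 2}"
        and \<rho>: "\<rho> = subst (class_pairs (deviant_classes i1 i2 i3 i4 n))"
      have iB: "i = 2 \<or> i \<noteq> 2 \<and> i = i1 + 2 \<or> i \<noteq> 2 \<and> i \<noteq> i1 + 2 \<and> i = i2 + 2" using i B by auto
      show ?thesis
      proof (cases "i = i1 + 2 \<and> i2 = i1 + 1")
        case True
        have "r = i1 + 2 + 2"
        proof -
          have "r \<noteq> i1 + 3" using i(5) B True by auto
          then have "r > i1 + 3" using i(2) True by auto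
          moreover have "\<not> r > i1 + 4"
          proof
            assume "r > i1 + 4"
            then have "i1 + 4 \<in> B" using i(4) True by auto
            then show False using B True x by (auto simp: deviant_indices_def)
          qed
          ultimately show ?thesis by auto
        qed
        then have "black_perm i r \<rho> = subst (class_pairs (deviant_classes i1 (i1 + 2) (i3 + 1) (i4 + 1) (n + 1)))"
          using black_deviant[of i1 i3 i4 n] x True \<rho> by (auto simp: deviant_indices_def)
        moreover have "deviant_indices i1 (i1 + 2) (i3 + 1) (i4 + 1) (n + 1)"
          using x True by (auto simp: deviant_indices_def)
        moreover have "insert_black i B = {2, i1 + 2, i1 + 2 + 2}"
          using True x by (auto simp: B insert_black_def sh_def deviant_indices_def)
        ultimately show ?thesis by (intro cell_permI(2))
      next
        case False
        define z where "z = (if i = 2 then 1 else i)"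
        have "i \<noteq> 2 \<Longrightarrow> i + 1 \<notin> B" using iB x False by (auto simp: B deviant_indices_def)
        then have "black_perm i r \<rho> = insert_fixpoint z \<rho>" using one two by (cases "i = 2") (auto simp: z_def)
        moreover have "z \<le> i1 \<or> z = i1 + 2 \<and> i1 + 1 < i2 \<or> z = i2 + 2"
          using iB x False by (auto simp: z_def deviant_indices_def)
        ultimately have "black_perm i r \<rho> =
            subst (class_pairs (deviant_classes (sh z i1) (sh z i2) (sh z i3) (sh z i4) (n + 1)))"
          using insert_fixpoint_classes[OF classes_nonempty(2)] deviant_classes_sh[OF x] \<rho> by simp
        moreover have "deviant_indices (sh z i1) (sh z i2) (sh z i3) (sh z i4) (n + 1)"
          using iB x False by (auto simp: z_def deviant_indices_def sh_def)
        moreover have "insert_black i B = {2, sh z i1 + 2, sh z i2 + 2}"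
          using iB x False insert_black_triple[of "i1 + 2" "i2 + 2"]
          unfolding B deviant_indices_def by (elim disjE conjE) (simp_all add: z_def sh_def)
        ultimately show ?thesis by (intro cell_permI(2))
      qed
    qed
    then show ?thesis using 3 by (simp add: reachable_shape_def)
  next
    case 4
    then show ?thesis by (simp add: reachable_shape_def)
  qed
qed

lemma shape_white:
  assumes re: "reachable n k B \<rho>" and sh: "reachable_shape n k B \<rho>"
    and i: "i \<in> {3..n - 1}" "r \<in> B" "r < i" "{r<..i} \<inter> B = {}"
  shows "reachable_shape (n + 1) (k + 1) (insert_black i B)
    (white_perm i (if r = 2 then n else r - 2) \<rho>)"
proof -
  \<comment> \<open>A white blow-up at \<open>i\<close> creates the dominoes of index
    \<open>i - 2\<close> and \<open>i\<close>.\<close>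
  define q where "q = i - 2"
  have q: "i = q + 2" "1 \<le> q" "q + 2 < n" using i by (auto simp: q_def)
  have last: "b \<le> r \<or> i < b" if "b \<in> B" for b
  proof -
    have "b \<notin> {r<..i}" using that i(4) by blast
    then show ?thesis by auto
  qed
  consider "k = 2" | "k = 3" | "k > 3" using sh unfolding reachable_shape_def by linarith
  then show ?thesis
  proof cases
    case 1
    then have e: "B = {2}" "\<rho> = (\<lambda>j. j)" using sh by (auto simp: reachable_shape_def)
    have "white_perm i n \<rho> = subst (path_to [q, q + 1, q + 2, q + 2 + 1, n + 1] q)"
      using white_perm_id[OF q(2,3)] e q by simp
    moreover have "insert_black i B = {2, q + 2}" using e q by (auto simp: insert_black_def sh_def)
    moreover have "r = 2" using e i by simp
    ultimately show ?thesis
      unfolding reachable_shape_def using 1 q by (intro conjI impI exI[of _ q] exI[of _ "q + 2"]) auto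
  next
    case 2
    then obtain i1 i2 where a: "1 \<le> i1" "i1 + 1 < i2" "i2 + 1 < n" and B: "B = {2, i1 + 2}"
      and \<rho>: "\<rho> = subst (path_to [i1, i1 + 1, i2, i2 + 1, n] i1)"
      using sh unfolding reachable_shape_def by auto
    have "i \<noteq> i1 + 2" using last[of "i1 + 2"] i(2,3) B by auto
    then consider "q + 1 \<le> i1" | "i1 + 1 \<le> q" "q + 1 \<le> i2" | "i2 \<le> q" using q by linarith
    then have "cell_perm (n + 1) (white_perm i (if r = 2 then n else r - 2) \<rho>) (insert_black i B)"
    proof cases
      case 1
      then have "r = 2" using i(2,3) B q by auto
      then show ?thesis
        using white_orthodox_left[OF a(2,3) q(2) 1] 1 q a
        by (intro cell_permI(1)[of q "q + 2" "i1 + 1" "i2 + 1"])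
          (auto simp: orthodox_indices_def \<rho> B insert_black_def sh_def)
    next
      case 2
      then have "r = i1 + 2" using last[of "i1 + 2"] i(2) B q a by auto
      then show ?thesis
        using white_deviant[OF a(1) 2 a(3)] 2 q a
        by (intro cell_permI(2)[of i1 q "q + 2" "i2 + 1"])
          (auto simp: deviant_indices_def \<rho> B insert_black_def sh_def)
    next
      case 3
      then have "r = i1 + 2" using last[of "i1 + 2"] i(2) B q a by auto
      then show ?thesis
        using white_orthodox_right[OF a(2,3,1) 3 q(3)] 3 q a
        by (intro cell_permI(1)[of i1 i2 q "q + 2"])
          (auto simp: orthodox_indices_def \<rho> B insert_black_def sh_def)
    qed
    then show ?thesis using 2 by (simp add: reachable_shape_def)
  next
    case 3
    then show ?thesis by (simp add: reachable_shape_def)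
  qed
qed

lemma reachable_cell_perm:
  "reachable n 4 B \<rho> \<Longrightarrow> cell_perm n \<rho> B"
proof -
  have "reachable n k B \<rho> \<Longrightarrow> reachable_shape n k B \<rho>" for n k B \<rho>
  proof (induction rule: reachable.induct)
    case start
    then show ?case by (simp add: reachable_shape_def)
  next
    case (at_black n k B \<rho> i r)
    then show ?case by (intro shape_black)
  next
    case (at_white n k B \<rho> i r)
    then show ?case by (intro shape_white)
  qed
  then show "reachable n 4 B \<rho> \<Longrightarrow> cell_perm n \<rho> B" by (auto simp: reachable_shape_def)
qed

section \<open>Pipes in diagrams with two rows\<close>

text \<open>A diagram is described by the labels \<open>q1 < q2\<close> of its rows and by the lists, in increasing
  order, of the labels of the columns with a \<open>+\<close> in the first and in the second row. Labels
  increase from right to left.\<close>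

definition plus_at :: "nat list \<Rightarrow> nat \<Rightarrow> symbol" where
  "plus_at ls l = (if l \<in> set ls then P else Z)"

text \<open>Labels above \<open>q2\<close> belong to columns of height 2, those between
  \<open>q1\<close> and \<open>q2\<close> to columns of height 1. The label \<open>q2\<close> of the
  second row lies between the two kinds, which explains the different offsets.\<close>

definition two_row_column :: "nat \<Rightarrow> nat \<Rightarrow> nat list \<Rightarrow> nat list \<Rightarrow> nat \<Rightarrow> symbol list" where
  "two_row_column n q2 R1 R2 c =
     (if c \<le> n - q2 then [plus_at R1 (n + 1 - c), plus_at R2 (n + 1 - c)] else [plus_at R1 (n - c)])"

definition two_row_diagram :: "nat \<Rightarrow> nat \<Rightarrow> nat \<Rightarrow> nat list \<Rightarrow> nat list \<Rightarrow> diagram" where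
  "two_row_diagram n q1 q2 R1 R2 = map (two_row_column n q2 R1 R2) [1..<n - q1]"

text \<open>A pipe moving left meets increasing labels, so its next \<open>+\<close> is at the first
  label of the sorted list above \<open>x\<close>. The default \<open>q\<close> is the label of the
  row, for a pipe that leaves it on the left.\<close>

fun next_in :: "nat list \<Rightarrow> nat \<Rightarrow> nat \<Rightarrow> nat" where
  "next_in [] q x = q"
| "next_in (l # ls) q x = (if x < l then l else next_in ls q x)"

definition up :: "nat \<Rightarrow> nat list \<Rightarrow> nat \<Rightarrow> nat" where
  "up q1 R1 l = (if l \<in> set R1 then next_in R1 q1 l else l)"

text \<open>A pipe in the second row leaves it upwards at the next \<open>+\<close> or on the left.
  In the first row it either goes straight up or is turned left by a \<open>+\<close>, and then
  leaves at the next \<open>+\<close> or on the left.\<close>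

definition two_row_perm :: "nat \<Rightarrow> nat \<Rightarrow> nat list \<Rightarrow> nat list \<Rightarrow> nat \<Rightarrow> nat" where
  "two_row_perm q1 q2 R1 R2 l =
     (if l = q1 then next_in R1 q1 l
      else if l = q2 \<or> l \<in> set R2 then
        let m = next_in R2 q2 l in if m = q2 then q2 else up q1 R1 m
      else up q1 R1 l)"

lemma next_in_cases:
  assumes "sorted xs"
  shows "(\<forall>y\<in>set xs. y \<le> x) \<and> next_in xs q x = q \<or>
    next_in xs q x \<in> set xs \<and> x < next_in xs q x \<and> (\<forall>y\<in>set xs. x < y \<longrightarrow> next_in xs q x \<le> y)"
  using assms by (induction xs) auto

lemma next_in_cong:
  "(\<And>y. y \<in> set ys \<Longrightarrow> (x < y) = (x' < y)) \<Longrightarrow> next_in ys q x = next_in ys q x'"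
  by (induction ys) auto

section \<open>Following the pipes box by box\<close>

lemma pipe_border: "pipe D s 0 c = ColEdge c" "0 < r \<Longrightarrow> pipe D s r 0 = RowEdge r"
  by (subst pipe.simps, simp)+

lemma pipe_step:
  assumes "0 < r" "0 < c"
  shows "box D r c = Z \<Longrightarrow> pipe D RightSide r c = pipe D RightSide r (c - 1)"
    "box D r c = P \<Longrightarrow> pipe D RightSide r c = pipe D BottomSide (r - 1) c"
    "box D r c = Z \<Longrightarrow> pipe D BottomSide r c = pipe D BottomSide (r - 1) c"
    "box D r c = P \<Longrightarrow> pipe D BottomSide r c = pipe D RightSide r (c - 1)"
  by (subst pipe.simps, use assms in simp)+

locale two_rows =
  fixes n q1 q2 :: nat and R1 R2
  assumes q: "1 \<le> q1" "q1 < q2" "q2 \<le> n"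
    and R1: "sorted R1" "set R1 \<subseteq> {q1<..n} - {q2}" and R2: "sorted R2" "set R2 \<subseteq> {q2<..n}"
begin

abbreviation "D \<equiv> two_row_diagram n q1 q2 R1 R2"

definition lab :: "nat \<Rightarrow> nat" where
  "lab c = (if c \<le> n - q2 then n + 1 - c else n - c)"

lemma length_D: "length D = n - q1 - 1"
  by (simp add: two_row_diagram_def)

lemma D_nth: "c \<in> {1..n - q1 - 1} \<Longrightarrow> D ! (c - 1) = two_row_column n q2 R1 R2 c"
  by (auto simp: two_row_diagram_def nth_upt)

lemma oplus: "oplus_diagram 2 n D"
proof -
  have "sorted_wrt (\<ge>) (map length D)"
    unfolding two_row_diagram_def map_map
    by (auto simp: sorted_wrt_map sorted_wrt_iff_nth_less two_row_column_def)
  then show ?thesis using q unfolding oplus_diagram_def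
    by (auto simp: length_D two_row_diagram_def two_row_column_def)
qed

lemma box1: "c \<in> {1..n - q1 - 1} \<Longrightarrow> box D 1 c = plus_at R1 (lab c)"
  using D_nth[of c] by (simp add: box_def two_row_column_def lab_def)

lemma box2: "c \<in> {1..n - q2} \<Longrightarrow> box D 2 c = plus_at R2 (lab c)"
proof -
  assume c: "c \<in> {1..n - q2}"
  then have "c \<in> {1..n - q1 - 1}" using q by auto
  then show ?thesis using c D_nth[of c] by (simp add: box_def two_row_column_def lab_def)
qed

lemma col_height: "col_height D c = (if c \<in> {1..n - q2} then 2 else if c \<in> {1..n - q1 - 1} then 1 else 0)"
  using q D_nth[of c] by (auto simp: col_height_def length_D two_row_column_def)

lemma row_length1: "row_length D 1 = n - q1 - 1"
proof -
  have "filter (\<lambda>x. 1 \<le> length x) D = D"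
    by (rule filter_True) (auto simp: two_row_diagram_def two_row_column_def)
  then show ?thesis by (simp add: row_length_def length_D)
qed

lemma row_length2: "row_length D 2 = n - q2"
proof -
  have "filter (\<lambda>x. 2 \<le> length x) D = map (two_row_column n q2 R1 R2) (filter (\<lambda>c. c \<le> n - q2) [1..<n - q1])"
    by (simp add: two_row_diagram_def filter_map comp_def two_row_column_def)
  also have "filter (\<lambda>c. c \<le> n - q2) [1..<n - q1] = [1..<n - q2 + 1]"
  proof -
    have "[1..<n - q1] = [1..<n - q2 + 1] @ [n - q2 + 1..<n - q1]"
    proof -
      have e: "n - q1 = n - q2 + 1 + (q2 - q1 - 1)" using q by linarith
      show ?thesis unfolding e by (rule upt_add_eq_append) simp
    qed
    moreover have "filter (\<lambda>c. c \<le> n - q2) [1..<n - q2 + 1] = [1..<n - q2 + 1]"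
      by (rule filter_True) auto
    moreover have "filter (\<lambda>c. c \<le> n - q2) [n - q2 + 1..<n - q1] = []"
      by (rule filter_False) auto
    ultimately show ?thesis by simp
  qed
  finally show ?thesis unfolding row_length_def by (simp del: upt_Suc)
qed

definition edge :: "nat \<Rightarrow> border_edge" where
  "edge l = (if l = q1 then RowEdge 1 else if l = q2 then RowEdge 2
     else if q2 < l then ColEdge (n + 1 - l) else if q1 < l then ColEdge (n - l) else ColEdge (n - 1 - l))"

lemma edge_edge_label: "x \<in> border_edges 2 n \<Longrightarrow> edge (edge_label 2 n D x) = x"
proof -
  assume "x \<in> border_edges 2 n"
  then consider "x = RowEdge 1" | "x = RowEdge 2" | c where "x = ColEdge c" "c \<in> {1..n - 2}"
    unfolding border_edges_def by force
  then show ?thesis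
  proof cases
    case 1
    then show ?thesis using q row_length1 by (simp add: edge_def)
  next
    case 2
    then show ?thesis using q row_length2 by (simp add: edge_def)
  next
    case 3
    consider "c \<le> n - q2" | "n - q2 < c" "c \<le> n - q1 - 1" | "n - q1 - 1 < c" by linarith
    then show ?thesis using 3 q by cases (auto simp: col_height edge_def)
  qed
qed

lemma edge_label_edge:
  assumes "l \<in> {1..n}"
  shows "edge l \<in> border_edges 2 n" "edge_label 2 n D (edge l) = l"
proof -
  consider "l = q1" | "l = q2" | "q2 < l" | "q1 < l" "l < q2" | "l < q1" by linarith
  then have "edge l \<in> border_edges 2 n \<and> edge_label 2 n D (edge l) = l"
  proof cases
    case 1
    then show ?thesis using q row_length1 by (simp add: edge_def border_edges_def)
  next
    case 2
    then show ?thesis using q row_length2 by (simp add: edge_def border_edges_def)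
  qed (use q assms in \<open>auto simp: col_height edge_def border_edges_def\<close>)
  then show "edge l \<in> border_edges 2 n" "edge_label 2 n D (edge l) = l" by auto
qed

lemma inv_edge: "l \<in> {1..n} \<Longrightarrow> inv_into (border_edges 2 n) (edge_label 2 n D) l = edge l"
  by (rule inv_into_f_eq) (auto intro: inj_on_inverseI[of _ edge] edge_edge_label edge_label_edge)

lemma lab_col:
  "c \<in> {1..n - q1 - 1} \<Longrightarrow> edge (lab c) = ColEdge c"
  "c \<in> {1..n - q1 - 1} \<Longrightarrow> lab c \<in> {q1<..n} - {q2}"
  using q by (auto simp: lab_def edge_def)

lemma lab_less: "c < c' \<Longrightarrow> c' \<in> {1..n - q1 - 1} \<Longrightarrow> lab c' < lab c"
  using q by (auto simp: lab_def)

lemma lab_surj: "l \<in> {q1<..n} - {q2} \<Longrightarrow> \<exists>c\<in>{1..n - q1 - 1}. lab c = l"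
  using q by (intro bexI[of _ "if q2 < l then n + 1 - l else n - l"]) (auto simp: lab_def)

text \<open>\<open>x\<close> is the label passed last, which is that of the row at its right end. A
  box with \<open>0\<close> may be skipped because no label of \<open>R1\<close> lies between
  \<open>x\<close> and the label of that box.\<close>

lemma pipe_right1:
  "c \<le> n - q1 - 1 \<Longrightarrow> (if c = n - q1 - 1 then x = q1 else x = lab (c + 1)) \<Longrightarrow>
     pipe D RightSide 1 c = edge (next_in R1 q1 x)"
proof (induction c arbitrary: x)
  case 0
  have "\<forall>y\<in>set R1. y \<le> x"
  proof
    fix y assume "y \<in> set R1"
    then have "q1 < y" "y \<le> n" "y \<noteq> q2" using R1(2) by auto
    then show "y \<le> x" using 0 q by (auto simp: lab_def split: if_splits)
  qed
  then have "next_in R1 q1 x = q1" using next_in_cases[OF R1(1), of x q1] by auto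
  then show ?case by (simp add: pipe_border edge_def)
next
  case (Suc c)
  let ?l = "lab (Suc c)"
  have c: "Suc c \<in> {1..n - q1 - 1}" using Suc.prems by auto
  have x: "x < ?l" "\<And>y. y \<in> set R1 \<Longrightarrow> x < y \<Longrightarrow> ?l \<le> y"
  proof -
    show "x < ?l" using Suc.prems lab_less[of "Suc c" "Suc c + 1"] lab_col(2)[OF c]
      by (auto split: if_splits)
    fix y assume y: "y \<in> set R1" "x < y"
    then obtain c' where c': "c' \<in> {1..n - q1 - 1}" "lab c' = y" using lab_surj R1 by blast
    have "c' \<le> Suc c"
    proof (rule ccontr)
      assume a: "\<not> c' \<le> Suc c"
      then have x: "x = lab (Suc c + 1)" "Suc c + 1 \<le> c'" using Suc.prems c'(1) by (auto split: if_splits)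
      then have "y \<le> x" using lab_less[of "Suc c + 1" c'] c' by (cases "c' = Suc c + 1") auto
      then show False using y by simp
    qed
    then show "?l \<le> y" using lab_less[of c' "Suc c"] c' c by (cases "c' = Suc c") auto
  qed
  show ?case
  proof (cases "?l \<in> set R1")
    case True
    then have "next_in R1 q1 x = ?l"
      using next_in_cases[OF R1(1), of x q1] x by (meson le_antisym linorder_not_le)
    moreover have "pipe D RightSide 1 (Suc c) = ColEdge (Suc c)"
      using True box1[OF c] pipe_step(2)[of 1 "Suc c" D] pipe_border(1) by (simp add: plus_at_def)
    ultimately show ?thesis using lab_col(1)[OF c] by simp
  next
    case False
    have "pipe D RightSide 1 (Suc c) = pipe D RightSide 1 c"
      using False box1[OF c] pipe_step(1)[of 1 "Suc c" D] by (simp add: plus_at_def)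
    also have "\<dots> = edge (next_in R1 q1 ?l)" by (rule Suc.IH) (use c in auto)
    also have "next_in R1 q1 ?l = next_in R1 q1 x"
    proof -
      have "(x < y) = (?l < y)" if y: "y \<in> set R1" for y
      proof -
        have "y \<noteq> ?l" using y False by auto
        then show ?thesis using x(1) x(2)[OF y] by linarith
      qed
      then show ?thesis by (intro next_in_cong) simp
    qed
    finally show ?thesis .
  qed
qed

lemma pipe_bottom1:
  assumes "c \<in> {1..n - q1 - 1}"
  shows "pipe D BottomSide 1 c = edge (up q1 R1 (lab c))"
proof (cases "lab c \<in> set R1")
  case True
  have "pipe D BottomSide 1 c = pipe D RightSide 1 (c - 1)"
    using True box1[OF assms] pipe_step(4)[of 1 c D] assms by (simp add: plus_at_def)
  also have "\<dots> = edge (next_in R1 q1 (lab c))"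
    using assms by (intro pipe_right1) auto
  finally show ?thesis using True by (simp add: up_def)
next
  case False
  have "pipe D BottomSide 1 c = ColEdge c"
    using False box1[OF assms] pipe_step(3)[of 1 c D] pipe_border(1) assms by (simp add: plus_at_def)
  then show ?thesis using False lab_col(1)[OF assms] by (simp add: up_def)
qed

definition up2 :: "nat \<Rightarrow> nat" where
  "up2 m = (if m = q2 then q2 else up q1 R1 m)"

lemma pipe_right2:
  "c \<le> n - q2 \<Longrightarrow> (if c = n - q2 then x = q2 else x = lab (c + 1)) \<Longrightarrow>
     pipe D RightSide 2 c = edge (up2 (next_in R2 q2 x))"
proof (induction c arbitrary: x)
  case 0
  have "\<forall>y\<in>set R2. y \<le> x"
  proof
    fix y assume "y \<in> set R2"
    then have "q2 < y" "y \<le> n" using R2(2) by auto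
    then show "y \<le> x" using 0 q by (auto simp: lab_def split: if_splits)
  qed
  then have "next_in R2 q2 x = q2" using next_in_cases[OF R2(1), of x q2] by auto
  then show ?case using q by (simp add: pipe_border edge_def up2_def)
next
  case (Suc c)
  let ?l = "lab (Suc c)"
  have c2: "Suc c \<in> {1..n - q2}" using Suc.prems by auto
  have c: "Suc c \<in> {1..n - q1 - 1}" using Suc.prems q by auto
  have x: "x < ?l" "\<And>y. y \<in> set R2 \<Longrightarrow> x < y \<Longrightarrow> ?l \<le> y"
    using Suc.prems q by (auto simp: lab_def split: if_splits)
  show ?case
  proof (cases "?l \<in> set R2")
    case True
    then have "next_in R2 q2 x = ?l"
      using next_in_cases[OF R2(1), of x q2] x by (meson le_antisym linorder_not_le)
    moreover have "pipe D RightSide 2 (Suc c) = pipe D BottomSide 1 (Suc c)"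
      using True box2[OF c2] pipe_step(2)[of 2 "Suc c" D] by (simp add: plus_at_def)
    moreover have "?l \<noteq> q2" using lab_col(2)[OF c] by simp
    ultimately show ?thesis using pipe_bottom1[OF c] by (simp add: up2_def)
  next
    case False
    have "pipe D RightSide 2 (Suc c) = pipe D RightSide 2 c"
      using False box2[OF c2] pipe_step(1)[of 2 "Suc c" D] by (simp add: plus_at_def)
    also have "\<dots> = edge (up2 (next_in R2 q2 ?l))" by (rule Suc.IH) (use c2 in auto)
    also have "next_in R2 q2 ?l = next_in R2 q2 x"
    proof -
      have "(x < y) = (?l < y)" if y: "y \<in> set R2" for y
      proof -
        have "y \<noteq> ?l" using y False by auto
        then show ?thesis using x(1) x(2)[OF y] by linarith
      qed
      then show ?thesis by (intro next_in_cong) simp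
    qed
    finally show ?thesis .
  qed
qed

lemma pipe_bottom2:
  assumes "c \<in> {1..n - q2}"
  shows "pipe D BottomSide 2 c =
    edge (if lab c \<in> set R2 then up2 (next_in R2 q2 (lab c)) else up q1 R1 (lab c))"
proof (cases "lab c \<in> set R2")
  case True
  have "pipe D BottomSide 2 c = pipe D RightSide 2 (c - 1)"
    using True box2[OF assms] pipe_step(4)[of 2 c D] assms by (simp add: plus_at_def)
  also have "\<dots> = edge (up2 (next_in R2 q2 (lab c)))"
    using assms by (intro pipe_right2) auto
  finally show ?thesis using True by simp
next
  case False
  have "pipe D BottomSide 2 c = pipe D BottomSide 1 c"
    using False box2[OF assms] pipe_step(3)[of 2 c D] assms by (simp add: plus_at_def)
  moreover have "c \<in> {1..n - q1 - 1}" using assms q by auto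
  ultimately show ?thesis using False pipe_bottom1 by simp
qed

lemma pipe_end_edge:
  assumes l: "l \<in> {1..n}"
  shows "pipe_end D (edge l) = edge (two_row_perm q1 q2 R1 R2 l)"
proof -
  consider "l = q1" | "l = q2" | "q2 < l" | "q1 < l" "l < q2" | "l < q1" by linarith
  then show ?thesis
  proof cases
    case 1
    then show ?thesis using q row_length1 pipe_right1[of "n - q1 - 1" q1]
      by (simp add: edge_def[of q1] two_row_perm_def)
  next
    case 2
    then show ?thesis using q row_length2 pipe_right2[of "n - q2" q2]
      by (simp add: edge_def[of q2] two_row_perm_def up2_def Let_def)
  next
    case 3
    define c where "c = n + 1 - l"
    have c: "c \<in> {1..n - q2}" "lab c = l" "edge l = ColEdge c" using 3 l q by (auto simp: c_def lab_def edge_def)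
    then show ?thesis using 3 q pipe_bottom2[OF c(1)]
      by (simp add: col_height two_row_perm_def up2_def Let_def)
  next
    case 4
    define c where "c = n - l"
    have c: "c \<in> {1..n - q1 - 1}" "c \<notin> {1..n - q2}" "lab c = l" "edge l = ColEdge c"
      using 4 l q by (auto simp: c_def lab_def edge_def)
    moreover have "l \<notin> set R2" using 4 R2 by auto
    ultimately show ?thesis using 4 q pipe_bottom1[OF c(1)]
      by (simp add: col_height two_row_perm_def)
  next
    case 5
    define c where "c = n - 1 - l"
    have c: "c \<notin> {1..n - q1 - 1}" "c \<notin> {1..n - q2}" "edge l = ColEdge c"
      using 5 l q by (auto simp: c_def edge_def)
    moreover have "l \<notin> set R2" "l \<notin> set R1" using 5 R2 R1 q by auto
    ultimately show ?thesis using 5 q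
      by (auto simp: col_height two_row_perm_def up_def pipe_border)
  qed
qed

lemma two_row_perm_range: "l \<in> {1..n} \<Longrightarrow> two_row_perm q1 q2 R1 R2 l \<in> {1..n}"
proof -
  assume l: "l \<in> {1..n}"
  have a: "next_in R1 q1 x \<in> {1..n}" for x
    using next_in_cases[OF R1(1), of x q1] R1(2) q by auto
  have "next_in R2 q2 x \<in> {1..n}" for x
    using next_in_cases[OF R2(1), of x q2] R2(2) q by auto
  then show ?thesis using a l q by (auto simp: two_row_perm_def up_def Let_def)
qed

text \<open>All fixed points are black, because neither of the two row labels is fixed and the other
  labels belong to horizontal edges.\<close>

lemma diagram_perm_two_rows:
  assumes \<rho>: "\<And>l. l \<in> {1..n} \<Longrightarrow> two_row_perm q1 q2 R1 R2 l = \<rho> l" "\<And>l. l \<notin> {1..n} \<Longrightarrow> \<rho> l = l"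
    and fixed: "\<rho> q1 \<noteq> q1" "\<rho> q2 \<noteq> q2"
  shows "diagram_perm 2 n D = (\<rho>, {i \<in> {1..n}. \<rho> i = i})"
proof -
  let ?e = "inv_into (border_edges 2 n) (edge_label 2 n D)"
  have p: "(\<lambda>i. if i \<in> {1..n} then edge_label 2 n D (pipe_end D (?e i)) else i) = \<rho>"
  proof
    fix i
    show "(if i \<in> {1..n} then edge_label 2 n D (pipe_end D (?e i)) else i) = \<rho> i"
    proof (cases "i \<in> {1..n}")
      case True
      then have "edge_label 2 n D (pipe_end D (?e i)) = edge_label 2 n D (edge (\<rho> i))"
        using inv_edge pipe_end_edge \<rho>(1) by simp
      also have "\<dots> = \<rho> i" using edge_label_edge(2) two_row_perm_range[OF True] \<rho>(1)[OF True] by simp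
      finally show ?thesis using True by simp
    next
      case False
      then show ?thesis using \<rho>(2)[OF False] by (metis (full_types))
    qed
  qed
  have "(\<exists>c. ?e i = ColEdge c)" if "i \<in> {1..n}" "\<rho> i = i" for i
    using that fixed inv_edge by (auto simp: edge_def)
  then have "{i \<in> {1..n}. \<rho> i = i \<and> (\<exists>c. ?e i = ColEdge c)} = {i \<in> {1..n}. \<rho> i = i}" by blast
  then show ?thesis unfolding diagram_perm_def Let_def p fun_cong[OF p] by (simp only:)
qed

end

lemma two_row_perm_subst:
  assumes K: "K = q1 # q2 # R1 @ R2"
    and eq: "\<forall>l\<in>set K. two_row_perm q1 q2 R1 R2 l = subst ps l"
    and keys: "fst ` set ps \<subseteq> set K"
  shows "two_row_perm q1 q2 R1 R2 = subst ps"
proof (rule eq_by_keys[OF eq])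
  fix l assume l: "l \<notin> set K"
  then have "l \<notin> fst ` set ps" using keys by blast
  then show "two_row_perm q1 q2 R1 R2 l = subst ps l"
    using l K subst_other by (simp add: two_row_perm_def up_def)
qed

section \<open>Diagrams and sign patterns of the nine classes\<close>

lemma map_upt_Nil: "a = b \<Longrightarrow> map f [a..<b] \<in> instances []"
  by simp

lemma map_upt_One:
  "map f [a + 1..<b] \<in> instances ts \<Longrightarrow> a < b \<Longrightarrow> f a = x \<Longrightarrow> map f [a..<b] \<in> instances (One x # ts)"
  by (simp add: upt_conv_Cons)

text \<open>Once the end \<open>m\<close> of the block has been chosen, membership in a pattern is
  proved by walking along the interval.\<close>

lemma map_upt_Many:
  assumes "map f [m..<b] \<in> instances ts" "a \<le> m" "m \<le> b" "\<And>c. a \<le> c \<Longrightarrow> c < m \<Longrightarrow> f c = x"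
  shows "map f [a..<b] \<in> instances (Many x # ts)"
proof -
  have "map f [a..<m] = replicate (m - a) x"
    using assms(4) by (intro replicate_eqI) auto
  moreover have "[a..<b] = [a..<m] @ [m..<b]"
    using assms(2,3) upt_add_eq_append[of a m "b - m"] by simp
  ultimately have "map f [a..<b] = replicate (m - a) x @ map f [m..<b]" by simp
  then show ?thesis using assms(1) by auto
qed

text \<open>The rows are labelled by the pivots: \<open>i1\<close> is the first nonzero column and
  \<open>i3\<close> the first one not parallel to it, which is \<open>i2\<close> in the deviant
  case. The lists give the places of the \<open>+\<close> in the pattern of the class.\<close>

definition orthodox_diagram :: "nat \<Rightarrow> nat \<Rightarrow> nat \<Rightarrow> nat \<Rightarrow> nat \<Rightarrow> diagram" where
  "orthodox_diagram i1 i2 i3 i4 n = two_row_diagram n i1 i3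
     (if i2 = i3 then [i1 + 1, i2 + 1, i4, n] else if i2 + 1 = i3 then [i1 + 1, i2, i3 + 1, n]
      else [i1 + 1, i2, i2 + 1, n])
     [i3 + 1, i4, i4 + 1, n]"

definition deviant_diagram :: "nat \<Rightarrow> nat \<Rightarrow> nat \<Rightarrow> nat \<Rightarrow> nat \<Rightarrow> diagram" where
  "deviant_diagram i1 i2 i3 i4 n = two_row_diagram n i1 i2
     [if i2 = i1 + 1 then i2 + 1 else i1 + 1, i4, i4 + 1, n] [i2 + 1, i3, i3 + 1, n]"

definition orthodox_class :: "nat \<Rightarrow> nat \<Rightarrow> bcfw_class" where
  "orthodox_class i2 i3 = (if i2 = i3 then Class3 else if i2 + 1 = i3 then Class2 else Class1)"

definition deviant_class :: "nat \<Rightarrow> nat \<Rightarrow> nat \<Rightarrow> nat \<Rightarrow> bcfw_class" where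
  "deviant_class i1 i2 i3 i4 =
     (if i2 = i1 + 1 then if i4 = i3 then Class9 else if i4 = i3 + 1 then Class8 else Class7
      else if i4 = i3 then Class4 else if i4 = i3 + 1 then Class5 else Class6)"

lemma orthodox_diagram_perm:
  assumes x: "orthodox_indices i1 i2 i3 i4 n"
  defines "\<rho> \<equiv> subst (class_pairs (orthodox_classes i1 i2 i3 i4 n))"
  shows "oplus_diagram 2 n (orthodox_diagram i1 i2 i3 i4 n)"
    "diagram_perm 2 n (orthodox_diagram i1 i2 i3 i4 n) = (\<rho>, {i \<in> {1..n}. \<rho> i = i})"
proof -
  define R1 where "R1 = (if i2 = i3 then [i1 + 1, i2 + 1, i4, n] else if i2 + 1 = i3
    then [i1 + 1, i2, i3 + 1, n] else [i1 + 1, i2, i2 + 1, n])"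
  define R2 where "R2 = [i3 + 1, i4, i4 + 1, n]"
  have D: "orthodox_diagram i1 i2 i3 i4 n = two_row_diagram n i1 i3 R1 R2"
    by (simp add: orthodox_diagram_def R1_def R2_def)
  interpret two_rows n i1 i3 R1 R2
    using x by unfold_locales (auto simp: R1_def R2_def orthodox_indices_def)
  have e: "two_row_perm i1 i3 R1 R2 = \<rho> \<and> \<rho> i1 \<noteq> i1 \<and> \<rho> i3 \<noteq> i3"
  proof -
    have o: "1 \<le> i1" "i1 + 1 < i2" "i3 + 1 < i4" "i4 + 1 < n" using x by (auto simp: orthodox_indices_def)
    show ?thesis unfolding \<rho>_def
      by (cases rule: orthodox_cases[OF x]; intro conjI two_row_perm_subst[OF refl];
        use o in \<open>simp add: R1_def R2_def orthodox_classes_def class_pairs_def two_row_perm_def up_def Let_def\<close>)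
  qed
  have out: "\<rho> l = l" if "l \<notin> {1..n}" for l
  proof -
    have "l \<notin> {i1, i3} \<union> set R1 \<union> set R2" using that q R1 R2 by auto
    then have "two_row_perm i1 i3 R1 R2 l = l" by (simp add: two_row_perm_def up_def)
    then show ?thesis using e by simp
  qed
  show "oplus_diagram 2 n (orthodox_diagram i1 i2 i3 i4 n)" unfolding D by (rule oplus)
  show "diagram_perm 2 n (orthodox_diagram i1 i2 i3 i4 n) = (\<rho>, {i \<in> {1..n}. \<rho> i = i})"
    unfolding D using e out by (intro diagram_perm_two_rows) auto
qed

lemma deviant_diagram_perm:
  assumes x: "deviant_indices i1 i2 i3 i4 n"
  defines "\<rho> \<equiv> subst (class_pairs (deviant_classes i1 i2 i3 i4 n))"
  shows "oplus_diagram 2 n (deviant_diagram i1 i2 i3 i4 n)"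
    "diagram_perm 2 n (deviant_diagram i1 i2 i3 i4 n) = (\<rho>, {i \<in> {1..n}. \<rho> i = i})"
proof -
  define R1 where "R1 = [if i2 = i1 + 1 then i2 + 1 else i1 + 1, i4, i4 + 1, n]"
  define R2 where "R2 = [i2 + 1, i3, i3 + 1, n]"
  have D: "deviant_diagram i1 i2 i3 i4 n = two_row_diagram n i1 i2 R1 R2"
    by (simp add: deviant_diagram_def R1_def R2_def)
  interpret two_rows n i1 i2 R1 R2
    using x by unfold_locales (auto simp: R1_def R2_def deviant_indices_def)
  have e: "two_row_perm i1 i2 R1 R2 = \<rho> \<and> \<rho> i1 \<noteq> i1 \<and> \<rho> i2 \<noteq> i2"
  proof -
    have o: "1 \<le> i1" "i2 + 1 < i3" "i4 + 1 < n" using x by (auto simp: deviant_indices_def)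
    show ?thesis unfolding \<rho>_def
      by (cases rule: deviant_cases[OF x]; intro conjI two_row_perm_subst[OF refl];
        use o in \<open>simp add: R1_def R2_def deviant_classes_def class_pairs_def two_row_perm_def up_def Let_def\<close>)
  qed
  have out: "\<rho> l = l" if "l \<notin> {1..n}" for l
  proof -
    have "l \<notin> {i1, i2} \<union> set R1 \<union> set R2" using that q R1 R2 by auto
    then have "two_row_perm i1 i2 R1 R2 l = l" by (simp add: two_row_perm_def up_def)
    then show ?thesis using e by simp
  qed
  show "oplus_diagram 2 n (deviant_diagram i1 i2 i3 i4 n)" unfolding D by (rule oplus)
  show "diagram_perm 2 n (deviant_diagram i1 i2 i3 i4 n) = (\<rho>, {i \<in> {1..n}. \<rho> i = i})"
    unfolding D using e out by (intro diagram_perm_two_rows) auto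
qed

lemma sign_pattern_values:
  "sign_pattern Class1 = [Many (0, 0), One (1, 0), One (1, 0), Many (0, 0), One (1, 0),
     One (1, 0), Many (0, 0), One (0, 1), One (0, 1), Many (0, 0), One (0, 1), One (0, 1),
     Many (0, 0), One (-1, 1)]"
  "sign_pattern Class2 = [Many (0, 0), One (1, 0), One (1, 0), Many (0, 0), One (1, 0),
     One (1, 1), One (0, 1), Many (0, 0), One (0, 1), One (0, 1), Many (0, 0), One (-1, 1)]"
  "sign_pattern Class3 = [Many (0, 0), One (1, 0), One (1, 0), Many (0, 0), One (1, 1),
     One (1, 1), Many (0, 0), One (0, 1), One (0, 1), Many (0, 0), One (-1, 1)]"
  "sign_pattern Class4 = [Many (0, 0), One (1, 1), One (1, 1), Many (0, 0), One (0, 1),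
     One (0, 1), Many (0, 0), One (-1, 1), One (-1, 1), Many (0, 0), One (-1, 0)]"
  "sign_pattern Class5 = [Many (0, 0), One (1, 1), One (1, 1), Many (0, 0), One (0, 1),
     One (0, 1), Many (0, 0), One (0, 1), One (-1, 1), One (-1, 0), Many (0, 0), One (-1, 0)]"
  "sign_pattern Class6 = [Many (0, 0), One (1, 1), One (1, 1), Many (0, 0), One (0, 1),
     One (0, 1), Many (0, 0), One (0, 1), One (0, 1), Many (0, 0), One (-1, 0), One (-1, 0),
     Many (0, 0), One (-1, 0)]"
  "sign_pattern Class7 = [Many (0, 0), One (1, 1), One (1, 1), One (0, 1), Many (0, 0),
     One (0, 1), One (0, 1), Many (0, 0), One (-1, 0), One (-1, 0), Many (0, 0), One (-1, 0)]"
  "sign_pattern Class8 = [Many (0, 0), One (1, 1), One (1, 1), One (0, 1), Many (0, 0),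
     One (0, 1), One (-1, 1), One (-1, 0), Many (0, 0), One (-1, 0)]"
  "sign_pattern Class9 = [Many (0, 0), One (1, 1), One (1, 1), One (0, 1), Many (0, 0),
     One (-1, 1), One (-1, 1), Many (0, 0), One (-1, 0)]"
  by (simp_all add: sign_pattern_def char_sign_def)

lemma orthodox_diagram_pattern:
  assumes x: "orthodox_indices i1 i2 i3 i4 n"
  shows "orthodox_diagram i1 i2 i3 i4 n \<in> instances (diagram_pattern (orthodox_class i2 i3))"
proof -
  have o: "1 \<le> i1" "i1 + 1 < i2" "i3 + 1 < i4" "i4 + 1 < n" using x by (auto simp: orthodox_indices_def)
  show ?thesis
  proof (cases rule: orthodox_cases[OF x])
    case 1
    have c: "orthodox_class i2 i3 = Class3" using 1 o by (simp add: orthodox_class_def)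
    \<comment> \<open>Columns run from left to right and labels from right to left. A block ends at
      the column of the next label \<open>l\<close>, which is \<open>n + 1 - l\<close> where the
      height is 2 and \<open>n - l\<close> where it is 1.\<close>
    show ?thesis unfolding orthodox_diagram_def two_row_diagram_def c diagram_pattern.simps
      by (rule map_upt_One, rule map_upt_Many[where m = "n - i4"], rule map_upt_One,
      rule map_upt_One, rule map_upt_Many[where m = "n - i3"], rule map_upt_One,
      rule map_upt_Many[where m = "n - i1 - 1"], rule map_upt_One, rule map_upt_Nil)
        (use o 1 in \<open>simp_all add: two_row_column_def plus_at_def, ((intro conjI impI; linarith)+)?\<close>)
  next
    case 2
    have c: "orthodox_class i2 i3 = Class2" using 2 o by (simp add: orthodox_class_def)
    show ?thesis unfolding orthodox_diagram_def two_row_diagram_def c diagram_pattern.simps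
      by (rule map_upt_One, rule map_upt_Many[where m = "n - i4"], rule map_upt_One,
      rule map_upt_One, rule map_upt_Many[where m = "n - i3"], rule map_upt_One,
      rule map_upt_One, rule map_upt_Many[where m = "n - i1 - 1"], rule map_upt_One,
      rule map_upt_Nil)
        (use o 2 in \<open>simp_all add: two_row_column_def plus_at_def, ((intro conjI impI; linarith)+)?\<close>)
  next
    case 3
    have c: "orthodox_class i2 i3 = Class1" using 3 o by (simp add: orthodox_class_def)
    show ?thesis unfolding orthodox_diagram_def two_row_diagram_def c diagram_pattern.simps
      by (rule map_upt_One, rule map_upt_Many[where m = "n - i4"], rule map_upt_One,
      rule map_upt_One, rule map_upt_Many[where m = "n - i3"], rule map_upt_One,
      rule map_upt_Many[where m = "n - i2 - 1"], rule map_upt_One, rule map_upt_One,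
      rule map_upt_Many[where m = "n - i1 - 1"], rule map_upt_One, rule map_upt_Nil)
        (use o 3 in \<open>simp_all add: two_row_column_def plus_at_def, ((intro conjI impI; linarith)+)?\<close>)
  qed
qed

lemma deviant_diagram_pattern:
  assumes x: "deviant_indices i1 i2 i3 i4 n"
  shows "deviant_diagram i1 i2 i3 i4 n \<in> instances (diagram_pattern (deviant_class i1 i2 i3 i4))"
proof -
  have o: "1 \<le> i1" "i2 + 1 < i3" "i4 + 1 < n" using x by (auto simp: deviant_indices_def)
  show ?thesis
  proof (cases rule: deviant_cases[OF x])
    case 1
    have c: "deviant_class i1 i2 i3 i4 = Class9" using 1 o by (simp add: deviant_class_def)
    show ?thesis unfolding deviant_diagram_def two_row_diagram_def c diagram_pattern.simps
      by (rule map_upt_One, rule map_upt_Many[where m = "n - i3"], rule map_upt_One,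
      rule map_upt_One, rule map_upt_Many[where m = "n - i2"], rule map_upt_One,
      rule map_upt_Nil)
        (use o 1 in \<open>simp_all add: two_row_column_def plus_at_def, ((intro conjI impI; linarith)+)?\<close>)
  next
    case 2
    have c: "deviant_class i1 i2 i3 i4 = Class8" using 2 o by (simp add: deviant_class_def)
    show ?thesis unfolding deviant_diagram_def two_row_diagram_def c diagram_pattern.simps
      by (rule map_upt_One, rule map_upt_Many[where m = "n - i4"], rule map_upt_One,
      rule map_upt_One, rule map_upt_One, rule map_upt_Many[where m = "n - i2"],
      rule map_upt_One, rule map_upt_Nil)
        (use o 2 in \<open>simp_all add: two_row_column_def plus_at_def, ((intro conjI impI; linarith)+)?\<close>)
  next
    case 3
    have c: "deviant_class i1 i2 i3 i4 = Class7" using 3 o by (simp add: deviant_class_def)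
    show ?thesis unfolding deviant_diagram_def two_row_diagram_def c diagram_pattern.simps
      by (rule map_upt_One, rule map_upt_Many[where m = "n - i4"], rule map_upt_One,
      rule map_upt_One, rule map_upt_Many[where m = "n - i3"], rule map_upt_One,
      rule map_upt_One, rule map_upt_Many[where m = "n - i2"], rule map_upt_One,
      rule map_upt_Nil)
        (use o 3 in \<open>simp_all add: two_row_column_def plus_at_def, ((intro conjI impI; linarith)+)?\<close>)
  next
    case 4
    have c: "deviant_class i1 i2 i3 i4 = Class4" using 4 o by (simp add: deviant_class_def)
    show ?thesis unfolding deviant_diagram_def two_row_diagram_def c diagram_pattern.simps
      by (rule map_upt_One, rule map_upt_Many[where m = "n - i3"], rule map_upt_One,
      rule map_upt_One, rule map_upt_Many[where m = "n - i2"], rule map_upt_One,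
      rule map_upt_Many[where m = "n - i1 - 1"], rule map_upt_One, rule map_upt_Nil)
        (use o 4 in \<open>simp_all add: two_row_column_def plus_at_def, ((intro conjI impI; linarith)+)?\<close>)
  next
    case 5
    have c: "deviant_class i1 i2 i3 i4 = Class5" using 5 o by (simp add: deviant_class_def)
    show ?thesis unfolding deviant_diagram_def two_row_diagram_def c diagram_pattern.simps
      by (rule map_upt_One, rule map_upt_Many[where m = "n - i4"], rule map_upt_One,
      rule map_upt_One, rule map_upt_One, rule map_upt_Many[where m = "n - i2"],
      rule map_upt_One, rule map_upt_Many[where m = "n - i1 - 1"], rule map_upt_One,
      rule map_upt_Nil)
        (use o 5 in \<open>simp_all add: two_row_column_def plus_at_def, ((intro conjI impI; linarith)+)?\<close>)
  next
    case 6
    have c: "deviant_class i1 i2 i3 i4 = Class6" using 6 o by (simp add: deviant_class_def)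
    show ?thesis unfolding deviant_diagram_def two_row_diagram_def c diagram_pattern.simps
      by (rule map_upt_One, rule map_upt_Many[where m = "n - i4"], rule map_upt_One,
      rule map_upt_One, rule map_upt_Many[where m = "n - i3"], rule map_upt_One,
      rule map_upt_One, rule map_upt_Many[where m = "n - i2"], rule map_upt_One,
      rule map_upt_Many[where m = "n - i1 - 1"], rule map_upt_One, rule map_upt_Nil)
        (use o 6 in \<open>simp_all add: two_row_column_def plus_at_def, ((intro conjI impI; linarith)+)?\<close>)
  qed
qed

lemma orthodox_sign_pattern:
  assumes x: "orthodox_indices i1 i2 i3 i4 n"
    and s: "\<And>j. j \<in> {1..n} \<Longrightarrow> sgn (coord d j) = (if j \<in> {i1, i1 + 1, i2, i2 + 1} then 1 else if j = n then -1 else 0)"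
      "\<And>j. j \<in> {1..n} \<Longrightarrow> sgn (coord e j) = (if j \<in> {i3, i3 + 1, i4, i4 + 1, n} then 1 else 0)"
  shows "has_sign_pattern n (orthodox_class i2 i3) d e"
proof -
  have o: "1 \<le> i1" "i1 + 1 < i2" "i3 + 1 < i4" "i4 + 1 < n" using x by (auto simp: orthodox_indices_def)
  show ?thesis
  proof (cases rule: orthodox_cases[OF x])
    case 1
    have c: "orthodox_class i2 i3 = Class3" using 1 o by (simp add: orthodox_class_def)
    show ?thesis unfolding has_sign_pattern_def c sign_pattern_values
      by (rule map_upt_Many[where m = "i1"], rule map_upt_One, rule map_upt_One,
      rule map_upt_Many[where m = "i2"], rule map_upt_One, rule map_upt_One,
      rule map_upt_Many[where m = "i4"], rule map_upt_One, rule map_upt_One,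
      rule map_upt_Many[where m = "n"], rule map_upt_One, rule map_upt_Nil)
        (use o 1 in \<open>simp_all add: s\<close>)
  next
    case 2
    have c: "orthodox_class i2 i3 = Class2" using 2 o by (simp add: orthodox_class_def)
    show ?thesis unfolding has_sign_pattern_def c sign_pattern_values
      by (rule map_upt_Many[where m = "i1"], rule map_upt_One, rule map_upt_One,
      rule map_upt_Many[where m = "i2"], rule map_upt_One, rule map_upt_One, rule map_upt_One,
      rule map_upt_Many[where m = "i4"], rule map_upt_One, rule map_upt_One,
      rule map_upt_Many[where m = "n"], rule map_upt_One, rule map_upt_Nil)
        (use o 2 in \<open>simp_all add: s\<close>)
  next
    case 3
    have c: "orthodox_class i2 i3 = Class1" using 3 o by (simp add: orthodox_class_def)
    show ?thesis unfolding has_sign_pattern_def c sign_pattern_values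
      by (rule map_upt_Many[where m = "i1"], rule map_upt_One, rule map_upt_One,
      rule map_upt_Many[where m = "i2"], rule map_upt_One, rule map_upt_One,
      rule map_upt_Many[where m = "i3"], rule map_upt_One, rule map_upt_One,
      rule map_upt_Many[where m = "i4"], rule map_upt_One, rule map_upt_One,
      rule map_upt_Many[where m = "n"], rule map_upt_One, rule map_upt_Nil)
        (use o 3 in \<open>simp_all add: s\<close>)
  qed
qed

lemma deviant_sign_pattern:
  assumes x: "deviant_indices i1 i2 i3 i4 n"
    and s: "\<And>j. j \<in> {1..n} \<Longrightarrow> sgn (coord d j) = (if j \<in> {i1, i1 + 1} then 1 else if j \<in> {i4, i4 + 1, n} then -1 else 0)"
      "\<And>j. j \<in> {1..n} \<Longrightarrow> sgn (coord e j) = (if j \<in> {i1, i1 + 1, i2, i2 + 1, i3, i3 + 1} then 1 else 0)"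
  shows "has_sign_pattern n (deviant_class i1 i2 i3 i4) d e"
proof -
  have o: "1 \<le> i1" "i2 + 1 < i3" "i4 + 1 < n" using x by (auto simp: deviant_indices_def)
  show ?thesis
  proof (cases rule: deviant_cases[OF x])
    case 1
    have c: "deviant_class i1 i2 i3 i4 = Class9" using 1 o by (simp add: deviant_class_def)
    show ?thesis unfolding has_sign_pattern_def c sign_pattern_values
      by (rule map_upt_Many[where m = "i1"], rule map_upt_One, rule map_upt_One, rule map_upt_One,
      rule map_upt_Many[where m = "i3"], rule map_upt_One, rule map_upt_One,
      rule map_upt_Many[where m = "n"], rule map_upt_One, rule map_upt_Nil)
        (use o 1 in \<open>simp_all add: s\<close>)
  next
    case 2
    have c: "deviant_class i1 i2 i3 i4 = Class8" using 2 o by (simp add: deviant_class_def)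
    show ?thesis unfolding has_sign_pattern_def c sign_pattern_values
      by (rule map_upt_Many[where m = "i1"], rule map_upt_One, rule map_upt_One, rule map_upt_One,
      rule map_upt_Many[where m = "i3"], rule map_upt_One, rule map_upt_One, rule map_upt_One,
      rule map_upt_Many[where m = "n"], rule map_upt_One, rule map_upt_Nil)
        (use o 2 in \<open>simp_all add: s\<close>)
  next
    case 3
    have c: "deviant_class i1 i2 i3 i4 = Class7" using 3 o by (simp add: deviant_class_def)
    show ?thesis unfolding has_sign_pattern_def c sign_pattern_values
      by (rule map_upt_Many[where m = "i1"], rule map_upt_One, rule map_upt_One, rule map_upt_One,
      rule map_upt_Many[where m = "i3"], rule map_upt_One, rule map_upt_One,
      rule map_upt_Many[where m = "i4"], rule map_upt_One, rule map_upt_One,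
      rule map_upt_Many[where m = "n"], rule map_upt_One, rule map_upt_Nil)
        (use o 3 in \<open>simp_all add: s\<close>)
  next
    case 4
    have c: "deviant_class i1 i2 i3 i4 = Class4" using 4 o by (simp add: deviant_class_def)
    show ?thesis unfolding has_sign_pattern_def c sign_pattern_values
      by (rule map_upt_Many[where m = "i1"], rule map_upt_One, rule map_upt_One,
      rule map_upt_Many[where m = "i2"], rule map_upt_One, rule map_upt_One,
      rule map_upt_Many[where m = "i3"], rule map_upt_One, rule map_upt_One,
      rule map_upt_Many[where m = "n"], rule map_upt_One, rule map_upt_Nil)
        (use o 4 in \<open>simp_all add: s\<close>)
  next
    case 5
    have c: "deviant_class i1 i2 i3 i4 = Class5" using 5 o by (simp add: deviant_class_def)
    show ?thesis unfolding has_sign_pattern_def c sign_pattern_values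
      by (rule map_upt_Many[where m = "i1"], rule map_upt_One, rule map_upt_One,
      rule map_upt_Many[where m = "i2"], rule map_upt_One, rule map_upt_One,
      rule map_upt_Many[where m = "i3"], rule map_upt_One, rule map_upt_One, rule map_upt_One,
      rule map_upt_Many[where m = "n"], rule map_upt_One, rule map_upt_Nil)
        (use o 5 in \<open>simp_all add: s\<close>)
  next
    case 6
    have c: "deviant_class i1 i2 i3 i4 = Class6" using 6 o by (simp add: deviant_class_def)
    show ?thesis unfolding has_sign_pattern_def c sign_pattern_values
      by (rule map_upt_Many[where m = "i1"], rule map_upt_One, rule map_upt_One,
      rule map_upt_Many[where m = "i2"], rule map_upt_One, rule map_upt_One,
      rule map_upt_Many[where m = "i3"], rule map_upt_One, rule map_upt_One,
      rule map_upt_Many[where m = "i4"], rule map_upt_One, rule map_upt_One,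
      rule map_upt_Many[where m = "n"], rule map_upt_One, rule map_upt_Nil)
        (use o 6 in \<open>simp_all add: s\<close>)
  qed
qed

section \<open>Parallel columns of \<open>2 \<times> n\<close> matrices\<close>

definition wedge :: "real vec \<Rightarrow> real vec \<Rightarrow> real" where
  "wedge v w = v $ 0 * w $ 1 - w $ 0 * v $ 1"

abbreviation span2 :: "real vec set \<Rightarrow> real vec set" where
  "span2 S \<equiv> LinearCombinations.module.span class_ring (module_vec TYPE(real) 2) S"

lemma wedge_simps [simp]: "wedge v v = 0" "wedge (0\<^sub>v 2) v = 0" "wedge v (0\<^sub>v 2) = 0"
  by (simp_all add: wedge_def)

lemma wedge_commute: "wedge v w = - wedge w v"
  by (simp add: wedge_def)

lemma wedge_eq_0_commute: "wedge v w = 0 \<longleftrightarrow> wedge w v = 0"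
  using wedge_commute[of v w] by simp

lemma vec2_eq: "v \<in> carrier_vec 2 \<Longrightarrow> w \<in> carrier_vec 2 \<Longrightarrow> v $ 0 = w $ 0 \<Longrightarrow> v $ 1 = w $ 1 \<Longrightarrow> v = (w :: real vec)"
  by (intro eq_vecI) (auto simp: less_2_cases_iff)

text \<open>The two identities are the coordinates of the linear relation between three vectors of
  the plane. Cancelling a nonzero coordinate of \<open>v\<close> is what makes being parallel
  transitive.\<close>

lemma wedge_trans:
  assumes "v \<in> carrier_vec 2" "v \<noteq> 0\<^sub>v 2" "wedge u v = 0" "wedge v w = 0"
  shows "wedge u w = 0"
proof -
  have "v $ 0 \<noteq> 0 \<or> v $ 1 \<noteq> 0" using assms(1,2) vec2_eq[of v "0\<^sub>v 2"] by auto
  moreover have "v $ 0 * wedge u w = u $ 0 * wedge v w + w $ 0 * wedge u v"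
    "v $ 1 * wedge u w = u $ 1 * wedge v w + w $ 1 * wedge u v"
    by (simp_all add: wedge_def algebra_simps)
  ultimately show ?thesis using assms(3,4) by auto
qed

lemma span2_wedge:
  assumes "S \<subseteq> carrier_vec 2" "v \<in> span2 S" "\<And>s. s \<in> S \<Longrightarrow> wedge w s = 0"
  shows "wedge w v = 0"
proof -
  interpret W: vec_space "TYPE(real)" 2 .
  obtain a B where v: "v = W.lincomb a B" "B \<subseteq> S" using W.in_spanE[OF assms(2)] by blast
  have B: "B \<subseteq> carrier_vec 2" using v(2) assms(1) by blast
  have "wedge w v = w $ 0 * (\<Sum>s\<in>B. a s * s $ 1) - (\<Sum>s\<in>B. a s * s $ 0) * w $ 1"
    unfolding wedge_def v(1) by (simp add: W.lincomb_index B)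
  also have "\<dots> = (\<Sum>s\<in>B. a s * wedge w s)"
    by (simp add: wedge_def sum_distrib_left sum_distrib_right sum_subtractf[symmetric] algebra_simps)
  also have "\<dots> = 0" using assms(3) v(2) by (intro sum.neutral) auto
  finally show ?thesis .
qed

lemma span_pair:
  assumes "S \<subseteq> carrier_vec n" "s \<in> S" "t \<in> S"
  shows "a \<cdot>\<^sub>v s + b \<cdot>\<^sub>v t \<in> LinearCombinations.module.span class_ring (module_vec TYPE(real) n) S"
proof -
  interpret W: vec_space "TYPE(real)" n .
  have "s \<in> W.span S" "t \<in> W.span S" using W.span_mem[of S] assms by auto
  then have "a \<cdot>\<^sub>v s \<in> W.span S" "b \<cdot>\<^sub>v t \<in> W.span S" using W.smult_in_span assms(1) by auto
  then show "a \<cdot>\<^sub>v s + b \<cdot>\<^sub>v t \<in> W.span S" using W.span_add1[of S] assms(1) by auto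
qed

lemma zero_in_span2: "S \<subseteq> carrier_vec 2 \<Longrightarrow> 0\<^sub>v 2 \<in> span2 S"
proof -
  interpret W: vec_space "TYPE(real)" 2 .
  have "W.lincomb (\<lambda>_. 0) {} = 0\<^sub>v 2" by (simp add: W.lincomb_def)
  then show "0\<^sub>v 2 \<in> span2 S" by (intro W.in_spanI[of _ "\<lambda>_. 0" "{}"]) auto
qed

text \<open>Cramer's rule gives the coefficients of \<open>v\<close> in the basis \<open>s\<close>,
  \<open>t\<close>.\<close>

lemma span2_full:
  assumes S: "S \<subseteq> carrier_vec 2" "s \<in> S" "t \<in> S" and st: "wedge s t \<noteq> 0" and v: "v \<in> carrier_vec 2"
  shows "v \<in> span2 S"
proof -
  have [simp]: "s \<in> carrier_vec 2" "t \<in> carrier_vec 2" "dim_vec s = 2" "dim_vec t = 2" using S by auto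
  have "v $ 0 * wedge s t = wedge v t * s $ 0 + wedge s v * t $ 0"
    "v $ 1 * wedge s t = wedge v t * s $ 1 + wedge s v * t $ 1"
    by (simp_all add: wedge_def algebra_simps)
  then have "v $ 0 = wedge v t / wedge s t * s $ 0 + wedge s v / wedge s t * t $ 0"
    "v $ 1 = wedge v t / wedge s t * s $ 1 + wedge s v / wedge s t * t $ 1"
    using st by (simp_all add: field_simps)
  then have "v = (wedge v t / wedge s t) \<cdot>\<^sub>v s + (wedge s v / wedge s t) \<cdot>\<^sub>v t"
    using v by (intro vec2_eq) simp_all
  then show ?thesis using span_pair[OF S] by metis
qed

lemma span2_parallel:
  assumes S: "S \<subseteq> carrier_vec 2" "s \<in> S" and s: "s \<noteq> 0\<^sub>v 2" "wedge s v = 0" and v: "v \<in> carrier_vec 2"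
  shows "v \<in> span2 S"
proof -
  have sc: "s \<in> carrier_vec 2" using S by blast
  have "s $ 0 \<noteq> 0 \<or> s $ 1 \<noteq> 0" using sc s(1) vec2_eq[of s "0\<^sub>v 2"] by auto
  then obtain a where "v = a \<cdot>\<^sub>v s + 0 \<cdot>\<^sub>v s"
  proof
    assume "s $ 0 \<noteq> 0"
    then have "v = (v $ 0 / s $ 0) \<cdot>\<^sub>v s + 0 \<cdot>\<^sub>v s"
      using sc v s(2) by (intro vec2_eq) (auto simp: field_simps wedge_def carrier_vecD)
    then show ?thesis using that by blast
  next
    assume "s $ 1 \<noteq> 0"
    then have "v = (v $ 1 / s $ 1) \<cdot>\<^sub>v s + 0 \<cdot>\<^sub>v s"
      using sc v s(2) by (intro vec2_eq) (auto simp: field_simps wedge_def carrier_vecD)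
    then show ?thesis using that by blast
  qed
  then show ?thesis using span_pair[OF S(1) S(2) S(2)] by metis
qed

section \<open>The first return of a column\<close>

definition cyc_between :: "nat \<Rightarrow> nat \<Rightarrow> nat \<Rightarrow> nat set" where
  "cyc_between n i j = (if i < j then {i<..<j} else {i<..n} \<union> {1..<j})"

lemma residue_simps:
  assumes "j \<in> {1..n}"
  shows "residue n j = j" "residue n (j + n) = j"
proof -
  have j: "j - 1 < n" "j + n - 1 = j - 1 + n" "j - 1 + 1 = j" using assms by auto
  show "residue n j = j" unfolding residue_def mod_less[OF j(1)] by (rule j(3))
  show "residue n (j + n) = j"
    unfolding residue_def j(2) mod_add_self2 mod_less[OF j(1)] by (rule j(3))
qed

lemma cyc_col_image:
  assumes i: "i \<in> {1..n}" and m: "m < n"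
  shows "cyc_col n A ` {i + 1..i + m} = (\<lambda>j. col A (j - 1)) ` ({i<..min n (i + m)} \<union> {1..i + m - n})"
proof -
  have low: "cyc_col n A j = col A (j - 1)" if "j \<in> {1..n}" for j
    using residue_simps[OF that] by (simp add: cyc_col_def)
  have high: "cyc_col n A (j + n) = col A (j - 1)" if "j \<in> {1..n}" for j
    using residue_simps[OF that] by (simp add: cyc_col_def)
  have "{i + 1..i + m} = {i<..min n (i + m)} \<union> (\<lambda>j. j + n) ` {1..i + m - n}"
  proof -
    have "x \<in> {i + 1..i + m} \<longleftrightarrow> x \<in> {i<..min n (i + m)} \<union> (\<lambda>j. j + n) ` {1..i + m - n}" for x
    proof -
    have "x \<in> (\<lambda>j. j + n) ` {1..i + m - n} \<longleftrightarrow> n < x \<and> x \<le> i + m"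
      by (auto intro!: image_eqI[of _ _ "x - n"])
    then show ?thesis using i by auto
    qed
    then show ?thesis by blast
  qed
  then have "cyc_col n A ` {i + 1..i + m} =
      cyc_col n A ` {i<..min n (i + m)} \<union> (\<lambda>j. cyc_col n A (j + n)) ` {1..i + m - n}"
    by (simp only: image_Un image_image)
  also have "cyc_col n A ` {i<..min n (i + m)} = (\<lambda>j. col A (j - 1)) ` {i<..min n (i + m)}"
    using i by (intro image_cong low) auto
  also have "(\<lambda>j. cyc_col n A (j + n)) ` {1..i + m - n} = (\<lambda>j. col A (j - 1)) ` {1..i + m - n}"
    using i m by (intro image_cong high) auto
  finally show ?thesis by (simp add: image_Un)
qed

text \<open>Minimality of the return at \<open>j\<close> means that column \<open>i\<close> lies in
  the span of the columns up to \<open>j\<close>, but not in the span without \<open>j\<close>. In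
  this form no index beyond \<open>n\<close> is left.\<close>

lemma first_return:
  assumes A: "A \<in> carrier_mat 2 n" and i: "i \<in> {1..n}"
  defines "r \<equiv> first_return 2 n A i" and "c \<equiv> \<lambda>j. col A (j - 1)"
  shows "r = i \<Longrightarrow> c i = 0\<^sub>v 2"
    and "residue n r = j \<Longrightarrow> j \<noteq> i \<Longrightarrow>
      c i \<in> span2 (c ` insert j (cyc_between n i j)) \<and> c i \<notin> span2 (c ` cyc_between n i j)"
proof -
  have c: "c k \<in> carrier_vec 2" for k using A by (intro carrier_vecI) (simp add: c_def)
  have cc: "cyc_col n A k \<in> carrier_vec 2" for k using A by (intro carrier_vecI) (simp add: cyc_col_def)
  define Q where "Q k \<longleftrightarrow> i \<le> k \<and> cyc_col n A i \<in> span2 (cyc_col n A ` {i + 1..k})" for k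
  have r: "r = (LEAST k. Q k)" by (simp add: r_def first_return_def Q_def)
  have ci: "cyc_col n A i = c i" using residue_simps[OF i] by (simp add: cyc_col_def c_def)
  interpret W: vec_space "TYPE(real)" 2 .
  \<comment> \<open>After a full turn column \<open>i\<close> itself appears, so the minimum exists
    and is at most \<open>i + n\<close>.\<close>
  have "cyc_col n A (i + n) = c i" using residue_simps[OF i] by (simp add: cyc_col_def c_def)
  moreover have "i + n \<in> {i + 1..i + n}" using i by auto
  ultimately have "c i \<in> cyc_col n A ` {i + 1..i + n}" by (metis image_eqI)
  moreover have "cyc_col n A ` {i + 1..i + n} \<subseteq> carrier_vec 2" using cc by auto
  ultimately have "c i \<in> span2 (cyc_col n A ` {i + 1..i + n})" using W.span_mem by simp
  then have Qn: "Q (i + n)" by (simp add: Q_def ci)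
  then have Qr: "Q r" and r_le: "r \<le> i + n" unfolding r by (auto intro: LeastI Least_le)
  have Q_less: "\<not> Q k" if "k < r" for k using that not_less_Least unfolding r by blast
  show "c i = 0\<^sub>v 2" if "r = i"
  proof -
    have "c i \<in> span2 {}" using Qr that by (simp add: Q_def ci)
    then have w: "wedge w (c i) = 0" for w using span2_wedge[of "{}"] by auto
    have "wedge (unit_vec 2 0) (c i) = 0" "wedge (unit_vec 2 1) (c i) = 0" using w by blast+
    then show ?thesis using c by (intro vec2_eq) (auto simp: wedge_def)
  qed
  show "c i \<in> span2 (c ` insert j (cyc_between n i j)) \<and> c i \<notin> span2 (c ` cyc_between n i j)"
    if j: "residue n r = j" "j \<noteq> i"
  proof -
    have "i \<le> r" using Qr by (simp add: Q_def)
    moreover have "r \<noteq> i" "r \<noteq> i + n" using j residue_simps[OF i] by auto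
    ultimately have ir: "i < r" "r < i + n" using r_le by auto
    have rj: "r = (if i < j then j else j + n)" and j1: "j \<in> {1..n}"
    proof -
      have "(r - 1) mod n < n" using i by (intro mod_less_divisor) auto
      then show "j \<in> {1..n}" using j(1) by (auto simp: residue_def)
      show "r = (if i < j then j else j + n)"
      proof (cases "r \<le> n")
        case True
        then have "j = r" using j residue_simps(1)[of r n] ir i by auto
        then show ?thesis using ir by simp
      next
        case False
        define t where "t = r - n"
        have t: "r = t + n" "1 \<le> t" "t < i" using False ir by (auto simp: t_def)
        then have "j = t" using j residue_simps(2)[of t n] i by auto
        then show ?thesis using t by simp
      qed
    qed
    have im: "cyc_col n A ` {i + 1..r} = c ` insert j (cyc_between n i j)"
    proof -
      have "{i<..min n r} \<union> {1..r - n} = insert j (cyc_between n i j)"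
        using rj j1 j(2) i by (auto simp: cyc_between_def)
      then show ?thesis using cyc_col_image[OF i, of "r - i" A] ir by (simp add: c_def)
    qed
    have im': "cyc_col n A ` {i + 1..r - 1} = c ` cyc_between n i j"
    proof -
      have "{i<..min n (r - 1)} \<union> {1..r - 1 - n} = cyc_between n i j"
        using rj j1 j(2) i by (auto simp: cyc_between_def)
      then show ?thesis using cyc_col_image[OF i, of "r - 1 - i" A] ir by (simp add: c_def)
    qed
    have "\<not> Q (r - 1)" using Q_less ir by auto
    then show ?thesis using Qr ir im im' unfolding Q_def ci by auto
  qed
qed

section \<open>Parallel classes determined by the permutation\<close>

lemma subst_eq:
  "distinct (map fst ps) \<Longrightarrow> (x, y) \<in> set ps \<Longrightarrow> subst ps x = y"
proof (induction ps)
  case (Cons p ps)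
  then show ?case by (cases p) force
qed simp

lemma fst_path_to: "map fst (path_to g y) = g"
  by (induction g y rule: path_to.induct) auto

lemma fst_class_pairs: "map fst (class_pairs gs) = concat gs"
proof -
  have "map fst (concat (map2 (\<lambda>g h. path_to g (hd h)) gs hs)) = concat gs" if "length hs = length gs" for hs
    using that by (induction gs hs rule: list_induct2') (auto simp: fst_path_to)
  from this[of "drop 2 gs @ take 2 gs"] show ?thesis by (simp add: class_pairs_def)
qed

lemma path_to_next: "k + 1 < length g \<Longrightarrow> (g ! k, g ! (k + 1)) \<in> set (path_to g y)"
proof (induction g y arbitrary: k rule: path_to.induct)
  case (3 a b as y)
  then show ?case by (cases k) auto
qed auto

lemma path_to_last: "g \<noteq> [] \<Longrightarrow> (last g, y) \<in> set (path_to g y)"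
  by (induction g y rule: path_to.induct) auto

lemma class_pairs_mem:
  assumes "s < length gs" "2 \<le> length gs" "p \<in> set (path_to (gs ! s) (hd (gs ! ((s + 2) mod length gs))))"
  shows "p \<in> set (class_pairs gs)"
proof -
  let ?hs = "drop 2 gs @ take 2 gs"
  have "?hs ! s = gs ! ((s + 2) mod length gs)"
  proof (cases "s < length gs - 2")
    case True
    then show ?thesis by (simp add: nth_append add.commute)
  next
    case False
    then have "s + 2 = (s + 2 - length gs) + length gs" "s + 2 - length gs < length gs" "s + 2 - length gs < 2"
      using assms by auto
    then have "(s + 2) mod length gs = s + 2 - length gs" by (metis mod_add_self2 mod_less)
    then show ?thesis using False assms(1,2) by (simp add: nth_append)
  qed
  moreover have "s < length (zip gs ?hs)" using assms by simp
  ultimately have "(gs ! s, gs ! ((s + 2) mod length gs)) \<in> set (zip gs ?hs)"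
    by (metis nth_mem nth_zip length_zip min_less_iff_conj)
  then show ?thesis using assms(3) unfolding class_pairs_def by force
qed

text \<open>The columns of an arbitrary representative, whose minors may have any sign. Its
  permutation determines what is parallel within a class and between cyclically neighbouring
  classes.\<close>

locale class_columns =
  fixes n :: nat and c :: "nat \<Rightarrow> real vec" and gs
  assumes carrier: "\<And>j. c j \<in> carrier_vec 2"
    and sorted: "sorted_wrt (<) (concat gs)" and range: "set (concat gs) \<subseteq> {1..n}"
    and nonempty: "[] \<notin> set gs" and three: "3 \<le> length gs"
    and zero: "\<And>j. j \<in> {1..n} \<Longrightarrow> j \<notin> set (concat gs) \<Longrightarrow> c j = 0\<^sub>v 2"
    and return: "\<And>i. i \<in> set (concat gs) \<Longrightarrow>
      c i \<in> span2 (c ` insert (subst (class_pairs gs) i) (cyc_between n i (subst (class_pairs gs) i))) \<and>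
      c i \<notin> span2 (c ` cyc_between n i (subst (class_pairs gs) i))"
begin

lemma image_carrier: "c ` J \<subseteq> carrier_vec 2"
  using carrier by blast

lemma between_range: "j \<in> {1..n} \<Longrightarrow> cyc_between n i j \<subseteq> {1..n}"
  by (auto simp: cyc_between_def)

lemma nonzero: "i \<in> set (concat gs) \<Longrightarrow> c i \<noteq> 0\<^sub>v 2"
  using return zero_in_span2[OF image_carrier] by metis

lemma step:
  assumes i: "i \<in> set (concat gs)" and j: "subst (class_pairs gs) i = j" "j \<in> {1..n}"
    and "\<And>m. m \<in> cyc_between n i j \<Longrightarrow> m \<notin> set (concat gs)"
  shows "wedge (c i) (c j) = 0"
proof -
  have "c m = 0\<^sub>v 2" if "m \<in> cyc_between n i j" for m
    using that assms(4) zero between_range[OF j(2)] by blast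
  then have "wedge (c j) s = 0" if "s \<in> c ` insert j (cyc_between n i j)" for s using that by auto
  then have "wedge (c j) (c i) = 0" using span2_wedge[OF image_carrier] return[OF i] j(1) by blast
  then show ?thesis using wedge_eq_0_commute by blast
qed

text \<open>If column \<open>m\<close> were parallel to column \<open>i\<close>, the latter would
  lie in the span before \<open>j\<close> is reached. All columns in between are parallel to column
  \<open>m\<close>, since two independent ones would span the plane; so column \<open>j\<close> has
  to contribute a new direction.\<close>

lemma jump:
  assumes i: "i \<in> set (concat gs)" and j: "subst (class_pairs gs) i = j"
    and m: "m \<in> cyc_between n i j" "m \<in> set (concat gs)"
  shows "wedge (c i) (c m) \<noteq> 0" "wedge (c m) (c j) \<noteq> 0"
proof -
  have notin: "c i \<notin> span2 (c ` cyc_between n i j)" using return[OF i] j by simp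
  have mi: "wedge (c m) (c i) \<noteq> 0"
    using span2_parallel[OF image_carrier, of "c m" "cyc_between n i j" "c i"] notin nonzero[OF m(2)] carrier m(1)
    by blast
  then show "wedge (c i) (c m) \<noteq> 0" using wedge_eq_0_commute by blast
  show "wedge (c m) (c j) \<noteq> 0"
  proof
    assume mj: "wedge (c m) (c j) = 0"
    have "wedge (c m) (c p) = 0" if "p \<in> cyc_between n i j" for p
      using span2_full[OF image_carrier, of "c m" "cyc_between n i j" "c p" "c i"] notin carrier m(1) that by blast
    then have "wedge (c m) s = 0" if "s \<in> c ` insert j (cyc_between n i j)" for s using that mj by blast
    then have "wedge (c m) (c i) = 0" using span2_wedge[OF image_carrier] return[OF i] j by blast
    then show False using mi by simp
  qed
qed

lemma less_of_class:
  assumes "s < t" "t < length gs" "a \<in> set (gs ! s)" "b \<in> set (gs ! t)"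
  shows "a < b"
proof -
  have "concat gs = concat (take t gs) @ concat (drop t gs)"
    by (metis append_take_drop_id concat_append)
  then have "\<forall>x\<in>set (concat (take t gs)). \<forall>y\<in>set (concat (drop t gs)). x < y"
    using sorted by (metis sorted_wrt_append)
  moreover have "gs ! s \<in> set (take t gs)" "gs ! t \<in> set (drop t gs)"
    using assms nth_mem[of s "take t gs"] nth_mem[of 0 "drop t gs"] by simp_all
  ultimately show ?thesis using assms by auto
qed

lemma sorted_class:
  assumes "s < length gs"
  shows "sorted_wrt (<) (gs ! s)"
proof -
  have "concat gs = concat (take s gs) @ gs ! s @ concat (drop (Suc s) gs)"
    by (subst id_take_nth_drop[OF assms]) simp
  then show ?thesis using sorted by (metis sorted_wrt_append)
qed

lemma mem_concat: "s < length gs \<Longrightarrow> a \<in> set (gs ! s) \<Longrightarrow> a \<in> set (concat gs)"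
  by auto

lemma class_of: "a \<in> set (concat gs) \<Longrightarrow> \<exists>s<length gs. a \<in> set (gs ! s)"
proof -
  assume "a \<in> set (concat gs)"
  then obtain g where "g \<in> set gs" "a \<in> set g" by auto
  then show ?thesis by (metis in_set_conv_nth)
qed

lemma subst_pair: "(x, y) \<in> set (class_pairs gs) \<Longrightarrow> subst (class_pairs gs) x = y"
  using sorted by (intro subst_eq) (simp add: fst_class_pairs strict_sorted_iff)

text \<open>Between consecutive members of a class there are only zero columns, so a return is
  possible only along a parallel vector. Transitivity applies since the members are nonzero.\<close>

lemma same_class:
  assumes s: "s < length gs" and a: "a \<in> set (gs ! s)" and b: "b \<in> set (gs ! s)"
  shows "wedge (c a) (c b) = 0"
proof -
  let ?g = "gs ! s"
  have g: "k < length ?g \<Longrightarrow> ?g ! k \<in> set (concat gs)" for k using mem_concat[OF s] by simp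
  have srt: "k < l \<Longrightarrow> l < length ?g \<Longrightarrow> ?g ! k < ?g ! l" for k l
    using sorted_class[OF s] sorted_wrt_nth_less by blast
  have next0: "wedge (c (?g ! k)) (c (?g ! (k + 1))) = 0" if k: "k + 1 < length ?g" for k
  proof (rule step)
    show "?g ! k \<in> set (concat gs)" using g k by simp
    show "subst (class_pairs gs) (?g ! k) = ?g ! (k + 1)"
      using subst_pair class_pairs_mem[OF s] path_to_next[OF k] three by simp
    show "?g ! (k + 1) \<in> {1..n}" using g[OF k] range by blast
    fix m assume "m \<in> cyc_between n (?g ! k) (?g ! (k + 1))"
    then have m: "?g ! k < m" "m < ?g ! (k + 1)" using srt[of k "k + 1"] k by (auto simp: cyc_between_def)
    show "m \<notin> set (concat gs)"
    proof
      assume "m \<in> set (concat gs)"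
      then obtain t where t: "t < length gs" "m \<in> set (gs ! t)" using class_of by blast
      have "\<not> t < s" using less_of_class[of t s m "?g ! k"] s t m(1) k by auto
      moreover have "\<not> s < t" using less_of_class[of s t "?g ! (k + 1)" m] t m(2) k by auto
      ultimately have "m \<in> set ?g" using t by auto
      then obtain l where l: "l < length ?g" "m = ?g ! l" by (metis in_set_conv_nth)
      have "\<not> l \<le> k" using srt[of l k] l m(1) k by (cases "l = k") auto
      moreover have "\<not> k + 1 \<le> l" using srt[of "k + 1" l] l m(2) by (cases "l = k + 1") auto
      ultimately show False by simp
    qed
  qed
  have first: "wedge (c (?g ! 0)) (c (?g ! k)) = 0" if "k < length ?g" for k
    using that
  proof (induction k)
    case (Suc k)
    then have k: "k < length ?g" "k + 1 < length ?g" by simp_all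
    from wedge_trans[OF carrier nonzero[OF g[OF k(1)]] Suc.IH[OF k(1)] next0[OF k(2)]]
    show ?case by simp
  qed simp
  obtain k where k: "k < length ?g" "a = ?g ! k" using a by (metis in_set_conv_nth)
  obtain l where l: "l < length ?g" "b = ?g ! l" using b by (metis in_set_conv_nth)
  have "wedge (c a) (c (?g ! 0)) = 0" using first[OF k(1)] wedge_eq_0_commute k(2) by blast
  from wedge_trans[OF carrier nonzero[OF g[of 0]] this first[OF l(1)]] l show ?thesis by force
qed

text \<open>The last member of class \<open>s\<close> returns at the first member of class
  \<open>s + 2\<close>, and class \<open>s + 1\<close> lies strictly between them. With at least
  three classes this remains true around the end of the list.\<close>

lemma adjacent_classes:
  assumes s: "s < length gs" and a: "a \<in> set (gs ! s)" and b: "b \<in> set (gs ! ((s + 1) mod length gs))"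
  shows "wedge (c a) (c b) \<noteq> 0"
proof -
  let ?m = "length gs"
  define t where "t = (s + 1) mod ?m"
  define u where "u = (s + 2) mod ?m"
  have "0 < ?m" using three by linarith
  then have t: "t < ?m" and u: "u < ?m" unfolding t_def u_def by (rule mod_less_divisor)+
  have ne: "gs ! k \<noteq> []" if "k < ?m" for k using nonempty that by (metis nth_mem)
  let ?i = "last (gs ! s)" and ?j = "hd (gs ! u)"
  have i: "?i \<in> set (gs ! s)" and j: "?j \<in> set (gs ! u)" using ne s u by auto
  have sub: "subst (class_pairs gs) ?i = ?j"
    using subst_pair class_pairs_mem[OF s] path_to_last[OF ne[OF s]] three unfolding u_def by simp
  have b': "b \<in> set (gs ! t)" using b by (simp add: t_def)
  have br: "b \<in> {1..n}" using mem_concat[OF t b'] range by blast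
  consider "s + 2 < ?m" | "s + 2 = ?m" | "s + 1 = ?m" using s by linarith
  then have "b \<in> cyc_between n ?i ?j"
  proof cases
    case 1
    then have tu: "t = s + 1" "u = s + 2" by (simp_all add: t_def u_def)
    have "?i < b" "b < ?j" using less_of_class[of s t ?i b] less_of_class[of t u b ?j] i j b' t u tu by auto
    then show ?thesis by (simp add: cyc_between_def)
  next
    case 2
    then have "s + 1 < ?m" by linarith
    then have tu: "t = s + 1" "u = 0" unfolding t_def u_def 2 by simp_all
    have "?i < b" "?j < ?i" using less_of_class[of s t ?i b] less_of_class[of u s ?j ?i] i j b' t u tu 2 three by auto
    then show ?thesis using br by (simp add: cyc_between_def)
  next
    case 3
    have m: "s + 2 = 1 + ?m" "1 < ?m" using 3 three by linarith+
    have tu: "t = 0" "u = 1" unfolding t_def u_def 3 m(1) mod_add_self2 mod_less[OF m(2)] by simp_all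
    have "b < ?j" "?j < ?i" using less_of_class[of t u b ?j] less_of_class[of u s ?j ?i] i j b' t u tu 3 three by auto
    then show ?thesis using br by (simp add: cyc_between_def)
  qed
  then have ib: "wedge (c ?i) (c b) \<noteq> 0"
    using jump(1)[OF mem_concat[OF s i] sub _ mem_concat[OF t b']] by simp
  have "wedge (c ?i) (c a) = 0" using same_class[OF s i a] .
  then show ?thesis
    using ib wedge_trans[OF carrier nonzero[OF mem_concat[OF s a]]] by blast
qed

end

text \<open>In a totally nonnegative matrix also columns of distant classes are not parallel, by the
  Pluecker relation.\<close>

locale nonneg_class_columns = class_columns +
  fixes w :: "nat \<Rightarrow> real vec" and \<kappa> :: real
  assumes proportional: "\<And>a b. wedge (c a) (c b) = \<kappa> * wedge (w a) (w b)"
    and nonneg: "\<And>a b. a \<in> {1..n} \<Longrightarrow> b \<in> {1..n} \<Longrightarrow> a < b \<Longrightarrow> 0 \<le> wedge (w a) (w b)"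
begin

lemma kappa: "\<kappa> \<noteq> 0"
proof -
  have l: "0 < length gs" "1 < length gs" using three by linarith+
  then have "gs ! 0 \<in> set gs" "gs ! 1 \<in> set gs" using nth_mem by blast+
  then have "gs ! 0 \<noteq> []" "gs ! 1 \<noteq> []" using nonempty by metis+
  then have "wedge (c (hd (gs ! 0))) (c (hd (gs ! 1))) \<noteq> 0"
    using l by (intro adjacent_classes[of 0]) auto
  then show ?thesis using proportional by auto
qed

lemma wedge_w_0: "wedge (w a) (w b) = 0 \<longleftrightarrow> wedge (c a) (c b) = 0"
  using proportional kappa by simp

text \<open>By the three-term Pluecker relation the product of the two crossing minors is a sum of
  nonnegative terms, one of which is positive by assumption. So neither factor vanishes.\<close>

lemma crossing:
  assumes "{p, q, r, s} \<subseteq> {1..n}" "p < q" "q < r" "r < s"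
    and "wedge (w p) (w q) \<noteq> 0 \<and> wedge (w r) (w s) \<noteq> 0 \<or> wedge (w p) (w s) \<noteq> 0 \<and> wedge (w q) (w r) \<noteq> 0"
  shows "wedge (w p) (w r) \<noteq> 0" "wedge (w q) (w s) \<noteq> 0"
proof -
  have nn: "0 \<le> wedge (w p) (w q)" "0 \<le> wedge (w r) (w s)" "0 \<le> wedge (w p) (w s)" "0 \<le> wedge (w q) (w r)"
    using nonneg assms(1-4) by auto
  have "wedge (w p) (w r) * wedge (w q) (w s) =
      wedge (w p) (w q) * wedge (w r) (w s) + wedge (w p) (w s) * wedge (w q) (w r)"
    by (simp add: wedge_def algebra_simps)
  moreover have "0 < wedge (w p) (w q) * wedge (w r) (w s) + wedge (w p) (w s) * wedge (w q) (w r)"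
    using assms(5) nn by (metis add_nonneg_pos add_pos_nonneg less_eq_real_def mult_nonneg_nonneg mult_pos_pos)
  ultimately show "wedge (w p) (w r) \<noteq> 0" "wedge (w q) (w s) \<noteq> 0" by auto
qed

text \<open>Classes that are not cyclic neighbours are compared by \<open>crossing\<close>, with
  auxiliary columns chosen such that \<open>a\<close> and \<open>b\<close> cross them: from the
  classes following those of \<open>a\<close> and \<open>b\<close>, or, if \<open>t\<close> is the
  last class, from the first class and the one following \<open>s\<close>.\<close>

lemma different_classes:
  assumes st: "s < t" "t < length gs" and a: "a \<in> set (gs ! s)" and b: "b \<in> set (gs ! t)"
  shows "0 < wedge (w a) (w b)"
proof -
  let ?m = "length gs"
  have ne: "gs ! k \<noteq> []" if "k < ?m" for k using nonempty that by (metis nth_mem)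
  have mem: "hd (gs ! k) \<in> set (gs ! k)" if "k < ?m" for k using ne[OF that] by simp
  have rng: "x \<in> {1..n}" if "k < ?m" "x \<in> set (gs ! k)" for x k
    using mem_concat[OF that] range by blast
  have s: "s < ?m" using st by simp
  have ab: "a < b" using less_of_class[OF st a b] .
  have adj: "wedge (w x) (w y) \<noteq> 0" if "k < ?m" "x \<in> set (gs ! k)" "y \<in> set (gs ! ((k + 1) mod ?m))" for x y k
    using adjacent_classes[OF that] wedge_w_0 by simp
  have "wedge (w a) (w b) \<noteq> 0"
  proof -
    consider "t = s + 1" | "s + 1 < t" "t + 1 < ?m" | "s + 1 < t" "t + 1 = ?m" "0 < s" | "t + 1 = ?m" "s = 0"
      using st by linarith
    then show ?thesis
    proof cases
      case 1
      then show ?thesis using adj[of s a b] a b st by simp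
    next
      case 2
      let ?x = "hd (gs ! (s + 1))" and ?y = "hd (gs ! (t + 1))"
      have x: "?x \<in> set (gs ! (s + 1))" and y: "?y \<in> set (gs ! (t + 1))" using mem 2 by auto
      have "wedge (w a) (w ?x) \<noteq> 0" "wedge (w b) (w ?y) \<noteq> 0"
        using adj[of s a ?x] adj[of t b ?y] a b x y 2 st by auto
      moreover have "a < ?x" "?x < b" "b < ?y"
        using less_of_class[of s "s + 1" a ?x] less_of_class[of "s + 1" t ?x b] less_of_class[of t "t + 1" b ?y]
          a b x y 2 by auto
      moreover have "{a, ?x, b, ?y} \<subseteq> {1..n}"
        using rng[OF _ x] rng[OF _ y] rng[OF s a] rng[OF st(2) b] 2 by simp
      ultimately show ?thesis using crossing(1)[of a ?x b ?y] by blast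
    next
      case 3
      let ?x = "hd (gs ! 0)" and ?y = "hd (gs ! (s + 1))"
      have "0 < ?m" "s + 1 < ?m" using st 3 by linarith+
      then have x: "?x \<in> set (gs ! 0)" and y: "?y \<in> set (gs ! (s + 1))" using mem by blast+
      have "wedge (w b) (w ?x) \<noteq> 0" "wedge (w a) (w ?y) \<noteq> 0"
        using adj[of t b ?x] adj[of s a ?y] a b x y 3 st by auto
      then have "wedge (w ?x) (w b) \<noteq> 0" "wedge (w a) (w ?y) \<noteq> 0" using wedge_eq_0_commute by blast+
      moreover have "?x < a" "a < ?y" "?y < b"
        using less_of_class[of 0 s ?x a] less_of_class[of s "s + 1" a ?y] less_of_class[of "s + 1" t ?y b]
          a b x y 3 st by auto
      moreover have "{?x, a, ?y, b} \<subseteq> {1..n}"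
        using rng[OF _ x] rng[OF _ y] rng[OF s a] rng[OF st(2) b] 3 \<open>0 < ?m\<close> by simp
      ultimately show ?thesis using crossing(2)[of ?x a ?y b] by blast
    next
      case 4
      then have "wedge (w b) (w a) \<noteq> 0" using adj[of t b a] a b st by simp
      then show ?thesis using wedge_eq_0_commute by blast
    qed
  qed
  moreover have "0 \<le> wedge (w a) (w b)" using nonneg[OF rng[OF s a] rng[OF st(2) b] ab] .
  ultimately show ?thesis by simp
qed

lemma wedge_cases:
  assumes "a \<in> {1..n}" "b \<in> {1..n}" "a < b"
  shows "sgn (wedge (w a) (w b)) =
    (if {a, b} \<subseteq> set (concat gs) \<and> \<not> (\<exists>g\<in>set gs. a \<in> set g \<and> b \<in> set g) then 1 else 0)"
proof (cases "{a, b} \<subseteq> set (concat gs)")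
  case False
  then have "wedge (c a) (c b) = 0" using zero[OF assms(1)] zero[OF assms(2)] by fastforce
  then have "sgn (wedge (w a) (w b)) = 0" using wedge_w_0[of a b] by simp
  then show ?thesis using False by (simp only: simp_thms if_False)
next
  case True
  then obtain s where s: "s < length gs" "a \<in> set (gs ! s)" using class_of[of a] by blast
  from True obtain t where t: "t < length gs" "b \<in> set (gs ! t)" using class_of[of b] by blast
  have st: "s \<le> t" using less_of_class[of t s b a] s t assms(3) by (meson linorder_not_le order_less_asym)
  have iff: "(\<exists>g\<in>set gs. a \<in> set g \<and> b \<in> set g) \<longleftrightarrow> s = t"
  proof
    assume "\<exists>g\<in>set gs. a \<in> set g \<and> b \<in> set g"
    then obtain k where k: "k < length gs" "a \<in> set (gs ! k)" "b \<in> set (gs ! k)" by (metis in_set_conv_nth)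
    have "k = s" using less_of_class[of k s a a] less_of_class[of s k a a] k s by (cases k s rule: linorder_cases) auto
    moreover have "k = t" using less_of_class[of k t b b] less_of_class[of t k b b] k t by (cases k t rule: linorder_cases) auto
    ultimately show "s = t" by simp
  next
    assume "s = t"
    then show "\<exists>g\<in>set gs. a \<in> set g \<and> b \<in> set g" using s t by (intro bexI[of _ "gs ! s"]) auto
  qed
  show ?thesis
  proof (cases "s = t")
    case eq: True
    then have "wedge (w a) (w b) = 0" using same_class[OF s(1,2)] t wedge_w_0 by simp
    then show ?thesis using iff eq by simp
  next
    case False
    then have "0 < wedge (w a) (w b)" using different_classes[of s t a b] st s t by simp
    then show ?thesis using True iff False by simp
  qed
qed

end

section \<open>Minors, row spaces and changes of basis\<close>

lemma det_2:
  assumes A: "A \<in> carrier_mat 2 2"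
  shows "det A = A $$ (0, 0) * A $$ (1, 1) - A $$ (0, 1) * A $$ (1, 0 :: nat)"
proof -
  have c: "mat_delete A i 0 \<in> carrier_mat 1 1" for i
    using A by (simp add: mat_delete_def)
  have "det A = (\<Sum>i<2. A $$ (i, 0) * cofactor A i 0)"
    by (rule laplace_expansion_column[OF A]) simp
  also have "\<dots> = A $$ (0, 0) * cofactor A 0 0 + A $$ (1, 0) * cofactor A 1 0"
    by (simp add: numeral_2_eq_2)
  also have "cofactor A 0 0 = A $$ (1, 1)"
    using A by (simp add: cofactor_def det_single[OF c]) (simp add: mat_delete_def)
  also have "cofactor A 1 0 = - A $$ (0, 1)"
    using A det_single[OF c[of 1]] by (simp add: cofactor_def) (simp add: mat_delete_def)
  finally show ?thesis by simp
qed

lemma minor_wedge: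
  assumes A: "A \<in> carrier_mat 2 n" and pq: "p < q" "q < n"
  shows "det (submatrix A UNIV {p, q}) = wedge (col A p) (col A q)"
proof -
  let ?B = "submatrix A UNIV {p, q}"
  have "{j. j < n \<and> j \<in> {p, q}} = {p, q}" using pq by auto
  then have B: "?B \<in> carrier_mat 2 2"
    using A pq by (intro carrier_matI) (auto simp: dim_submatrix)
  have p: "card {a \<in> {p, q}. a < p} = 0" and q: "card {a \<in> {p, q}. a < q} = 1"
  proof -
    have "{a \<in> {p, q}. a < p} = {}" "{a \<in> {p, q}. a < q} = {p}" using pq by auto
    then show "card {a \<in> {p, q}. a < p} = 0" "card {a \<in> {p, q}. a < q} = 1" by simp_all
  qed
  have i: "card {a \<in> UNIV. a < i} = i" for i :: nat by simp
  have "?B $$ (i, 0) = A $$ (i, p)" "?B $$ (i, 1) = A $$ (i, q)" if "i < 2" for i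
    using submatrix_index_card[of i A p UNIV "{p, q}"] submatrix_index_card[of i A q UNIV "{p, q}"]
      that A pq unfolding p q i by auto
  then show ?thesis using A pq unfolding det_2[OF B] wedge_def by simp
qed

text \<open>The rows of \<open>A\<close> are combinations of those of \<open>A'\<close>. The
  determinant of the coefficients is the common factor of all minors.\<close>

lemma row_space_wedge:
  assumes A: "A \<in> carrier_mat 2 n" "A' \<in> carrier_mat 2 n"
    and eq: "vec_space.row_space n A = vec_space.row_space n A'"
  shows "\<exists>\<kappa>. \<forall>a<n. \<forall>b<n. wedge (col A a) (col A b) = \<kappa> * wedge (col A' a) (col A' b)"
proof -
  interpret W: vec_space "TYPE(real)" n .
  have "\<exists>y\<in>carrier_vec 2. \<forall>j<n. A $$ (i, j) = y $ 0 * A' $$ (0, j) + y $ 1 * A' $$ (1, j)" if i: "i < 2" for i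
  proof -
    have "row A i \<in> set (rows A)" using A i by (auto simp: rows_def)
    moreover have "set (rows A) \<subseteq> carrier_vec n" using A by (auto simp: rows_def)
    ultimately have "row A i \<in> W.row_space A" unfolding W.row_space_def using W.span_mem by simp
    then obtain y where y: "y \<in> carrier_vec 2" "A'\<^sup>T *\<^sub>v y = row A i"
      using eq W.row_space_eq[OF A(2)] A by auto
    have "A $$ (i, j) = y $ 0 * A' $$ (0, j) + y $ 1 * A' $$ (1, j)" if j: "j < n" for j
    proof -
      have "A $$ (i, j) = (A'\<^sup>T *\<^sub>v y) $ j" using y A i j by simp
      also have "\<dots> = (\<Sum>k\<in>{0..<2}. A' $$ (k, j) * y $ k)"
        using A y(1) j by (auto simp: scalar_prod_def intro!: sum.cong)
      also have "\<dots> = y $ 0 * A' $$ (0, j) + y $ 1 * A' $$ (1, j)"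
        by (simp add: numeral_2_eq_2)
      finally show ?thesis .
    qed
    then show ?thesis using y by blast
  qed
  from this[of 0] this[of 1] obtain y z where
    yz: "\<forall>j<n. A $$ (0, j) = y $ 0 * A' $$ (0, j) + y $ 1 * A' $$ (1, j)"
      "\<forall>j<n. A $$ (1, j) = z $ 0 * A' $$ (0, j) + z $ 1 * A' $$ (1, j)" by auto
  have "wedge (col A a) (col A b) = wedge y z * wedge (col A' a) (col A' b)" if "a < n" "b < n" for a b
    using yz that A by (simp add: wedge_def algebra_simps)
  then show ?thesis by blast
qed

text \<open>The wedges of the columns with a fixed vector form a combination of the two rows. The
  two combinations have the coefficient determinant \<open>\<gamma> * wedge p q\<close>, and the
  inverse matrix recovers the old rows.\<close>

lemma represents_change_basis:
  assumes A: "represents 2 n A V" and \<gamma>: "\<gamma> * wedge p q \<noteq> 0"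
  defines "d \<equiv> vec n (\<lambda>j. wedge (col A j) p)" and "e \<equiv> vec n (\<lambda>j. \<gamma> * wedge (col A j) q)"
  shows "represents 2 n (mat_of_rows n [d, e]) V"
proof -
  interpret W: vec_space "TYPE(real)" n .
  have Ac: "A \<in> carrier_mat 2 n" and V: "V = W.row_space A" using A by (auto simp: represents_def)
  let ?x = "row A 0" and ?y = "row A 1"
  have [simp]: "?x \<in> carrier_vec n" "?y \<in> carrier_vec n" "d \<in> carrier_vec n" "e \<in> carrier_vec n"
    "dim_row A = 2" "dim_col A = n" using Ac by (auto simp: d_def e_def)
  have rA: "set (rows A) = {?x, ?y}" by (auto simp: rows_def numeral_2_eq_2 less_Suc_eq)
  have r: "set (rows (mat_of_rows n [d, e])) = {d, e}" by simp
  have "d = (p $ 1) \<cdot>\<^sub>v ?x + (- p $ 0) \<cdot>\<^sub>v ?y" "e = (\<gamma> * q $ 1) \<cdot>\<^sub>v ?x + (- \<gamma> * q $ 0) \<cdot>\<^sub>v ?y"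
    by (intro eq_vecI; auto simp: d_def e_def wedge_def algebra_simps)+
  moreover have sx: "{?x, ?y} \<subseteq> carrier_vec n" using Ac by (auto intro!: carrier_vecI)
  ultimately have 1: "{d, e} \<subseteq> W.span {?x, ?y}"
    using span_pair[OF sx insertI1, of ?y] by (metis insertCI insert_subset empty_subsetI)
  define \<delta> where "\<delta> = \<gamma> * wedge p q"
  have \<delta>: "\<delta> \<noteq> 0" using \<gamma> by (simp add: \<delta>_def)
  have "?x = (- (\<gamma> * q $ 0) / \<delta>) \<cdot>\<^sub>v d + (p $ 0 / \<delta>) \<cdot>\<^sub>v e"
  proof (rule eq_vecI)
    fix j assume "j < dim_vec ((- (\<gamma> * q $ 0) / \<delta>) \<cdot>\<^sub>v d + (p $ 0 / \<delta>) \<cdot>\<^sub>v e)"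
    then have j: "j < n" by (simp add: e_def)
    have "\<delta> * A $$ (0, j) = - (\<gamma> * q $ 0) * d $ j + p $ 0 * e $ j"
      using j by (simp add: d_def e_def \<delta>_def wedge_def algebra_simps)
    then show "?x $ j = ((- (\<gamma> * q $ 0) / \<delta>) \<cdot>\<^sub>v d + (p $ 0 / \<delta>) \<cdot>\<^sub>v e) $ j"
      using j \<delta> by (simp add: e_def d_def field_simps)
  qed (simp add: e_def)
  moreover have "?y = (- (\<gamma> * q $ 1) / \<delta>) \<cdot>\<^sub>v d + (p $ 1 / \<delta>) \<cdot>\<^sub>v e"
  proof (rule eq_vecI)
    fix j assume "j < dim_vec ((- (\<gamma> * q $ 1) / \<delta>) \<cdot>\<^sub>v d + (p $ 1 / \<delta>) \<cdot>\<^sub>v e)"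
    then have j: "j < n" by (simp add: e_def)
    have "\<delta> * A $$ (1, j) = - (\<gamma> * q $ 1) * d $ j + p $ 1 * e $ j"
      using j by (simp add: d_def e_def \<delta>_def wedge_def algebra_simps)
    then show "?y $ j = ((- (\<gamma> * q $ 1) / \<delta>) \<cdot>\<^sub>v d + (p $ 1 / \<delta>) \<cdot>\<^sub>v e) $ j"
      using j \<delta> by (simp add: e_def d_def field_simps)
  qed (simp add: e_def)
  ultimately have 2: "{?x, ?y} \<subseteq> W.span {d, e}"
    using span_pair[of "{d, e}" n d e] \<open>d \<in> carrier_vec n\<close> \<open>e \<in> carrier_vec n\<close>
    by (metis insertCI insert_subset empty_subsetI)
  have "W.span {?x, ?y} = W.span {d, e}"
    using W.span_subsetI[OF sx 1] W.span_subsetI[OF _ 2] by auto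
  moreover have "mat_of_rows n [d, e] \<in> carrier_mat 2 n" by (intro carrier_matI) simp_all
  ultimately show ?thesis unfolding represents_def V W.row_space_def rA r by simp
qed

lemma lin_indpt_four:
  assumes c: "{d1, d2, d3, d4} \<subseteq> carrier_vec n"
    and ind: "\<And>a1 a2 a3 a4. (\<And>j. j < n \<Longrightarrow> a1 * d1 $ j + a2 * d2 $ j + a3 * d3 $ j + a4 * d4 $ j = 0) \<Longrightarrow>
      a1 = 0 \<and> a2 = 0 \<and> a3 = 0 \<and> a4 = 0"
  shows "lin_indpt_vecs n [d1, d2, d3, d4]"
proof -
  interpret W: vec_space "TYPE(real)" n .
  have ne: "d1 \<noteq> d2" "d1 \<noteq> d3" "d1 \<noteq> d4" "d2 \<noteq> d3" "d2 \<noteq> d4" "d3 \<noteq> d4"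
    using ind[of 1 "-1" 0 0] ind[of 1 0 "-1" 0] ind[of 1 0 0 "-1"] ind[of 0 1 "-1" 0] ind[of 0 1 0 "-1"]
      ind[of 0 0 1 "-1"] by auto
  have "W.lin_indpt (set [d1, d2, d3, d4])"
  proof
    assume "W.lin_dep (set [d1, d2, d3, d4])"
    from W.finite_lin_dep[OF _ this] c obtain a v where
      a: "W.lincomb a (set [d1, d2, d3, d4]) = 0\<^sub>v n" and v: "v \<in> set [d1, d2, d3, d4]" "a v \<noteq> 0"
      by auto
    have "a d1 * d1 $ j + a d2 * d2 $ j + a d3 * d3 $ j + a d4 * d4 $ j = 0" if "j < n" for j
    proof -
      have "W.lincomb a (set [d1, d2, d3, d4]) $ j = (\<Sum>x\<in>set [d1, d2, d3, d4]. a x * x $ j)"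
        using W.lincomb_index[OF that] c by simp
      then show ?thesis using ne that unfolding a by (simp add: add.assoc)
    qed
    then show False using ind[of "a d1" "a d2" "a d3" "a d4"] v by auto
  qed
  then show ?thesis using ne by simp
qed

text \<open>A point of the cell comes with two matrices, one having the prescribed permutation and
  one having nonnegative minors. Their minors are proportional, so the first decides which minors of
  the second vanish; it is the second that is returned.\<close>

lemma cell_columns:
  assumes V: "V \<in> positroid_cell 2 n (\<rho>, {i \<in> {1..n}. \<rho> i = i})"
    and \<rho>: "\<rho> = subst (class_pairs gs)" and moves: "\<forall>i\<in>set (concat gs). \<rho> i \<noteq> i"
    and gs: "sorted_wrt (<) (concat gs)" "set (concat gs) \<subseteq> {1..n}" "[] \<notin> set gs" "3 \<le> length gs"
  shows "\<exists>A. represents 2 n A V \<and> (\<forall>a\<in>{1..n}. \<forall>b\<in>{1..n}. a < b \<longrightarrow>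
    sgn (wedge (col A (a - 1)) (col A (b - 1))) =
    (if {a, b} \<subseteq> set (concat gs) \<and> \<not> (\<exists>g\<in>set gs. a \<in> set g \<and> b \<in> set g) then 1 else 0))"
proof -
  from V obtain A A' where A: "represents 2 n A V" "mat_perm 2 n A = (\<rho>, {i \<in> {1..n}. \<rho> i = i})"
    and A': "represents 2 n A' V" "\<forall>J. J \<subseteq> {0..<n} \<and> card J = 2 \<longrightarrow> det (submatrix A' UNIV J) \<ge> 0"
    unfolding positroid_cell_def nonneg_grassmannian_def by blast
  have Ac: "A \<in> carrier_mat 2 n" and A'c: "A' \<in> carrier_mat 2 n"
    and rs: "vec_space.row_space n A = vec_space.row_space n A'"
    using A(1) A'(1) by (auto simp: represents_def)
  obtain \<kappa> where \<kappa>: "\<forall>a<n. \<forall>b<n. wedge (col A a) (col A b) = \<kappa> * wedge (col A' a) (col A' b)"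
    using row_space_wedge[OF Ac A'c rs] by blast
  \<comment> \<open>Padding with zero vectors makes the dimension and the proportionality of wedges
    hold for all indices.\<close>
  define c where "c j = (if j \<in> {1..n} then col A (j - 1) else 0\<^sub>v 2)" for j
  define w where "w j = (if j \<in> {1..n} then col A' (j - 1) else 0\<^sub>v 2)" for j
  have cim: "(\<lambda>j. col A (j - 1)) ` J = c ` J" if "J \<subseteq> {1..n}" for J
    using that by (intro image_cong) (auto simp: c_def)
  have fr: "residue n (first_return 2 n A i) = \<rho> i" if "i \<in> {1..n}" for i
    using A(2) that by (auto simp: mat_perm_def fun_eq_iff split: if_splits)
  have bl: "first_return 2 n A i = i \<longleftrightarrow> \<rho> i = i" if "i \<in> {1..n}" for i
  proof -
    have "{i \<in> {1..n}. first_return 2 n A i = i} = {i \<in> {1..n}. \<rho> i = i}" using A(2) by (simp add: mat_perm_def)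
    then show ?thesis using that by blast
  qed
  interpret X: nonneg_class_columns n c gs w \<kappa>
  proof
    show "c j \<in> carrier_vec 2" for j using Ac by (auto simp: c_def intro!: carrier_vecI)
    show "sorted_wrt (<) (concat gs)" "set (concat gs) \<subseteq> {1..n}" "[] \<notin> set gs" "3 \<le> length gs"
      using gs .
    show "c j = 0\<^sub>v 2" if j: "j \<in> {1..n}" "j \<notin> set (concat gs)" for j
    proof -
      have "j \<notin> fst ` set (class_pairs gs)" using j(2) fst_class_pairs[of gs] by (metis set_map)
      then have "\<rho> j = j" using subst_other \<rho> by simp
      then show ?thesis using first_return(1)[OF Ac j(1)] bl[OF j(1)] j(1) by (simp add: c_def)
    qed
    show "c i \<in> span2 (c ` insert (subst (class_pairs gs) i) (cyc_between n i (subst (class_pairs gs) i))) \<and>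
      c i \<notin> span2 (c ` cyc_between n i (subst (class_pairs gs) i))" if i: "i \<in> set (concat gs)" for i
    proof -
      have i1: "i \<in> {1..n}" using i gs(2) by blast
      define j where "j = subst (class_pairs gs) i"
      have j: "residue n (first_return 2 n A i) = j" "j \<noteq> i" using fr[OF i1] moves i \<rho> by (auto simp: j_def)
      have jn: "j \<in> {1..n}"
      proof -
        have "(first_return 2 n A i - 1) mod n < n" using i1 by (intro mod_less_divisor) auto
        then show ?thesis using j(1) by (auto simp: residue_def)
      qed
      have J: "cyc_between n i j \<subseteq> {1..n}" "insert j (cyc_between n i j) \<subseteq> {1..n}"
        using jn by (auto simp: cyc_between_def)
      have "c i = col A (i - 1)" using i1 by (simp add: c_def)
      then show ?thesis using first_return(2)[OF Ac i1 j] cim[OF J(1)] cim[OF J(2)] unfolding j_def by simp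
    qed
    show "wedge (c a) (c b) = \<kappa> * wedge (w a) (w b)" for a b
      using \<kappa> by (auto simp: c_def w_def)
    show "0 \<le> wedge (w a) (w b)" if ab: "a \<in> {1..n}" "b \<in> {1..n}" "a < b" for a b
    proof -
      have "{a - 1, b - 1} \<subseteq> {0..<n} \<and> card {a - 1, b - 1} = 2" using ab by auto
      then have "det (submatrix A' UNIV {a - 1, b - 1}) \<ge> 0" using A'(2) by blast
      moreover have "a - 1 < b - 1" "b - 1 < n" using ab by auto
      ultimately show ?thesis using minor_wedge[OF A'c] ab by (simp add: w_def)
    qed
  qed
  show ?thesis using A'(1) X.wedge_cases by (intro exI[of _ A']) (auto simp: w_def)
qed

section \<open>Dominoes\<close>

definition restr :: "nat \<Rightarrow> nat set \<Rightarrow> (nat \<Rightarrow> real) \<Rightarrow> real vec" where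
  "restr n S f = vec n (\<lambda>k. if k + 1 \<in> S then f (k + 1) else 0)"

lemma restr_carrier [simp]: "restr n S f \<in> carrier_vec n"
  by (simp add: restr_def)

lemma coord_restr: "j \<in> {1..n} \<Longrightarrow> coord (restr n S f) j = (if j \<in> S then f j else 0)"
proof -
  assume "j \<in> {1..n}"
  then have "j - 1 < n" "j - 1 + 1 = j" by auto
  then show ?thesis unfolding restr_def coord_def by simp
qed

lemma vec_eq_coord:
  assumes "x \<in> carrier_vec n" "y \<in> carrier_vec n" "\<And>j. j \<in> {1..n} \<Longrightarrow> coord x j = coord y j"
  shows "x = y"
proof (rule eq_vecI)
  fix k assume "k < dim_vec y"
  then show "x $ k = y $ k" using assms(2) assms(3)[of "k + 1"] by (simp add: coord_def)
qed (use assms in simp)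

lemma coord_add:
  "x \<in> carrier_vec n \<Longrightarrow> y \<in> carrier_vec n \<Longrightarrow> j \<in> {1..n} \<Longrightarrow> coord (x + y) j = coord x j + coord y j"
  "x \<in> carrier_vec n \<Longrightarrow> y \<in> carrier_vec n \<Longrightarrow> j \<in> {1..n} \<Longrightarrow> coord (x - y) j = coord x j - coord y j"
  by (auto simp: coord_def)

lemma coord_bar: "j \<in> {1..n} \<Longrightarrow> coord (bar n d) j = (if j = n then 0 else coord d j)"
  by (auto simp: coord_def bar_def)

lemma bar_carrier [simp]: "bar n d \<in> carrier_vec n"
  by (simp add: bar_def)

lemma dominoD:
  assumes "domino n i s v"
  shows "v \<in> carrier_vec n" "i \<in> {1..n}" "s \<in> {1, -1}" "sgn (coord v i) = s"
    "j \<in> {1..n} \<Longrightarrow> j \<noteq> i \<Longrightarrow> j \<noteq> i + 1 \<Longrightarrow> coord v j = 0"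
    "i + 1 \<le> n \<Longrightarrow> sgn (coord v (i + 1)) = s"
    "j \<in> {1..n} \<Longrightarrow> coord v j = 0 \<or> sgn (coord v j) = s"
  using assms unfolding domino_def by (auto split: if_splits)

lemma domino_restr:
  assumes "1 \<le> i" "i + 1 \<le> n" "0 < f i" "0 < f (i + 1)"
  shows "domino n i 1 (restr n {i, i + 1} f)"
  unfolding domino_def using assms by (auto simp: coord_restr)

text \<open>By disjointness of the supports a difference of two dominoes of equal sign has entries
  of both signs. The theorem states an implication for each type with the same indices, so for an
  orthodox vector the deviant type has to be excluded, and vice versa.\<close>

lemma not_deviant:
  assumes "\<And>j. j \<in> {1..n} \<Longrightarrow> j \<noteq> n \<Longrightarrow> 0 \<le> coord d j"
  shows "\<not> deviant n d"
proof
  assume "deviant n d"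
  then obtain x y i j s where x: "domino n i s x" and y: "domino n j s y"
    and disj: "supp n x \<inter> supp n y = {}" and b: "bar n d = x - y" unfolding deviant_def by blast
  have s: "s = 1 \<or> s = -1" using dominoD(3)[OF x] by simp
  have bar: "0 \<le> coord (bar n d) k" if "k \<in> {1..n}" for k using that assms by (simp add: coord_bar)
  have i: "i \<in> {1..n}" and j: "j \<in> {1..n}" using dominoD(2) x y by blast+
  have xi: "coord x i \<noteq> 0" "coord y j \<noteq> 0" using dominoD(4)[OF x] dominoD(4)[OF y] s by auto
  then have "coord y i = 0" "coord x j = 0" using disj i j unfolding supp_def by blast+
  then have "coord (bar n d) i = coord x i" "coord (bar n d) j = - coord y j"
    unfolding b using coord_add(2)[OF dominoD(1)[OF x] dominoD(1)[OF y]] i j by simp_all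
  then have "0 < coord x i" "coord y j < 0" using bar[OF i] bar[OF j] xi by auto
  then show False using dominoD(4)[OF x] dominoD(4)[OF y] by simp
qed

lemma not_orthodox:
  assumes "i \<in> {1..n}" "i \<noteq> n" "0 < coord d i" "j \<in> {1..n}" "j \<noteq> n" "coord d j < 0"
  shows "\<not> orthodox n d"
proof
  assume "orthodox n d"
  then obtain x y k l s where x: "domino n k s x" and y: "domino n l s y" and b: "bar n d = x + y"
    unfolding orthodox_def by blast
  have s: "s = 1 \<or> s = -1" using dominoD(3)[OF x] by simp
  have "0 < coord x i + coord y i" "coord x j + coord y j < 0"
    using assms coord_bar[of i n d] coord_bar[of j n d]
      coord_add(1)[OF dominoD(1)[OF x] dominoD(1)[OF y]] unfolding b by simp_all
  moreover have "coord x i = 0 \<or> sgn (coord x i) = s" "coord y i = 0 \<or> sgn (coord y i) = s"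
    "coord x j = 0 \<or> sgn (coord x j) = s" "coord y j = 0 \<or> sgn (coord y j) = s"
    using dominoD(7)[OF x] dominoD(7)[OF y] assms by blast+
  ultimately show False using s by (auto simp: sgn_if split: if_splits)
qed

text \<open>Elimination by increasing index: at \<open>i1\<close> only \<open>d1\<close> is nonzero,
  and so on. Two dominoes with the same index are the only obstruction, which a nonzero determinant
  of their entries removes.\<close>

lemma dominoes_lin_indpt:
  assumes d: "domino n i1 1 d1" "domino n i2 1 d2" "domino n i3 1 d3" "domino n i4 1 d4"
    and i: "i1 < i2" "i2 \<le> i3" "i3 \<le> i4" "i4 + 1 \<le> n"
    and np2: "i2 = i3 \<Longrightarrow> i3 + 1 < i4 \<and> coord d2 i2 * coord d3 (i2 + 1) \<noteq> coord d2 (i2 + 1) * coord d3 i2"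
    and np3: "i3 = i4 \<Longrightarrow> i2 < i3 \<and> coord d3 i3 * coord d4 (i3 + 1) \<noteq> coord d3 (i3 + 1) * coord d4 i3"
  shows "lin_indpt_vecs n [d1, d2, d3, d4]"
proof (rule lin_indpt_four)
  show "{d1, d2, d3, d4} \<subseteq> carrier_vec n" using d dominoD(1) by blast
  fix a1 a2 a3 a4 :: real
  assume H: "\<And>j. j < n \<Longrightarrow> a1 * d1 $ j + a2 * d2 $ j + a3 * d3 $ j + a4 * d4 $ j = 0"
  have E: "a1 * coord d1 j + a2 * coord d2 j + a3 * coord d3 j + a4 * coord d4 j = 0" if "j \<in> {1..n}" for j
    using that H[of "j - 1"] by (auto simp: coord_def)
  have r: "i1 \<in> {1..n}" "i2 \<in> {1..n}" "i3 \<in> {1..n}" "i4 \<in> {1..n}" using d dominoD(2) by blast+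
  have nz: "coord d1 i1 \<noteq> 0" "coord d2 i2 \<noteq> 0" "coord d3 i3 \<noteq> 0" "coord d4 i4 \<noteq> 0"
    using dominoD(4)[OF d(1)] dominoD(4)[OF d(2)] dominoD(4)[OF d(3)] dominoD(4)[OF d(4)] by auto
  have z: "coord d2 i1 = 0" "coord d3 i1 = 0" "coord d4 i1 = 0"
    using dominoD(5)[OF d(2)] dominoD(5)[OF d(3)] dominoD(5)[OF d(4)] i r by auto
  have two: "x = 0 \<and> y = 0" if "x * p + y * q = 0" "x * p' + y * q' = 0" "p * q' \<noteq> p' * q" for x y p q p' q' :: real
  proof -
    have "x * (p * q' - p' * q) = q' * (x * p + y * q) - q * (x * p' + y * q')"
      "y * (p * q' - p' * q) = p * (x * p' + y * q') - p' * (x * p + y * q)" by (simp_all add: algebra_simps)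
    then have "x * (p * q' - p' * q) = 0" "y * (p * q' - p' * q) = 0" unfolding that(1,2) by simp_all
    then show ?thesis using that(3) by simp
  qed
  have a1: "a1 = 0" using E[OF r(1)] z nz by simp
  have a23: "a2 = 0 \<and> (i2 = i3 \<longrightarrow> a3 = 0)"
  proof (cases "i2 = i3")
    case True
    then have n2: "i3 + 1 < i4" "coord d2 i2 * coord d3 (i2 + 1) \<noteq> coord d2 (i2 + 1) * coord d3 i2"
      using np2 by blast+
    have "coord d4 i2 = 0" "coord d4 (i2 + 1) = 0" "i2 + 1 \<in> {1..n}"
      using dominoD(5)[OF d(4)] r True n2 i by auto
    then show ?thesis using two[OF _ _ n2(2), of a2 a3] E[of i2] E[of "i2 + 1"] a1 r by simp
  next
    case False
    then have "coord d3 i2 = 0" "coord d4 i2 = 0"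
      using dominoD(5)[OF d(3)] dominoD(5)[OF d(4)] i r by auto
    then show ?thesis using E[OF r(2)] a1 nz False by simp
  qed
  have a34: "a3 = 0 \<and> a4 = 0"
  proof (cases "i3 = i4")
    case True
    then have n3: "coord d3 i3 * coord d4 (i3 + 1) \<noteq> coord d3 (i3 + 1) * coord d4 i3" using np3 by blast
    show ?thesis using two[OF _ _ n3, of a3 a4] E[of i3] E[of "i3 + 1"] a1 a23 r i True by simp
  next
    case False
    then have "coord d4 i3 = 0" using dominoD(5)[OF d(4)] i r by auto
    then have a3: "a3 = 0" using E[OF r(3)] a1 a23 nz by simp
    then show ?thesis using E[OF r(4)] a1 a23 nz by simp
  qed
  show "a1 = 0 \<and> a2 = 0 \<and> a3 = 0 \<and> a4 = 0" using a1 a23 a34 by simp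
qed

lemma orthodox_dominoes:
  assumes x: "orthodox_indices i1 i2 i3 i4 n" and de: "d \<in> carrier_vec n" "e \<in> carrier_vec n"
    and sd: "\<And>j. j \<in> {1..n} \<Longrightarrow>
      sgn (coord d j) = (if j \<in> {i1, i1 + 1, i2, i2 + 1} then 1 else if j = n then -1 else 0)"
    and se: "\<And>j. j \<in> {1..n} \<Longrightarrow> sgn (coord e j) = (if j \<in> {i3, i3 + 1, i4, i4 + 1, n} then 1 else 0)"
    and np: "i2 = i3 \<Longrightarrow> coord d i2 * coord e (i2 + 1) \<noteq> coord d (i2 + 1) * coord e i2"
  shows "orthodox n d \<and> \<not> deviant n d \<and>
    (\<exists>d1 d2 d3 d4. domino n i1 1 d1 \<and> domino n i2 1 d2 \<and> domino n i3 1 d3 \<and> domino n i4 1 d4 \<and>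
      lin_indpt_vecs n [d1, d2, d3, d4] \<and> i1 + 1 < i2 \<and> i2 \<le> i3 \<and> i3 < i4 - 1 \<and>
      bar n d = d1 + d2 \<and> coord d n < 0 \<and> bar n e = d3 + d4 \<and> coord e n > 0)"
proof -
  have o: "1 \<le> i1" "i1 + 1 < i2" "i2 \<le> i3" "i3 + 1 < i4" "i4 + 1 < n" using x by (auto simp: orthodox_indices_def)
  define d1 where "d1 = restr n {i1, i1 + 1} (coord d)"
  define d2 where "d2 = restr n {i2, i2 + 1} (coord d)"
  define d3 where "d3 = restr n {i3, i3 + 1} (coord e)"
  define d4 where "d4 = restr n {i4, i4 + 1} (coord e)"
  have pd: "0 < coord d j" if "j \<in> {i1, i1 + 1, i2, i2 + 1}" for j
  proof -
    have "j \<in> {1..n}" using that o by auto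
    then show ?thesis using sd[of j] that by (simp add: sgn_1_pos)
  qed
  have pe: "0 < coord e j" if "j \<in> {i3, i3 + 1, i4, i4 + 1, n}" for j
  proof -
    have "j \<in> {1..n}" using that o by auto
    then show ?thesis using se[of j] that by (simp add: sgn_1_pos)
  qed
  have D: "domino n i1 1 d1" "domino n i2 1 d2" "domino n i3 1 d3" "domino n i4 1 d4"
    unfolding d1_def d2_def d3_def d4_def by (rule domino_restr; use o pd pe in simp)+
  have bd: "bar n d = d1 + d2"
  proof (rule vec_eq_coord)
    fix j assume j: "j \<in> {1..n}"
    have "coord d j = 0" if "j \<notin> {i1, i1 + 1, i2, i2 + 1}" "j \<noteq> n"
      using sd[OF j] that by (simp add: sgn_0_0)
    then show "coord (bar n d) j = coord (d1 + d2) j"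
      using j o coord_add(1)[of d1 n d2 j]
      by (auto simp: d1_def d2_def coord_bar coord_restr)
  qed (simp_all add: d1_def d2_def)
  have be: "bar n e = d3 + d4"
  proof (rule vec_eq_coord)
    fix j assume j: "j \<in> {1..n}"
    have "coord e j = 0" if "j \<notin> {i3, i3 + 1, i4, i4 + 1, n}"
      using se[OF j] that by (simp add: sgn_0_0)
    then show "coord (bar n e) j = coord (d3 + d4) j"
      using j o coord_add(1)[of d3 n d4 j]
      by (auto simp: d3_def d4_def coord_bar coord_restr)
  qed (simp_all add: d3_def d4_def)
  have dn: "coord d n < 0" using sd[of n] o by (auto simp: sgn_if split: if_splits)
  have "supp n d1 \<inter> supp n d2 = {}" using o by (auto simp: supp_def d1_def d2_def coord_restr split: if_splits)
  then have "orthodox n d" unfolding orthodox_def using D(1,2) bd by blast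
  moreover have "\<not> deviant n d"
  proof (rule not_deviant)
    fix j assume j: "j \<in> {1..n}" "j \<noteq> n"
    then show "0 \<le> coord d j" using sd[OF j(1)] by (auto simp: sgn_if split: if_splits)
  qed
  moreover have "lin_indpt_vecs n [d1, d2, d3, d4]"
  proof (rule dominoes_lin_indpt[OF D])
    show "i1 < i2" "i2 \<le> i3" "i3 \<le> i4" "i4 + 1 \<le> n" using o by auto
    show "i3 + 1 < i4 \<and> coord d2 i2 * coord d3 (i2 + 1) \<noteq> coord d2 (i2 + 1) * coord d3 i2" if "i2 = i3"
      using np[OF that] that o by (simp add: d2_def d3_def coord_restr)
    show "i2 < i3 \<and> coord d3 i3 * coord d4 (i3 + 1) \<noteq> coord d3 (i3 + 1) * coord d4 i3" if "i3 = i4"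
      using that o by simp
  qed
  moreover have "i3 < i4 - 1" using o by linarith
  ultimately show ?thesis using D bd be dn pe[of n] o by blast
qed

lemma deviant_dominoes:
  assumes x: "deviant_indices i1 i2 i3 i4 n" and de: "d \<in> carrier_vec n" "e \<in> carrier_vec n"
    and sd: "\<And>j. j \<in> {1..n} \<Longrightarrow>
      sgn (coord d j) = (if j \<in> {i1, i1 + 1} then 1 else if j \<in> {i4, i4 + 1, n} then -1 else 0)"
    and se: "\<And>j. j \<in> {1..n} \<Longrightarrow> sgn (coord e j) = (if j \<in> {i1, i1 + 1, i2, i2 + 1, i3, i3 + 1} then 1 else 0)"
    and eq: "coord e i1 = coord d i1" "i1 + 1 < i2 \<Longrightarrow> coord e (i1 + 1) = coord d (i1 + 1)"
      "i2 = i1 + 1 \<Longrightarrow> coord d (i1 + 1) < coord e (i1 + 1)"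
    and np: "i3 = i4 \<Longrightarrow> coord d i3 * coord e (i3 + 1) \<noteq> coord d (i3 + 1) * coord e i3"
  shows "deviant n d \<and> \<not> orthodox n d \<and>
    (\<exists>d1 d2 d3 d4. domino n i1 1 d1 \<and> domino n i2 1 d2 \<and> domino n i3 1 d3 \<and> domino n i4 1 d4 \<and>
      lin_indpt_vecs n [d1, d2, d3, d4] \<and> i1 + 1 < i2 + 1 \<and> i2 + 1 < i3 \<and> i3 \<le> i4 \<and>
      bar n d = d1 - d4 \<and> coord d n < 0 \<and> e = d1 + d2 + d3 \<and> coord e n = 0)"
proof -
  have o: "1 \<le> i1" "i1 < i2" "i2 + 1 < i3" "i3 \<le> i4" "i4 + 1 < n" using x by (auto simp: deviant_indices_def)
  \<comment> \<open>The second domino is what the first one leaves of \<open>e\<close> at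
    \<open>i2\<close> and \<open>i2 + 1\<close>. They share a column only if
    \<open>i2 = i1 + 1\<close>, and there the entry is positive by the strict inequality between
    \<open>d\<close> and \<open>e\<close>.\<close>
  define f where "f j = (if j \<le> i1 + 1 then coord e j - coord d j else coord e j)" for j
  define d1 where "d1 = restr n {i1, i1 + 1} (coord d)"
  define d2 where "d2 = restr n {i2, i2 + 1} f"
  define d3 where "d3 = restr n {i3, i3 + 1} (coord e)"
  define d4 where "d4 = restr n {i4, i4 + 1} (\<lambda>j. - coord d j)"
  have pd: "0 < coord d j" if "j \<in> {i1, i1 + 1}" for j
  proof -
    have "j \<in> {1..n}" using that o by auto
    then show ?thesis using sd[of j] that by (simp add: sgn_1_pos)
  qed
  have nd: "coord d j < 0" if "j \<in> {i4, i4 + 1, n}" for j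
  proof -
    have "j \<in> {1..n}" "j \<notin> {i1, i1 + 1}" using that o by auto
    then show ?thesis using sd[of j] that by (simp add: sgn_1_neg)
  qed
  have pe: "0 < coord e j" if "j \<in> {i1, i1 + 1, i2, i2 + 1, i3, i3 + 1}" for j
  proof -
    have "j \<in> {1..n}" using that o by auto
    then show ?thesis using se[of j] that by (simp add: sgn_1_pos)
  qed
  have pf: "0 < f i2" "0 < f (i2 + 1)"
    using eq(3) pe[of i2] pe[of "i2 + 1"] o by (cases "i2 = i1 + 1"; simp add: f_def)+
  have D: "domino n i1 1 d1" "domino n i2 1 d2" "domino n i3 1 d3" "domino n i4 1 d4"
    unfolding d1_def d2_def d3_def d4_def by (rule domino_restr; use o pd pe nd pf in simp)+
  have bd: "bar n d = d1 - d4"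
  proof (rule vec_eq_coord)
    fix j assume j: "j \<in> {1..n}"
    have "coord d j = 0" if "j \<notin> {i1, i1 + 1}" "j \<notin> {i4, i4 + 1, n}"
      using sd[OF j] that by (simp add: sgn_0_0)
    then show "coord (bar n d) j = coord (d1 - d4) j"
      using j o coord_add(2)[of d1 n d4 j]
      by (auto simp: d1_def d4_def coord_bar coord_restr)
  qed (simp_all add: d1_def d4_def)
  have e0: "coord e j = 0" if "j \<in> {1..n}" "j \<notin> {i1, i1 + 1, i2, i2 + 1, i3, i3 + 1}" for j
    using se[OF that(1)] that(2) by (simp add: sgn_0_0)
  have ee: "e = d1 + d2 + d3"
  proof (rule vec_eq_coord)
    fix j assume j: "j \<in> {1..n}"
    have "coord (d1 + d2 + d3) j = coord d1 j + coord d2 j + coord d3 j"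
      using coord_add(1)[of "d1 + d2" n d3 j] coord_add(1)[of d1 n d2 j] j
      by (simp add: d1_def d2_def d3_def)
    moreover have "coord e j = coord d1 j + coord d2 j + coord d3 j"
    proof -
      consider "j \<notin> {i1, i1 + 1, i2, i2 + 1, i3, i3 + 1}" | "j = i1" | "j = i1 + 1" "i1 + 1 < i2"
        | "j = i1 + 1" "i2 = i1 + 1" | "j = i2" "i1 + 1 < i2" | "j = i2 + 1" | "j \<in> {i3, i3 + 1}"
        using o(2) by force
      then show ?thesis
        using e0[OF j] j o eq(1,2) by cases (auto simp: d1_def d2_def d3_def coord_restr f_def)
    qed
    ultimately show "coord e j = coord (d1 + d2 + d3) j" by simp
  qed (use de in \<open>simp_all add: d1_def d2_def d3_def\<close>)
  have "supp n d1 \<inter> supp n d4 = {}" using o by (auto simp: supp_def d1_def d4_def coord_restr split: if_splits)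
  then have "deviant n d" unfolding deviant_def using D(1,4) bd by blast
  moreover have "\<not> orthodox n d"
    using not_orthodox[of i1 n d i4] pd[of i1] nd[of i4] o by auto
  moreover have "lin_indpt_vecs n [d1, d2, d3, d4]"
  proof (rule dominoes_lin_indpt[OF D])
    show "i1 < i2" "i2 \<le> i3" "i3 \<le> i4" "i4 + 1 \<le> n" using o by auto
    show "i3 + 1 < i4 \<and> coord d2 i2 * coord d3 (i2 + 1) \<noteq> coord d2 (i2 + 1) * coord d3 i2" if "i2 = i3"
      using that o by simp
    show "i2 < i3 \<and> coord d3 i3 * coord d4 (i3 + 1) \<noteq> coord d3 (i3 + 1) * coord d4 i3" if "i3 = i4"
      using np[OF that] that o by (simp add: d3_def d4_def coord_restr algebra_simps)
  qed
  moreover have "coord e n = 0" using e0[of n] o by auto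
  ultimately show ?thesis using D bd ee nd[of n] o by auto
qed


section \<open>Bases of the cells\<close>

text \<open>The sign of the minor of columns \<open>a < b\<close> at every point of the cell, as a
  function of the classes alone. This separates the case distinction over overlaps from the
  matrices.\<close>

definition generic :: "nat list list \<Rightarrow> nat \<Rightarrow> nat \<Rightarrow> real" where
  "generic gs a b = (if {a, b} \<subseteq> set (concat gs) \<and> \<not> (\<exists>g\<in>set gs. a \<in> set g \<and> b \<in> set g) then 1 else 0)"

lemma orthodox_generic:
  assumes x: "orthodox_indices i1 i2 i3 i4 n"
  defines "gs \<equiv> orthodox_classes i1 i2 i3 i4 n"
  shows "j < i4 + 1 \<Longrightarrow> generic gs j (i4 + 1) = (if j \<in> {i1, i1 + 1, i2, i2 + 1} then 1 else 0)"
    "i4 + 1 < j \<Longrightarrow> generic gs (i4 + 1) j = (if j = n then 1 else 0)"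
    "i1 < j \<Longrightarrow> generic gs i1 j = (if j \<in> {i3, i3 + 1, i4, i4 + 1, n} then 1 else 0)"
    "j < i1 \<Longrightarrow> generic gs j i1 = 0"
    "i2 = i3 \<Longrightarrow> generic gs i2 (i2 + 1) = 1"
    "sorted_wrt (<) (concat gs)" "set (concat gs) \<subseteq> {1..n}" "[] \<notin> set gs" "3 \<le> length gs"
    "\<forall>i\<in>set (concat gs). subst (class_pairs gs) i \<noteq> i"
  using x unfolding gs_def
  by (cases rule: orthodox_cases[OF x];
    auto simp: orthodox_classes_def orthodox_indices_def generic_def class_pairs_def)+

lemma deviant_generic:
  assumes x: "deviant_indices i1 i2 i3 i4 n"
  defines "gs \<equiv> deviant_classes i1 i2 i3 i4 n"
  shows "j < i2 + 1 \<Longrightarrow> generic gs j (i2 + 1) = (if j \<in> {i1, i1 + 1} then 1 else 0)"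
    "i2 + 1 < j \<Longrightarrow> generic gs (i2 + 1) j = (if j \<in> {i4, i4 + 1, n} then 1 else 0)"
    "j < n \<Longrightarrow> generic gs j n = (if j \<in> {i1, i1 + 1, i2, i2 + 1, i3, i3 + 1} then 1 else 0)"
    "generic gs i1 (i1 + 1) = (if i2 = i1 + 1 then 1 else 0)"
    "i3 = i4 \<Longrightarrow> generic gs i3 (i3 + 1) = 1"
    "sorted_wrt (<) (concat gs)" "set (concat gs) \<subseteq> {1..n}" "[] \<notin> set gs" "3 \<le> length gs"
    "\<forall>i\<in>set (concat gs). subst (class_pairs gs) i \<noteq> i"
  using x unfolding gs_def
  by (cases rule: deviant_cases[OF x];
    auto simp: deviant_classes_def deviant_indices_def generic_def class_pairs_def)+

text \<open>The Pluecker relation, read as multiplication of minors by \<open>wedge p q\<close>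
  under the change of basis to \<open>p\<close> and \<open>q\<close>.\<close>

lemma wedge_exchange: "wedge u p * wedge v q - wedge v p * wedge u q = wedge u v * wedge p q"
  by (simp add: wedge_def algebra_simps)

lemma coord_vec: "j \<in> {1..n} \<Longrightarrow> coord (vec n f) j = f (j - 1)"
  by (auto simp: coord_def)

lemma orthodox_cell:
  assumes x: "orthodox_indices i1 i2 i3 i4 n"
  defines "\<rho> \<equiv> subst (class_pairs (orthodox_classes i1 i2 i3 i4 n))"
  assumes V: "V \<in> positroid_cell 2 n (\<rho>, {i \<in> {1..n}. \<rho> i = i})"
  shows "\<exists>d e. d \<in> carrier_vec n \<and> e \<in> carrier_vec n \<and> represents 2 n (mat_of_rows n [d, e]) V \<and>
    (\<forall>j\<in>{1..n}. sgn (coord d j) = (if j \<in> {i1, i1 + 1, i2, i2 + 1} then 1 else if j = n then -1 else 0)) \<and>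
    (\<forall>j\<in>{1..n}. sgn (coord e j) = (if j \<in> {i3, i3 + 1, i4, i4 + 1, n} then 1 else 0)) \<and>
    (i2 = i3 \<longrightarrow> coord d i2 * coord e (i2 + 1) \<noteq> coord d (i2 + 1) * coord e i2)"
proof -
  have o: "1 \<le> i1" "i1 + 1 < i2" "i2 \<le> i3" "i3 + 1 < i4" "i4 + 1 < n" using x by (auto simp: orthodox_indices_def)
  note g = orthodox_generic[OF x]
  obtain A where A: "represents 2 n A V" and T: "\<forall>a\<in>{1..n}. \<forall>b\<in>{1..n}. a < b \<longrightarrow>
      sgn (wedge (col A (a - 1)) (col A (b - 1))) = generic (orthodox_classes i1 i2 i3 i4 n) a b"
    using cell_columns[OF V \<rho>_def[THEN meta_eq_to_obj_eq] _ g(6-9)] g(10) unfolding \<rho>_def generic_def by blast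
  define W where "W a b = wedge (col A (a - 1)) (col A (b - 1))" for a b
  have T: "sgn (W a b) = generic (orthodox_classes i1 i2 i3 i4 n) a b" if "a \<in> {1..n}" "b \<in> {1..n}" "a < b" for a b
    using T that by (simp add: W_def)
  have Wm: "W a b = - W b a" for a b by (simp add: W_def wedge_def)
  have W0: "W a a = 0" for a by (simp add: W_def wedge_def)
  \<comment> \<open>Matrix columns count from 0, so \<open>col A i4\<close> is the column numbered
    \<open>i4 + 1\<close>. In \<open>e\<close> the factor -1 turns \<open>D(j, i1)\<close> into
    \<open>D(i1, j)\<close>.\<close>
  define d where "d = vec n (\<lambda>j. wedge (col A j) (col A i4))"
  define e where "e = vec n (\<lambda>j. - 1 * wedge (col A j) (col A (i1 - 1)))"
  have r: "i1 \<in> {1..n}" "i4 + 1 \<in> {1..n}" using o by auto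
  have d: "coord d j = W j (i4 + 1)" and e: "coord e j = W i1 j" if "j \<in> {1..n}" for j
    using that Wm[of i1 j] by (simp_all add: d_def e_def coord_vec W_def)
  have "sgn (W i1 (i4 + 1)) = 1" using T[OF r] g(1)[of i1] o by simp
  then have p: "W i1 (i4 + 1) \<noteq> 0" by auto
  have "wedge (col A i4) (col A (i1 - 1)) = - W i1 (i4 + 1)"
    using Wm[of "i4 + 1" i1] by (simp add: W_def)
  then have "represents 2 n (mat_of_rows n [d, e]) V"
    unfolding d_def e_def using p by (intro represents_change_basis[OF A]) simp
  moreover have "sgn (coord d j) = (if j \<in> {i1, i1 + 1, i2, i2 + 1} then 1 else if j = n then -1 else 0)"
    if j: "j \<in> {1..n}" for j
  proof -
    consider "j < i4 + 1" | "j = i4 + 1" | "i4 + 1 < j" by linarith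
    then show ?thesis
    proof cases
      case 1
      then show ?thesis using T[OF j r(2)] g(1)[of j] d[OF j] o by auto
    next
      case 2
      then show ?thesis using d[OF j] W0 o by auto
    next
      case 3
      then show ?thesis using T[OF r(2) j] g(2)[of j] d[OF j] Wm[of j "i4 + 1"] o by (auto simp: sgn_minus)
    qed
  qed
  moreover have "sgn (coord e j) = (if j \<in> {i3, i3 + 1, i4, i4 + 1, n} then 1 else 0)"
    if j: "j \<in> {1..n}" for j
  proof -
    consider "j < i1" | "j = i1" | "i1 < j" by linarith
    then show ?thesis
    proof cases
      case 1
      then show ?thesis using T[OF j r(1)] g(4)[of j] e[OF j] Wm[of i1 j] o by (auto simp: sgn_minus)
    next
      case 2
      then show ?thesis using e[OF j] W0 o by auto
    next
      case 3
      then show ?thesis using T[OF r(1) j] g(3)[of j] e[OF j] o by auto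
    qed
  qed
  \<comment> \<open>If the second and third domino have the same index, their independence is the
    nonvanishing of the minor of columns \<open>i2\<close> and \<open>i2 + 1\<close>, up to the
    determinant of the change of basis.\<close>
  moreover have "coord d i2 * coord e (i2 + 1) \<noteq> coord d (i2 + 1) * coord e i2" if "i2 = i3"
  proof -
    have i: "i2 \<in> {1..n}" "i2 + 1 \<in> {1..n}" using o by auto
    have "sgn (W i2 (i2 + 1)) = 1" using T[OF i] g(5)[OF that] by simp
    then have "W i2 (i2 + 1) \<noteq> 0" by auto
    moreover have "coord d i2 * coord e (i2 + 1) - coord d (i2 + 1) * coord e i2 = W i2 (i2 + 1) * W i1 (i4 + 1)"
      unfolding d[OF i(1)] d[OF i(2)] e[OF i(1)] e[OF i(2)] by (simp add: W_def wedge_def algebra_simps)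
    ultimately show ?thesis using p by auto
  qed
  moreover have "d \<in> carrier_vec n" "e \<in> carrier_vec n" by (simp_all add: d_def e_def)
  ultimately show ?thesis by blast
qed

text \<open>The factor \<open>\<gamma>\<close> makes \<open>e\<close> agree with \<open>d\<close> at \<open>i1\<close>, as required for the common domino.\<close>

lemma deviant_cell:
  assumes x: "deviant_indices i1 i2 i3 i4 n"
  defines "\<rho> \<equiv> subst (class_pairs (deviant_classes i1 i2 i3 i4 n))"
  assumes V: "V \<in> positroid_cell 2 n (\<rho>, {i \<in> {1..n}. \<rho> i = i})"
  shows "\<exists>d e. d \<in> carrier_vec n \<and> e \<in> carrier_vec n \<and> represents 2 n (mat_of_rows n [d, e]) V \<and>
    (\<forall>j\<in>{1..n}. sgn (coord d j) = (if j \<in> {i1, i1 + 1} then 1 else if j \<in> {i4, i4 + 1, n} then -1 else 0)) \<and>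
    (\<forall>j\<in>{1..n}. sgn (coord e j) = (if j \<in> {i1, i1 + 1, i2, i2 + 1, i3, i3 + 1} then 1 else 0)) \<and>
    coord e i1 = coord d i1 \<and> (i1 + 1 < i2 \<longrightarrow> coord e (i1 + 1) = coord d (i1 + 1)) \<and>
    (i2 = i1 + 1 \<longrightarrow> coord d (i1 + 1) < coord e (i1 + 1)) \<and>
    (i3 = i4 \<longrightarrow> coord d i3 * coord e (i3 + 1) \<noteq> coord d (i3 + 1) * coord e i3)"
proof -
  have o: "1 \<le> i1" "i1 < i2" "i2 + 1 < i3" "i3 \<le> i4" "i4 + 1 < n" using x by (auto simp: deviant_indices_def)
  note g = deviant_generic[OF x]
  obtain A where A: "represents 2 n A V" and T: "\<forall>a\<in>{1..n}. \<forall>b\<in>{1..n}. a < b \<longrightarrow>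
      sgn (wedge (col A (a - 1)) (col A (b - 1))) = generic (deviant_classes i1 i2 i3 i4 n) a b"
    using cell_columns[OF V \<rho>_def[THEN meta_eq_to_obj_eq] _ g(6-9)] g(10) unfolding \<rho>_def generic_def by blast
  define W where "W a b = wedge (col A (a - 1)) (col A (b - 1))" for a b
  have T: "sgn (W a b) = generic (deviant_classes i1 i2 i3 i4 n) a b" if "a \<in> {1..n}" "b \<in> {1..n}" "a < b" for a b
    using T that by (simp add: W_def)
  have Wm: "W a b = - W b a" for a b by (simp add: W_def wedge_def)
  have W0: "W a a = 0" for a by (simp add: W_def wedge_def)
  have ex: "W a b * W a' b' - W a' b * W a b' = W a a' * W b b'" for a b a' b'
    unfolding W_def by (rule wedge_exchange)
  have r: "i1 \<in> {1..n}" "i1 + 1 \<in> {1..n}" "i2 + 1 \<in> {1..n}" "n \<in> {1..n}" "i3 \<in> {1..n}" "i3 + 1 \<in> {1..n}" using o by auto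
  have "sgn (W i1 (i2 + 1)) = 1" "sgn (W i1 n) = 1" "sgn (W (i2 + 1) n) = 1"
    using T[OF r(1,3)] T[OF r(1,4)] T[OF r(3,4)] g(1)[of i1] g(3)[of i1] g(3)[of "i2 + 1"] o by simp_all
  then have pos: "0 < W i1 (i2 + 1)" "0 < W i1 n" "0 < W (i2 + 1) n" by (simp_all add: sgn_1_pos)
  define \<gamma> where "\<gamma> = W i1 (i2 + 1) / W i1 n"
  have \<gamma>: "0 < \<gamma>" using pos by (simp add: \<gamma>_def)
  define d where "d = vec n (\<lambda>j. wedge (col A j) (col A i2))"
  define e where "e = vec n (\<lambda>j. \<gamma> * wedge (col A j) (col A (n - 1)))"
  have d: "coord d j = W j (i2 + 1)" and e: "coord e j = \<gamma> * W j n" if "j \<in> {1..n}" for j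
    using that by (simp_all add: d_def e_def coord_vec W_def)
  have "wedge (col A i2) (col A (n - 1)) = W (i2 + 1) n" by (simp add: W_def)
  then have "represents 2 n (mat_of_rows n [d, e]) V"
    unfolding d_def e_def using pos \<gamma> by (intro represents_change_basis[OF A]) simp
  moreover have "sgn (coord d j) = (if j \<in> {i1, i1 + 1} then 1 else if j \<in> {i4, i4 + 1, n} then -1 else 0)"
    if j: "j \<in> {1..n}" for j
  proof -
    consider "j < i2 + 1" | "j = i2 + 1" | "i2 + 1 < j" by linarith
    then show ?thesis
    proof cases
      case 1
      then show ?thesis using T[OF j r(3)] g(1)[of j] d[OF j] o by auto
    next
      case 2
      then show ?thesis using d[OF j] W0 o by auto
    next
      case 3
      then show ?thesis using T[OF r(3) j] g(2)[of j] d[OF j] Wm[of j "i2 + 1"] o by (auto simp: sgn_minus)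
    qed
  qed
  moreover have "sgn (coord e j) = (if j \<in> {i1, i1 + 1, i2, i2 + 1, i3, i3 + 1} then 1 else 0)"
    if j: "j \<in> {1..n}" for j
  proof (cases "j = n")
    case True
    then show ?thesis using e[OF j] W0 o by auto
  next
    case False
    then have "j < n" using j by simp
    then show ?thesis using T[OF j r(4)] g(3)[of j] e[OF j] \<gamma> by (simp add: sgn_mult)
  qed
  moreover have "coord e i1 = coord d i1"
    unfolding d[OF r(1)] e[OF r(1)] using pos by (simp add: \<gamma>_def)
  \<comment> \<open>By the Pluecker relation the difference is a positive multiple of the minor of
    columns \<open>i1\<close> and \<open>i1 + 1\<close>. It vanishes if these are parallel and is
    positive if the first two dominoes share column \<open>i1 + 1\<close>.\<close>
  moreover have diff: "coord e (i1 + 1) - coord d (i1 + 1) = W i1 (i1 + 1) * W (i2 + 1) n / W i1 n"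
    unfolding d[OF r(2)] e[OF r(2)] using pos ex[of i1 "i2 + 1" "i1 + 1" n] by (simp add: \<gamma>_def field_simps)
  moreover have "coord e (i1 + 1) = coord d (i1 + 1)" if "i1 + 1 < i2"
  proof -
    have "W i1 (i1 + 1) = 0" using T[OF r(1,2)] g(4) that by (simp add: sgn_0_0)
    then show ?thesis using diff by simp
  qed
  moreover have "coord d (i1 + 1) < coord e (i1 + 1)" if "i2 = i1 + 1"
  proof -
    have "0 < W i1 (i1 + 1)" using T[OF r(1,2)] g(4) that by (simp add: sgn_1_pos)
    then have "0 < W i1 (i1 + 1) * W (i2 + 1) n / W i1 n" using pos by simp
    then show ?thesis using diff by simp
  qed
  moreover have "coord d i3 * coord e (i3 + 1) \<noteq> coord d (i3 + 1) * coord e i3" if "i3 = i4"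
  proof -
    have "sgn (W i3 (i3 + 1)) = 1" using T[OF r(5,6)] g(5)[OF that] by simp
    then have "W i3 (i3 + 1) \<noteq> 0" by auto
    moreover have "coord d i3 * coord e (i3 + 1) - coord d (i3 + 1) * coord e i3 = \<gamma> * (W i3 (i3 + 1) * W (i2 + 1) n)"
      unfolding d[OF r(5)] d[OF r(6)] e[OF r(5)] e[OF r(6)] ex[of i3 "i2 + 1" "i3 + 1" n, symmetric]
      by (simp add: algebra_simps)
    ultimately show ?thesis using pos \<gamma> by auto
  qed
  moreover have "d \<in> carrier_vec n" "e \<in> carrier_vec n" by (simp_all add: d_def e_def)
  ultimately show ?thesis by blast
qed

theorem theorem10p3:
  fixes n :: nat and S :: "real vec set set"
  assumes "n \<ge> 6"
    and "S \<in> bcfw_cells 2 n"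
  shows "\<exists>c D. oplus_diagram 2 n D \<and> D \<in> instances (diagram_pattern c) \<and> S = diagram_cell 2 n D \<and>
    (\<forall>V\<in>S. \<exists>d e.
      d \<in> carrier_vec n \<and> e \<in> carrier_vec n \<and> represents 2 n (mat_of_rows n [d, e]) V \<and>
      has_sign_pattern n c d e \<and>
      (c \<in> {Class1, Class2, Class3} \<longrightarrow> orthodox n d) \<and>
      (c \<in> {Class4, Class5, Class6, Class7, Class8, Class9} \<longrightarrow> deviant n d) \<and>
      (\<exists>d1 d2 d3 d4 i1 i2 i3 i4.
        domino n i1 1 d1 \<and> domino n i2 1 d2 \<and> domino n i3 1 d3 \<and> domino n i4 1 d4 \<and>
        lin_indpt_vecs n [d1, d2, d3, d4] \<and>
        (orthodox n d \<longrightarrow>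
          i1 + 1 < i2 \<and> i2 \<le> i3 \<and> i3 < i4 - 1 \<and>
          bar n d = d1 + d2 \<and> coord d n < 0 \<and>
          bar n e = d3 + d4 \<and> coord e n > 0) \<and>
        (deviant n d \<longrightarrow>
          i1 + 1 < i2 + 1 \<and> i2 + 1 < i3 \<and> i3 \<le> i4 \<and>
          bar n d = d1 - d4 \<and> coord d n < 0 \<and>
          e = d1 + d2 + d3 \<and> coord e n = 0)))"
proof -
  let ?basis = "\<lambda>c V. \<exists>d e.
      d \<in> carrier_vec n \<and> e \<in> carrier_vec n \<and> represents 2 n (mat_of_rows n [d, e]) V \<and>
      has_sign_pattern n c d e \<and>
      (c \<in> {Class1, Class2, Class3} \<longrightarrow> orthodox n d) \<and>
      (c \<in> {Class4, Class5, Class6, Class7, Class8, Class9} \<longrightarrow> deviant n d) \<and>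
      (\<exists>d1 d2 d3 d4 i1 i2 i3 i4.
        domino n i1 1 d1 \<and> domino n i2 1 d2 \<and> domino n i3 1 d3 \<and> domino n i4 1 d4 \<and>
        lin_indpt_vecs n [d1, d2, d3, d4] \<and>
        (orthodox n d \<longrightarrow>
          i1 + 1 < i2 \<and> i2 \<le> i3 \<and> i3 < i4 - 1 \<and>
          bar n d = d1 + d2 \<and> coord d n < 0 \<and>
          bar n e = d3 + d4 \<and> coord e n > 0) \<and>
        (deviant n d \<longrightarrow>
          i1 + 1 < i2 + 1 \<and> i2 + 1 < i3 \<and> i3 \<le> i4 \<and>
          bar n d = d1 - d4 \<and> coord d n < 0 \<and>
          e = d1 + d2 + d3 \<and> coord e n = 0))"
  from assms(2) obtain G where G: "bcfw_graph n 4 G"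
    and S: "S = positroid_cell 2 n (cyc n \<circ> cyc n \<circ> trip_perm G,
      {i \<in> {1..n}. (cyc n \<circ> cyc n \<circ> trip_perm G) i = i})"
    unfolding bcfw_cells_def bcfw_perms_def by auto
  obtain B \<rho> where re: "reachable n 4 B \<rho>" and mo: "models G n B \<rho>"
    using bcfw_graph_reachable[OF G] by blast
  have "cyc n \<circ> cyc n \<circ> trip_perm G = \<rho>" using models_trip_perm[OF mo] by (auto simp: fun_eq_iff)
  then have S: "S = positroid_cell 2 n (\<rho>, {i \<in> {1..n}. \<rho> i = i})" using S by simp
  obtain i1 i2 i3 i4 where
    "orthodox_indices i1 i2 i3 i4 n \<and> \<rho> = subst (class_pairs (orthodox_classes i1 i2 i3 i4 n)) \<or>
     deviant_indices i1 i2 i3 i4 n \<and> \<rho> = subst (class_pairs (deviant_classes i1 i2 i3 i4 n))"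
    using reachable_cell_perm[OF re] unfolding cell_perm_def by blast
  then show ?thesis
  proof (elim disjE conjE)
    assume x: "orthodox_indices i1 i2 i3 i4 n"
      and \<rho>: "\<rho> = subst (class_pairs (orthodox_classes i1 i2 i3 i4 n))"
    define c where "c = orthodox_class i2 i3"
    have c: "c \<in> {Class1, Class2, Class3}" "c \<notin> {Class4, Class5, Class6, Class7, Class8, Class9}"
      by (auto simp: c_def orthodox_class_def)
    define D where "D = orthodox_diagram i1 i2 i3 i4 n"
    have D: "oplus_diagram 2 n D" "D \<in> instances (diagram_pattern c)" "S = diagram_cell 2 n D"
      using orthodox_diagram_perm[OF x] orthodox_diagram_pattern[OF x]
      unfolding D_def c_def diagram_cell_def S \<rho> by simp_all
    show ?thesis
    proof (intro exI[of _ c] exI[of _ D] conjI ballI D)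
      fix V assume "V \<in> S"
      then obtain d e where de: "d \<in> carrier_vec n" "e \<in> carrier_vec n" "represents 2 n (mat_of_rows n [d, e]) V"
        and s: "\<forall>j\<in>{1..n}. sgn (coord d j) = (if j \<in> {i1, i1 + 1, i2, i2 + 1} then 1 else if j = n then -1 else 0)"
          "\<forall>j\<in>{1..n}. sgn (coord e j) = (if j \<in> {i3, i3 + 1, i4, i4 + 1, n} then 1 else 0)"
        and np: "i2 = i3 \<longrightarrow> coord d i2 * coord e (i2 + 1) \<noteq> coord d (i2 + 1) * coord e i2"
        using orthodox_cell[OF x] unfolding S \<rho> by blast
      have sp: "has_sign_pattern n c d e"
        unfolding c_def using s by (intro orthodox_sign_pattern[OF x]) blast+
      from orthodox_dominoes[OF x de(1,2)] s np obtain d1 d2 d3 d4 where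
        od: "orthodox n d" "\<not> deviant n d" and
        dom: "domino n i1 1 d1 \<and> domino n i2 1 d2 \<and> domino n i3 1 d3 \<and> domino n i4 1 d4 \<and>
          lin_indpt_vecs n [d1, d2, d3, d4] \<and> i1 + 1 < i2 \<and> i2 \<le> i3 \<and> i3 < i4 - 1 \<and>
          bar n d = d1 + d2 \<and> coord d n < 0 \<and> bar n e = d3 + d4 \<and> coord e n > 0"
        by blast
      show "?basis c V"
        by (rule exI[of _ d], rule exI[of _ e], intro conjI de sp, use c od in blast, use c od in blast,
            rule exI[of _ d1], rule exI[of _ d2], rule exI[of _ d3], rule exI[of _ d4],
            rule exI[of _ i1], rule exI[of _ i2], rule exI[of _ i3], rule exI[of _ i4],
            use dom od in simp)
    qed
  next
    assume x: "deviant_indices i1 i2 i3 i4 n"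
      and \<rho>: "\<rho> = subst (class_pairs (deviant_classes i1 i2 i3 i4 n))"
    define c where "c = deviant_class i1 i2 i3 i4"
    have c: "c \<notin> {Class1, Class2, Class3}" by (auto simp: c_def deviant_class_def)
    define D where "D = deviant_diagram i1 i2 i3 i4 n"
    have D: "oplus_diagram 2 n D" "D \<in> instances (diagram_pattern c)" "S = diagram_cell 2 n D"
      using deviant_diagram_perm[OF x] deviant_diagram_pattern[OF x]
      unfolding D_def c_def diagram_cell_def S \<rho> by simp_all
    show ?thesis
    proof (intro exI[of _ c] exI[of _ D] conjI ballI D)
      fix V assume "V \<in> S"
      then obtain d e where de: "d \<in> carrier_vec n" "e \<in> carrier_vec n" "represents 2 n (mat_of_rows n [d, e]) V"
        and s: "\<forall>j\<in>{1..n}. sgn (coord d j) = (if j \<in> {i1, i1 + 1} then 1 else if j \<in> {i4, i4 + 1, n} then -1 else 0)"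
          "\<forall>j\<in>{1..n}. sgn (coord e j) = (if j \<in> {i1, i1 + 1, i2, i2 + 1, i3, i3 + 1} then 1 else 0)"
        and eq: "coord e i1 = coord d i1" "i1 + 1 < i2 \<longrightarrow> coord e (i1 + 1) = coord d (i1 + 1)"
          "i2 = i1 + 1 \<longrightarrow> coord d (i1 + 1) < coord e (i1 + 1)"
          "i3 = i4 \<longrightarrow> coord d i3 * coord e (i3 + 1) \<noteq> coord d (i3 + 1) * coord e i3"
        using deviant_cell[OF x] unfolding S \<rho> by blast
      have sp: "has_sign_pattern n c d e"
        unfolding c_def using s by (intro deviant_sign_pattern[OF x]) blast+
      from deviant_dominoes[OF x de(1,2)] s eq obtain d1 d2 d3 d4 where
        od: "deviant n d" "\<not> orthodox n d" and
        dom: "domino n i1 1 d1 \<and> domino n i2 1 d2 \<and> domino n i3 1 d3 \<and> domino n i4 1 d4 \<and>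
          lin_indpt_vecs n [d1, d2, d3, d4] \<and> i1 + 1 < i2 + 1 \<and> i2 + 1 < i3 \<and> i3 \<le> i4 \<and>
          bar n d = d1 - d4 \<and> coord d n < 0 \<and> e = d1 + d2 + d3 \<and> coord e n = 0"
        by blast
      show "?basis c V"
        by (rule exI[of _ d], rule exI[of _ e], intro conjI de sp, use c od in blast, use c od in blast,
            rule exI[of _ d1], rule exI[of _ d2], rule exI[of _ d3], rule exI[of _ d4],
            rule exI[of _ i1], rule exI[of _ i2], rule exI[of _ i3], rule exI[of _ i4],
            use dom od in blast)
    qed
  qed
qed

end
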